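(* Let $Q=\begin{pmatrix} a_1 & a_2\\ a_3 & a_4\end{pmatrix}$, where $a_1,a_2,a_3,a_4:\mathbb{R}\to\mathbb{C}$ are $\pi$-periodic functions of bounded variation on $[0,\pi]$, and let $L(Q)$ be the Dirac operator generated in $L_2^2(-\infty,\infty)$ by $l(\mathbf{y},Q)=J\mathbf{y}'+Q\mathbf{y}$, $J=\begin{pmatrix}0&1\\-1&0\end{pmatrix}$. If $$\operatorname{Re}\int_0^\pi \bigl(a_3(x)-a_2(x)\bigr)\,dx\neq 0,$$ then $L(Q)$ is an asymptotically spectral operator.
   Context: $L_2^2(I)$ denotes the Hilbert space of square-integrable $\mathbb{C}^2$-valued functions on the interval $I$. For $t\in(-1,1]$, $L_t(Q)$ denotes the operator generated in $L_2^2[0,\pi]$ by the differential expression $l(\mathbf{y},Q)=J\mathbf{y}'+Q\mathbf{y}$ and the boundary condition $\mathbf{y}(\pi)=e^{i\pi t}\mathbf{y}(0)$; $\rho(L_t(Q))$ is its resolvent set. For a (simple) closed contour $\gamma(t)\subset\rho(L_t(Q))$ put $$e(\gamma(t))=\int_{\gamma(t)}\bigl(L_t(Q)-\lambda I\bigr)^{-1}\,d\lambda .$$ Definition. $L(Q)$ is called a spectral operator if $\sup_{t\in(-1,1]}\sup_{\gamma(t)}\|e(\gamma(t))\|<\infty$, where the inner supremum is over all closed contours $\gamma(t)\subset\rho(L_t(Q))$. $L(Q)$ is called an asymptotically spectral operator if there exists $M>0$ such that $\sup_{t\in(-1,1]}\sup_{\gamma(t)}\|e(\gamma(t))\|<\infty$,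 where the inner supremum is over all closed contours $\gamma(t)\subset\{\lambda\in\mathbb{C}:|\lambda|>M\}\cap\rho(L_t(Q))$. *)

theory Defs
  imports "HOL-Analysis.Analysis"
begin

section \<open>The Hilbert space of square-integrable functions from the interval to pairs\<close>

abbreviation interval_measure :: "real measure"
  where "interval_measure \<equiv> lebesgue_on {0..pi}"

definition square_integrable :: "(real \<Rightarrow> complex^2) \<Rightarrow> bool" where
  "square_integrable f \<longleftrightarrow>
     f \<in> borel_measurable interval_measure \<and> integrable interval_measure (\<lambda>x. (norm (f x))\<^sup>2)"

definition L2_rel :: "(real \<Rightarrow> complex^2) \<Rightarrow> (real \<Rightarrow> complex^2) \<Rightarrow> bool" where
  "L2_rel f g \<longleftrightarrow> square_integrable f \<and> square_integrable g \<and> (AE x in interval_measure. f x = g x)"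

lemma square_integrable_zero: "square_integrable (\<lambda>x. 0)"
  by (simp add: square_integrable_def)

lemma square_integrable_measurable [measurable_dest]:
  "square_integrable f \<Longrightarrow> f \<in> borel_measurable interval_measure"
  by (simp add: square_integrable_def)

lemma square_integrable_bound:
  assumes "f \<in> borel_measurable interval_measure" "integrable interval_measure h"
    and "\<And>x. (norm (f x))\<^sup>2 \<le> h x"
  shows "square_integrable f"
  unfolding square_integrable_def
proof
  show "integrable interval_measure (\<lambda>x. (norm (f x))\<^sup>2)"
    using assms by (intro Bochner_Integration.integrable_bound[OF assms(2)])
      (auto intro!: AE_I2 order_trans[OF assms(3)])
qed (fact assms(1))

lemma square_integrable_add:
  assumes "square_integrable f" "square_integrable g"
  shows "square_integrable (\<lambda>x. f x + g x)"
proof (rule square_integrable_bound)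
  show "(\<lambda>x. f x + g x) \<in> borel_measurable interval_measure"
    using assms by (auto simp: square_integrable_def)
  show "integrable interval_measure (\<lambda>x. 2 * (norm (f x))\<^sup>2 + 2 * (norm (g x))\<^sup>2)"
    using assms by (auto simp: square_integrable_def)
  fix x
  have "(norm (f x + g x))\<^sup>2 \<le> (norm (f x) + norm (g x))\<^sup>2"
    by (intro power_mono norm_triangle_ineq) auto
  also have "\<dots> \<le> 2 * (norm (f x))\<^sup>2 + 2 * (norm (g x))\<^sup>2"
    using sum_squares_bound[of "norm (f x)" "norm (g x)"] by (simp add: power2_sum)
  finally show "(norm (f x + g x))\<^sup>2 \<le> 2 * (norm (f x))\<^sup>2 + 2 * (norm (g x))\<^sup>2" .
qed

lemma norm_vector_scalar_mult: "norm (c *s (v :: complex^2)) = cmod c * norm v"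
  by (simp add: norm_vec_def vector_scalar_mult_def norm_mult L2_set_right_distrib)

lemma linear_vector_scalar_mult: "linear ((*s) (c::complex) :: complex^2 \<Rightarrow> _)"
  by (rule linearI) (auto simp: vec_eq_iff algebra_simps)

lemma measurable_vector_scalar_mult:
  assumes "f \<in> borel_measurable M"
  shows "(\<lambda>x. (c::complex) *s (f x :: complex^2)) \<in> borel_measurable M"
  using borel_measurable_continuous_onI[OF linear_continuous_on[OF
      linear_conv_bounded_linear[THEN iffD1, OF linear_vector_scalar_mult]]] assms
  by (rule measurable_compose[rotated])

lemma square_integrable_scale:
  assumes "square_integrable f"
  shows "square_integrable (\<lambda>x. c *s f x)"
proof (rule square_integrable_bound)
  show "(\<lambda>x. c *s f x) \<in> borel_measurable interval_measure"
    using assms by (auto simp: square_integrable_def intro: measurable_vector_scalar_mult)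
  show "integrable interval_measure (\<lambda>x. (cmod c)\<^sup>2 * (norm (f x))\<^sup>2)"
    using assms by (auto simp: square_integrable_def)
qed (simp add: norm_vector_scalar_mult power_mult_distrib)

lemma square_integrable_scaleR:
  assumes "square_integrable f"
  shows "square_integrable (\<lambda>x. r *\<^sub>R f x)"
proof -
  have "complex_of_real r *s v = r *\<^sub>R v" for v :: "complex^2"
    by (simp add: vec_eq_iff scaleR_conv_of_real[where 'a = complex])
  with square_integrable_scale[OF assms, of "complex_of_real r"] show ?thesis by simp
qed

lemma square_integrable_diff:
  assumes "square_integrable f" "square_integrable g"
  shows "square_integrable (\<lambda>x. f x - g x)"
  using square_integrable_add[OF assms(1) square_integrable_scaleR[OF assms(2), of "-1"]] by simp

lemma integrable_inner:
  assumes "square_integrable f" "square_integrable g"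
  shows "integrable interval_measure (\<lambda>x. f x \<bullet> g x)"
proof (rule Bochner_Integration.integrable_bound)
  show "integrable interval_measure (\<lambda>x. (norm (f x))\<^sup>2 + (norm (g x))\<^sup>2)"
    using assms by (auto simp: square_integrable_def)
  show "(\<lambda>x. f x \<bullet> g x) \<in> borel_measurable interval_measure"
    using assms by (auto simp: square_integrable_def)
  show "AE x in interval_measure. norm (f x \<bullet> g x) \<le> norm ((norm (f x))\<^sup>2 + (norm (g x))\<^sup>2)"
  proof (rule AE_I2)
    fix x
    have "norm (f x \<bullet> g x) \<le> norm (f x) * norm (g x)"
      by (simp add: Cauchy_Schwarz_ineq2)
    also have "\<dots> \<le> (norm (f x))\<^sup>2 + (norm (g x))\<^sup>2"
      using sum_squares_bound[of "norm (f x)" "norm (g x)"]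
        mult_nonneg_nonneg[OF norm_ge_zero[of "f x"] norm_ge_zero[of "g x"]] by linarith
    finally show "norm (f x \<bullet> g x) \<le> norm ((norm (f x))\<^sup>2 + (norm (g x))\<^sup>2)" by simp
  qed
qed

quotient_type L2 = "real \<Rightarrow> complex^2" / partial: L2_rel
  morphisms rep_L2 L2_class
proof (rule part_equivpI)
  show "\<exists>x. L2_rel x x"
    by (rule exI[of _ "\<lambda>x. 0"]) (simp add: L2_rel_def square_integrable_zero)
  show "symp L2_rel"
    by (auto simp: symp_def L2_rel_def)
  show "transp L2_rel"
    by (auto simp: transp_def L2_rel_def elim: AE_mp)
qed

lift_definition scaleC_L2 :: "complex \<Rightarrow> L2 \<Rightarrow> L2" (infixr \<open>*\<^sub>C\<close> 75) is "\<lambda>c f x. c *s f x"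
  by (auto simp: L2_rel_def square_integrable_scale)

text \<open>The real inner product below is the real part of the Hermitian one, so that the norm
  is the usual norm of the complex Hilbert space.\<close>

instantiation L2 :: real_inner
begin

lift_definition zero_L2 :: L2 is "\<lambda>x. 0"
  by (simp add: L2_rel_def square_integrable_zero)

lift_definition plus_L2 :: "L2 \<Rightarrow> L2 \<Rightarrow> L2" is "\<lambda>f g x. f x + g x"
  by (auto simp: L2_rel_def square_integrable_add)

lift_definition minus_L2 :: "L2 \<Rightarrow> L2 \<Rightarrow> L2" is "\<lambda>f g x. f x - g x"
  by (auto simp: L2_rel_def square_integrable_diff)

lift_definition uminus_L2 :: "L2 \<Rightarrow> L2" is "\<lambda>f x. - f x"
  using square_integrable_scaleR[of _ "-1"] by (auto simp: L2_rel_def)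

lift_definition scaleR_L2 :: "real \<Rightarrow> L2 \<Rightarrow> L2" is "\<lambda>r f x. r *\<^sub>R f x"
  by (auto simp: L2_rel_def square_integrable_scaleR)

lift_definition inner_L2 :: "L2 \<Rightarrow> L2 \<Rightarrow> real" is "\<lambda>f g. \<integral>x. f x \<bullet> g x \<partial>interval_measure"
  by (auto simp: L2_rel_def square_integrable_def intro!: integral_cong_AE)

definition norm_L2 :: "L2 \<Rightarrow> real" where "norm_L2 f = sqrt (f \<bullet> f)"
definition sgn_L2 :: "L2 \<Rightarrow> L2" where "sgn_L2 f = inverse (norm f) *\<^sub>R f"
definition dist_L2 :: "L2 \<Rightarrow> L2 \<Rightarrow> real" where "dist_L2 f g = norm (f - g)"
definition uniformity_L2 :: "(L2 \<times> L2) filter"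
  where "uniformity_L2 = (INF e\<in>{0 <..}. principal {(x, y). dist x y < e})"
definition open_L2 :: "L2 set \<Rightarrow> bool"
  where "open_L2 U \<longleftrightarrow> (\<forall>x\<in>U. \<forall>\<^sub>F (x', y) in uniformity. x' = x \<longrightarrow> y \<in> U)"

instance
proof
  fix a b c :: L2 and r s :: real and U :: "L2 set"
  show "a + b + c = a + (b + c)"
    by transfer (auto simp: L2_rel_def add.assoc intro!: square_integrable_add)
  show "a + b = b + a"
    by transfer (auto simp: L2_rel_def add.commute intro!: square_integrable_add)
  show "0 + a = a"
    by transfer (auto simp: L2_rel_def)
  show "- a + a = 0"
    by transfer (auto simp: L2_rel_def square_integrable_zero)
  show "a - b = a + - b"
    by transfer (auto simp: L2_rel_def square_integrable_diff)
  show "r *\<^sub>R (a + b) = r *\<^sub>R a + r *\<^sub>R b"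
    by transfer (auto simp: L2_rel_def scaleR_add_right
        intro!: square_integrable_add square_integrable_scaleR)
  show "(r + s) *\<^sub>R a = r *\<^sub>R a + s *\<^sub>R a"
    by transfer (auto simp: L2_rel_def scaleR_add_left
        intro!: square_integrable_add square_integrable_scaleR)
  show "r *\<^sub>R s *\<^sub>R a = (r * s) *\<^sub>R a"
    by transfer (auto simp: L2_rel_def intro!: square_integrable_scaleR)
  show "1 *\<^sub>R a = a"
    by transfer (auto simp: L2_rel_def)
  show "a \<bullet> b = b \<bullet> a"
    by transfer (simp add: inner_commute)
  show "(a + b) \<bullet> c = a \<bullet> c + b \<bullet> c"
    by transfer (simp add: L2_rel_def inner_add_left integrable_inner)
  show "r *\<^sub>R a \<bullet> b = r * (a \<bullet> b)"
    by transfer (simp add: L2_rel_def)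
  show "0 \<le> a \<bullet> a"
    by transfer (simp add: integral_nonneg)
  show "a \<bullet> a = 0 \<longleftrightarrow> a = 0"
  proof transfer
    fix f :: "real \<Rightarrow> complex^2"
    assume "L2_rel f f"
    then have f: "square_integrable f" by (simp add: L2_rel_def)
    have "(\<integral>x. f x \<bullet> f x \<partial>interval_measure) = 0 \<longleftrightarrow> (AE x in interval_measure. f x \<bullet> f x = 0)"
      by (rule integral_nonneg_eq_0_iff_AE[OF integrable_inner[OF f f]]) simp
    then show "(\<integral>x. f x \<bullet> f x \<partial>interval_measure) = 0 \<longleftrightarrow> L2_rel f (\<lambda>x. 0)"
      using f by (simp add: L2_rel_def square_integrable_zero)
  qed
qed (simp_all only: norm_L2_def sgn_L2_def dist_L2_def uniformity_L2_def open_L2_def)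

end

lemma norm_L2_class:
  assumes "square_integrable f"
  shows "(norm (L2_class f))\<^sup>2 = (\<integral>x. (norm (f x))\<^sup>2 \<partial>interval_measure)"
proof -
  have "L2_rel f f" using assms by (simp add: L2_rel_def)
  then have "L2_class f \<bullet> L2_class f = (\<integral>x. f x \<bullet> f x \<partial>interval_measure)"
    by (simp add: inner_L2.abs_eq)
  then show ?thesis by (simp add: power2_norm_eq_inner)
qed

lemma scaleC_L2_simps:
  "z *\<^sub>C (a + b) = z *\<^sub>C a + z *\<^sub>C b"
  "z *\<^sub>C (r *\<^sub>R a) = r *\<^sub>R (z *\<^sub>C a)"
  "norm (z *\<^sub>C a) = cmod z * norm a"
proof -
  show "z *\<^sub>C (a + b) = z *\<^sub>C a + z *\<^sub>C b"
    by transfer (auto simp: L2_rel_def linear_add[OF linear_vector_scalar_mult]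
        intro!: square_integrable_add square_integrable_scale)
  show "z *\<^sub>C (r *\<^sub>R a) = r *\<^sub>R (z *\<^sub>C a)"
    by transfer (auto simp: L2_rel_def linear_scale[OF linear_vector_scalar_mult]
        intro!: square_integrable_scaleR square_integrable_scale)
  have "z *\<^sub>C a \<bullet> z *\<^sub>C a = (cmod z)\<^sup>2 * (a \<bullet> a)"
    by transfer
      (simp add: power2_norm_eq_inner[symmetric] norm_vector_scalar_mult power_mult_distrib)
  then show "norm (z *\<^sub>C a) = cmod z * norm a"
    by (simp add: norm_eq_sqrt_inner real_sqrt_mult)
qed

lemma square_integrable_nn_integral:
  assumes [measurable]: "f \<in> borel_measurable interval_measure"
    and "(\<integral>\<^sup>+x. ennreal ((norm (f x))\<^sup>2) \<partial>interval_measure) < \<infinity>"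
  shows "square_integrable f"
  using assms by (simp add: square_integrable_def integrable_iff_bounded)

lemma nn_integral_norm_L2_class:
  assumes "square_integrable f"
  shows "(\<integral>\<^sup>+x. ennreal ((norm (f x))\<^sup>2) \<partial>interval_measure) = ennreal ((norm (L2_class f))\<^sup>2)"
  using assms by (simp add: norm_L2_class nn_integral_eq_integral square_integrable_def)

lemma L2_class_surj: obtains f where "square_integrable f" "a = L2_class f"
  by (metis L2_rel_def Quotient_L2 Quotient_rel_rep Quotient_abs_rep)

lemma L2_class_diff:
  assumes "square_integrable f" "square_integrable g"
  shows "L2_class f - L2_class g = L2_class (\<lambda>x. f x - g x)"
  using assms by (intro minus_L2.abs_eq) (auto simp: L2_rel_def)

lemma ennreal_power2_le_imp_le:
  assumes "(x::ennreal)\<^sup>2 \<le> (ennreal c)\<^sup>2" "0 \<le> c"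
  shows "x \<le> ennreal c"
proof (cases x)
  case (real a)
  then show ?thesis
    using assms by (auto simp: ennreal_power intro!: ennreal_leI power2_le_imp_le)
next
  case top
  then show ?thesis using assms by (simp add: ennreal_power top_unique)
qed

lemma nn_integral_norm_le_L2:
  assumes "square_integrable f"
  shows "(\<integral>\<^sup>+x. ennreal (norm (f x)) \<partial>interval_measure) \<le> ennreal (sqrt pi * norm (L2_class f))"
proof -
  have [measurable]: "f \<in> borel_measurable interval_measure"
    using assms by (simp add: square_integrable_def)
  have em: "emeasure interval_measure (space interval_measure) = ennreal pi"
    by (simp add: emeasure_restrict_space space_restrict_space)
  have "(\<integral>\<^sup>+x. ennreal (norm (f x)) * 1 \<partial>interval_measure)\<^sup>2
      \<le> (\<integral>\<^sup>+x. (ennreal (norm (f x)))\<^sup>2 \<partial>interval_measure) * (\<integral>\<^sup>+x. 1\<^sup>2 \<partial>interval_measure)"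
    by (rule Cauchy_Schwarz_nn_integral) auto
  also have "\<dots> = ennreal ((norm (L2_class f))\<^sup>2) * ennreal pi"
    using nn_integral_norm_L2_class[OF assms] em by (simp add: ennreal_power)
  also have "\<dots> = (ennreal (sqrt pi * norm (L2_class f)))\<^sup>2"
    by (simp add: ennreal_power ennreal_mult[symmetric] power_mult_distrib mult.commute)
  finally show ?thesis
    by (intro ennreal_power2_le_imp_le) auto
qed

instance L2 :: banach
proof
  fix X :: "nat \<Rightarrow> L2"
  assume cauchy: "Cauchy X"
  have "\<exists>f. square_integrable f \<and> X n = L2_class f" for n
    by (metis L2_class_surj)
  then obtain f where f: "\<And>n. square_integrable (f n)" and X: "\<And>n. X n = L2_class (f n)"
    by metis
  have [measurable]: "f n \<in> borel_measurable interval_measure" for n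
    using f by (simp add: square_integrable_def)
  have diff: "square_integrable (\<lambda>x. f m x - f n x)"
    "L2_class (\<lambda>x. f m x - f n x) = X m - X n" for m n
    using f X by (auto simp: square_integrable_diff L2_class_diff)
  have "\<exists>N. \<forall>m\<ge>N. \<forall>n\<ge>N. norm (X m - X n) < (1/2)^k" for k
    using CauchyD[OF cauchy, of "(1/2)^k"] by auto
  then obtain N where N: "\<And>k m n. m \<ge> N k \<Longrightarrow> n \<ge> N k \<Longrightarrow> norm (X m - X n) < (1/2)^k"
    by metis
  define r where "r k = (\<Sum>i\<le>k. N i) + k" for k
  have rN: "r m \<ge> N k" if "k \<le> m" for k m
  proof -
    have "N k \<le> (\<Sum>i\<le>m. N i)" using that by (intro member_le_sum) auto
    then show ?thesis by (simp add: r_def)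
  qed
  have step: "norm (X (r m) - X (r k)) < (1/2)^k" if "k \<le> m" for k m
    using that by (intro N rN) auto
  have "(\<integral>\<^sup>+x. (\<Sum>k. ennreal (norm (f (r (Suc k)) x - f (r k) x))) \<partial>interval_measure)
      = (\<Sum>k. \<integral>\<^sup>+x. ennreal (norm (f (r (Suc k)) x - f (r k) x)) \<partial>interval_measure)"
    by (intro nn_integral_suminf) auto
  also have "\<dots> \<le> (\<Sum>k. ennreal (sqrt pi * (1/2)^k))"
  proof (intro suminf_le allI)
    fix k
    have "(\<integral>\<^sup>+x. ennreal (norm (f (r (Suc k)) x - f (r k) x)) \<partial>interval_measure)
      \<le> ennreal (sqrt pi * norm (X (r (Suc k)) - X (r k)))"
      using nn_integral_norm_le_L2[OF diff(1)] by (simp add: diff(2))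
    also have "\<dots> \<le> ennreal (sqrt pi * (1/2)^k)"
      using step[of k "Suc k"] by (intro ennreal_leI mult_left_mono) auto
    finally show "(\<integral>\<^sup>+x. ennreal (norm (f (r (Suc k)) x - f (r k) x)) \<partial>interval_measure)
      \<le> ennreal (sqrt pi * (1/2)^k)" .
  qed auto
  also have "\<dots> = ennreal (\<Sum>k. sqrt pi * (1/2)^k)"
    by (intro suminf_ennreal2) (auto intro!: summable_mult summable_geometric)
  also have "\<dots> < \<infinity>" by simp
  finally have "AE x in interval_measure.
      (\<Sum>k. ennreal (norm (f (r (Suc k)) x - f (r k) x))) \<noteq> \<infinity>"
    by (intro nn_integral_PInf_AE) auto
  then have conv: "AE x in interval_measure. convergent (\<lambda>k. f (r k) x)"
  proof eventually_elim
    case (elim x)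
    then have "summable (\<lambda>k. norm (f (r (Suc k)) x - f (r k) x))"
      by (intro summable_suminf_not_top) auto
    then have "summable (\<lambda>k. f (r (Suc k)) x - f (r k) x)"
      by (rule summable_norm_cancel)
    then have "convergent (\<lambda>n. (\<Sum>k<n. f (r (Suc k)) x - f (r k) x) + f (r 0) x)"
      by (intro convergent_add convergent_const) (simp add: summable_iff_convergent)
    then show ?case by (simp add: sum_lessThan_telescope[of "\<lambda>k. f (r k) x"])
  qed
  define F where "F x = lim (\<lambda>k. f (r k) x)" for x
  have [measurable]: "F \<in> borel_measurable interval_measure"
    unfolding F_def by (intro borel_measurable_lim_metric) auto
  have fatou: "(\<integral>\<^sup>+x. ennreal ((norm (F x - f (r k) x))\<^sup>2) \<partial>interval_measure) \<le> ennreal (((1/2)^k)\<^sup>2)"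
    for k
  proof -
    have "(\<integral>\<^sup>+x. ennreal ((norm (F x - f (r k) x))\<^sup>2) \<partial>interval_measure)
      = (\<integral>\<^sup>+x. liminf (\<lambda>m. ennreal ((norm (f (r m) x - f (r k) x))\<^sup>2)) \<partial>interval_measure)"
    proof (rule nn_integral_cong_AE)
      show "AE x in interval_measure. ennreal ((norm (F x - f (r k) x))\<^sup>2)
        = liminf (\<lambda>m. ennreal ((norm (f (r m) x - f (r k) x))\<^sup>2))"
        using conv
      proof eventually_elim
        case (elim x)
        then have "(\<lambda>m. f (r m) x) \<longlonglongrightarrow> F x"
          by (simp add: F_def convergent_LIMSEQ_iff)
        then have "(\<lambda>m. ennreal ((norm (f (r m) x - f (r k) x))\<^sup>2))
          \<longlonglongrightarrow> ennreal ((norm (F x - f (r k) x))\<^sup>2)"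
          by (intro tendsto_intros)
        then show ?case by (rule lim_imp_Liminf[OF sequentially_bot, symmetric])
      qed
    qed
    also have "\<dots> \<le> liminf (\<lambda>m. \<integral>\<^sup>+x. ennreal ((norm (f (r m) x - f (r k) x))\<^sup>2) \<partial>interval_measure)"
      by (intro nn_integral_liminf) auto
    also have "\<dots> \<le> ennreal (((1/2)^k)\<^sup>2)"
    proof (rule Liminf_le)
      show "\<forall>\<^sub>F m in sequentially. (\<integral>\<^sup>+x. ennreal ((norm (f (r m) x - f (r k) x))\<^sup>2) \<partial>interval_measure)
          \<le> ennreal (((1/2)^k)\<^sup>2)"
        using eventually_ge_at_top[of k]
      proof eventually_elim
        case (elim m)
        then show ?case
          using step[OF elim] nn_integral_norm_L2_class[OF diff(1), of "r m" "r k"]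
          by (auto simp: diff(2) intro!: ennreal_leI power_mono)
      qed
    qed auto
    finally show ?thesis .
  qed
  have Fd: "square_integrable (\<lambda>x. F x - f (r k) x)" for k
    by (rule square_integrable_nn_integral) (use fatou[of k] in \<open>auto intro: le_less_trans\<close>)
  have F: "square_integrable F"
    using square_integrable_add[OF Fd[of 0] f[of "r 0"]] by simp
  have bound: "norm (L2_class F - X (r k)) \<le> (1/2)^k" for k
  proof -
    have "ennreal ((norm (L2_class F - X (r k)))\<^sup>2) \<le> ennreal (((1/2)^k)\<^sup>2)"
      using fatou[of k] nn_integral_norm_L2_class[OF Fd[of k]] F f
      by (simp add: X L2_class_diff)
    then show ?thesis by (auto intro: power2_le_imp_le)
  qed
  have "X \<longlonglongrightarrow> L2_class F"
  proof (rule LIMSEQ_I)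
    fix e :: real assume "0 < e"
    then obtain k where k: "(1/2::real)^k < e/2"
      using real_arch_pow_inv[of "e/2" "1/2"] by auto
    have "norm (X n - L2_class F) < e" if "n \<ge> N k" for n
    proof -
      have "norm (X n - L2_class F) \<le> norm (X n - X (r k)) + norm (L2_class F - X (r k))"
        by (metis norm_triangle_ineq4 diff_diff_eq2 diff_add_cancel add_diff_eq)
      also have "\<dots> < e/2 + e/2"
        using N[OF that rN[of k k]] bound[of k] k by linarith
      finally show ?thesis by simp
    qed
    then show "\<exists>no. \<forall>n\<ge>no. norm (X n - L2_class F) < e" by blast
  qed
  then show "convergent X" by (auto simp: convergent_def)
qed


section \<open>The Dirac operators on the interval and their resolvents\<close>

definition dirac_J :: "complex^2^2" where
  "dirac_J = vector [vector [0, 1], vector [-1, 0]]"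

text \<open>Absolute continuity on \<open>[0,\<pi>]\<close> in Lebesgue's form: \<open>u\<close> is the indefinite integral of an
  integrable function \<open>u'\<close>, which is then its derivative almost everywhere.\<close>

definition ac_with_derivative :: "(real \<Rightarrow> complex^2) \<Rightarrow> (real \<Rightarrow> complex^2) \<Rightarrow> bool" where
  "ac_with_derivative u u' \<longleftrightarrow>
     u' absolutely_integrable_on {0..pi} \<and> (\<forall>x\<in>{0..pi}. u x = u 0 + integral {0..x} u')"

text \<open>Unbounded operators are represented by their graphs; the domain of \<open>dirac_operator Q t\<close>
  consists of all absolutely continuous functions \<open>u\<close> with \<open>J u' + Q u\<close> square integrable that
  satisfy the boundary condition.\<close>

definition dirac_operator :: "(real \<Rightarrow> complex^2^2) \<Rightarrow> real \<Rightarrow> (L2 \<times> L2) set" where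
  "dirac_operator Q t =
     {(L2_class u, L2_class (\<lambda>x. dirac_J *v u' x + Q x *v u x)) | u u'.
        ac_with_derivative u u' \<and>
        square_integrable (\<lambda>x. dirac_J *v u' x + Q x *v u x) \<and>
        u pi = exp (\<i> * of_real (pi * t)) *s u 0}"

text \<open>The inverse relation of \<open>A - z\<close> is the graph of the everywhere defined bounded operator \<open>R\<close>.\<close>

definition is_resolvent :: "(L2 \<times> L2) set \<Rightarrow> complex \<Rightarrow> (L2 \<Rightarrow>\<^sub>L L2) \<Rightarrow> bool" where
  "is_resolvent A z R \<longleftrightarrow> {(g - z *\<^sub>C y, y) | y g. (y, g) \<in> A} = {(f, R f) | f. True}"

definition resolvent_set :: "(L2 \<times> L2) set \<Rightarrow> complex set" where
  "resolvent_set A = {z. \<exists>R. is_resolvent A z R}"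

definition resolvent :: "(L2 \<times> L2) set \<Rightarrow> complex \<Rightarrow> (L2 \<Rightarrow>\<^sub>L L2)" where
  "resolvent A z = (THE R. is_resolvent A z R)"

lemma resolvent_works: "z \<in> resolvent_set A \<Longrightarrow> is_resolvent A z (resolvent A z)"
  unfolding resolvent_set_def resolvent_def mem_Collect_eq
proof (erule exE, rule theI)
  fix R S assume "is_resolvent A z R" "is_resolvent A z S"
  then have "{(f, R f) | f. True} = {(f, S f) | f. True}" by (simp add: is_resolvent_def)
  then show "S = R" by (intro blinfun_eqI) blast
qed

lift_definition scaleC_blinfun :: "complex \<Rightarrow> L2 \<Rightarrow>\<^sub>L L2" is scaleC_L2
  subgoal for z
    by (rule bounded_linear_intro[where K = "cmod z"]) (auto simp: scaleC_L2_simps mult.commute)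
  done

text \<open>The contour integral of the resolvent, as an integral of a function with values in the
  Banach space of bounded operators.\<close>

definition resolvent_contour_integral :: "(L2 \<times> L2) set \<Rightarrow> (real \<Rightarrow> complex) \<Rightarrow> (L2 \<Rightarrow>\<^sub>L L2)" where
  "resolvent_contour_integral A \<gamma> =
     integral {0..1} (\<lambda>s. scaleC_blinfun (vector_derivative \<gamma> (at s within {0..1}))
                            o\<^sub>L resolvent A (\<gamma> s))"

text \<open>Contours are simple: repeated traversal would multiply the integral by the number of
  turns and make every supremum over contours trivially infinite.\<close>

definition closed_contours_in :: "complex set \<Rightarrow> (real \<Rightarrow> complex) set" where
  "closed_contours_in S =
     {\<gamma>. valid_path \<gamma> \<and> simple_path \<gamma> \<and> pathfinish \<gamma> = pathstart \<gamma> \<and> path_image \<gamma> \<subseteq> S}"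

text \<open>Asymptotic spectrality of the operator generated on the whole line by \<open>J y' + Q y\<close>, for
  periodic \<open>Q\<close>, is by definition a property of the family of operators on the interval.\<close>

definition asymptotically_spectral :: "(real \<Rightarrow> complex^2^2) \<Rightarrow> bool" where
  "asymptotically_spectral Q \<longleftrightarrow>
     (\<exists>M>0. (SUP t\<in>{-1<..1}.
        SUP \<gamma>\<in>closed_contours_in ({z. cmod z > M} \<inter> resolvent_set (dirac_operator Q t)).
          ennreal (norm (resolvent_contour_integral (dirac_operator Q t) \<gamma>))) < \<infinity>)"


section \<open>Bounded variation\<close>

definition bounded_variation_on :: "(real \<Rightarrow> complex) \<Rightarrow> real \<Rightarrow> real \<Rightarrow> bool" where
  "bounded_variation_on f a b \<longleftrightarrow>
     (\<exists>V. \<forall>n (x :: nat \<Rightarrow> real). mono_on {..n} x \<and> x ` {..n} \<subseteq> {a..b} \<longrightarrow>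
        (\<Sum>i<n. cmod (f (x (Suc i)) - f (x i))) \<le> V)"

end

theory Submission
  imports Defs "HOL-Complex_Analysis.Complex_Analysis" "HOL-Real_Asymp.Real_Asymp"
begin

text \<open>In the eigenbasis of \<open>J\<close> the equation \<open>J y' + Q y = l y\<close> becomes a system whose diagonal part
    is
  solved by exponentials; factoring these out leaves \<open>\<zeta>\<^sub>1' = p \<zeta>\<^sub>2\<close>, \<open>\<zeta>\<^sub>2' = q \<zeta>\<^sub>1\<close> with \<open>p\<close>, \<open>q\<close>
  oscillating like \<open>exp (\<plusminus> 2 \<i> l x)\<close>. Bounded variation makes the primitives of \<open>p\<close>, \<open>q\<close>, hence also
      the
  deviation of the fundamental matrix from the identity, of order \<open>1/l\<close> in horizontal strips.

  The monodromy matrix has constant determinant \<open>D = exp (\<integral> (a\<^sub>3 - a\<^sub>2))\<close>, and the hypothesis says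
  \<open>\<bar>D\<bar> \<noteq> 1\<close>. So at an eigenvalue, where one multiplier is \<open>\<omega>
      = exp (\<i> \<pi> t)\<close>, the other one, \<open>D/\<omega>\<close>, is at
  a fixed distance, uniformly in \<open>t\<close>. Consequently the large eigenvalues are simple, uniformly
      separated,
  and confined to a strip, and the pairing of the resolvent with two functions has residues bounded
      by a
  product of two perturbed Fourier coefficients. Bessel's inequality
      for such nonharmonic coefficients
  bounds the sum of the residues over any set of large eigenvalues. The finitely many small
      eigenvalues
  are enclosed together by a contour of large modulus or not at all, and their joint contribution is
      an
  integral over a circle on which the characteristic function is uniformly bounded below.\<close>

section \<open>Absolutely continuous functions\<close>

text \<open>The operator-valued contour integral is only tested against pairs of vectors, so scalar
  estimates suffice. For fixed vectors the tested resolvent is \<open>N / \<Delta>\<close> plus the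
  entire function \<open>Rest\<close>. The latter integrates to zero over closed contours, which
  removes the Volterra part of the Green function before anything is estimated. The single residues
  are merely bounded as operators and are not summable in norm. Summability appears only after
  testing: each residue is then controlled by a product of two coefficients, each square summable
  over the eigenvalues. The order 1/l supplied by bounded variation matters here, because its
  squares can be summed over the eigenvalues. The obstacle is uniformity in t. If
  \<open>cmod D\<close> were 1, some unimodular \<omega> would satisfy \<omega> * \<omega> = D; both
  multipliers would then coincide at the eigenvalues, and the derivative of \<open>T\<close>, the
  denominator of the residues, could become arbitrarily small. From the operator itself two facts
  enter: the resolvent solves the boundary value problem, and zeros of \<Delta> lie in the
  spectrum.\<close>

lemma absolutely_integrable_bounded_mult:
  fixes f g :: "real \<Rightarrow> complex"
  assumes f: "f absolutely_integrable_on {a..b}"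
    and g: "g \<in> borel_measurable (lebesgue_on {a..b})" and "\<And>x. x \<in> {a..b} \<Longrightarrow> norm (g x) \<le> B"
  shows "(\<lambda>x. g x * f x) absolutely_integrable_on {a..b}"
proof (rule absolutely_integrable_bounded_measurable_product[OF _ g _ _ f])
  show "bilinear ((*) :: complex \<Rightarrow> _)"
    by (simp add: bilinear_conv_bounded_bilinear bounded_bilinear_mult)
  show "bounded (g ` {a..b})"
    unfolding bounded_iff using assms(3) by blast
qed auto

lemma continuous_on_interval_bounded:
  fixes g :: "real \<Rightarrow> complex"
  assumes "continuous_on {a..b} g"
  obtains B where "0 \<le> B" "\<And>x. x \<in> {a..b} \<Longrightarrow> norm (g x) \<le> B"
proof -
  have "bounded (g ` {a..b})"
    using assms by (intro compact_imp_bounded compact_continuous_image) auto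
  then show ?thesis
    using that unfolding bounded_pos by (metis imageI less_imp_le)
qed

lemma absolutely_integrable_continuous_mult:
  fixes f g :: "real \<Rightarrow> complex"
  assumes "f absolutely_integrable_on {a..b}" "continuous_on {a..b} g"
  shows "(\<lambda>x. g x * f x) absolutely_integrable_on {a..b}"
proof -
  obtain B where "\<And>x. x \<in> {a..b} \<Longrightarrow> norm (g x) \<le> B"
    by (rule continuous_on_interval_bounded[OF assms(2)]) blast
  then show ?thesis
    using continuous_imp_measurable_on_sets_lebesgue[OF assms(2)]
    by (intro absolutely_integrable_bounded_mult[OF assms(1)]) auto
qed

lemma absolutely_integrable_subinterval:
  fixes f :: "real \<Rightarrow> complex"
  assumes "f absolutely_integrable_on {a..b}" "a \<le> c" "d \<le> b"
  shows "f absolutely_integrable_on {c..d}"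
  using assms by (intro set_integrable_subset[OF assms(1)]) auto

lemma integrable_on_subinterval:
  fixes f :: "real \<Rightarrow> complex"
  assumes "f absolutely_integrable_on {a..b}" "a \<le> c" "d \<le> b"
  shows "f integrable_on {c..d}"
  using absolutely_integrable_subinterval[OF assms] by (simp add: absolutely_integrable_on_def)

text \<open>A function with increments quadratically small in the increments of a continuous monotone
  function is constant: bisect in the values of that function.\<close>
lemma quadratic_increments_imp_constant:
  fixes \<Phi> :: "real \<Rightarrow> complex" and m :: "real \<Rightarrow> real"
  assumes inc: "\<And>x y. a \<le> x \<Longrightarrow> x \<le> y \<Longrightarrow> y \<le> b \<Longrightarrow> cmod (\<Phi> y - \<Phi> x) \<le> K * (m y - m x)\<^sup>2"
    and mono: "\<And>x y. a \<le> x \<Longrightarrow> x \<le> y \<Longrightarrow> y \<le> b \<Longrightarrow> m x \<le> m y"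
    and cont: "continuous_on {a..b} m" and "a \<le> x" "x \<le> b"
  shows "\<Phi> x = \<Phi> a"
proof -
  \<comment> \<open>Splitting where \<open>m\<close> takes its mean value gives two halves, each
    with a quarter of the squared increment. Together they give half of it, so every bisection gains
    a factor 2.\<close>
  have *: "cmod (\<Phi> y - \<Phi> x) \<le> K * (m y - m x)\<^sup>2 / 2 ^ k"
    if "a \<le> x" "x \<le> y" "y \<le> b" for x y k
    using that
  proof (induction k arbitrary: x y)
    case (Suc k)
    have "\<exists>c\<ge>x. c \<le> y \<and> m c = (m x + m y) / 2"
      using Suc.prems mono[of x y] cont
      by (intro IVT') (auto intro: continuous_on_subset simp: field_simps)
    then obtain c where c: "x \<le> c" "c \<le> y" "m c = (m x + m y) / 2" by auto
    have "cmod (\<Phi> y - \<Phi> x) \<le> cmod (\<Phi> y - \<Phi> c) + cmod (\<Phi> c - \<Phi> x)"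
      by (metis diff_add_cancel norm_triangle_ineq add_diff_eq)
    also have "\<dots> \<le> K * (m y - m c)\<^sup>2 / 2 ^ k + K * (m c - m x)\<^sup>2 / 2 ^ k"
      using c Suc.prems by (intro add_mono Suc.IH) auto
    also have "\<dots> = K * (m y - m x)\<^sup>2 / 2 ^ Suc k"
      by (simp add: c field_simps power2_eq_square)
    finally show ?case .
  qed (use inc in auto)
  have "(\<lambda>k. K * (m x - m a)\<^sup>2 / 2 ^ k) \<longlonglongrightarrow> 0"
    by (rule LIMSEQ_divide_realpow_zero) simp
  then have "cmod (\<Phi> x - \<Phi> a) \<le> 0"
    using *[of a x] assms by (intro tendsto_lowerbound[OF _ always_eventually]) auto
  then show ?thesis by simp
qed

text \<open>Scalar analogue of \<open>ac_with_derivative\<close> with a variable right endpoint. The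
  density is carried along with the function, so differentiation at points never enters.\<close>

definition ac_on :: "real \<Rightarrow> (real \<Rightarrow> complex) \<Rightarrow> (real \<Rightarrow> complex) \<Rightarrow> bool" where
  "ac_on b u u' \<longleftrightarrow> u' absolutely_integrable_on {0..b} \<and> (\<forall>x\<in>{0..b}. u x = u 0 + integral {0..x} u')"

lemma ac_on_absolutely_integrable: "ac_on b u u' \<Longrightarrow> u' absolutely_integrable_on {0..b}"
  unfolding ac_on_def by blast

lemma ac_on_eq: "ac_on b u u' \<Longrightarrow> x \<in> {0..b} \<Longrightarrow> u x = u 0 + integral {0..x} u'"
  unfolding ac_on_def by blast

lemma ac_on_increment:
  assumes "ac_on b u u'" "0 \<le> x" "x \<le> y" "y \<le> b"
  shows "u y - u x = integral {x..y} u'"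
proof -
  have "u' integrable_on {0..y}"
    using assms by (intro integrable_on_subinterval[OF ac_on_absolutely_integrable[OF assms(1)]])
        auto
  then have "integral {0..x} u' + integral {x..y} u' = integral {0..y} u'"
    using assms by (intro Henstock_Kurzweil_Integration.integral_combine) auto
  then show ?thesis
    using ac_on_eq[OF assms(1), of x] ac_on_eq[OF assms(1), of y] assms
    by (simp add: algebra_simps)
qed

lemma ac_on_continuous:
  assumes "ac_on b u u'"
  shows "continuous_on {0..b} u"
proof -
  have "continuous_on {0..b} (\<lambda>x. u 0 + integral {0..x} u')"
    by (intro continuous_intros indefinite_integral_continuous_1
        integrable_on_subinterval[OF ac_on_absolutely_integrable[OF assms]]) auto
  then show ?thesis
    by (rule continuous_on_eq) (use ac_on_eq[OF assms] in metis)
qed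

lemma ac_on_integral:
  assumes "f absolutely_integrable_on {0..b}"
  shows "ac_on b (\<lambda>x. c + integral {0..x} f) f"
  using assms by (auto simp: ac_on_def)

lemma ac_on_has_vector_derivative:
  assumes "\<And>x. (u has_vector_derivative u' x) (at x)" "continuous_on {0..b} u'"
  shows "ac_on b u u'"
  unfolding ac_on_def
proof (intro conjI ballI)
  show "u' absolutely_integrable_on {0..b}"
    using assms(2) by (intro absolutely_integrable_continuous_real)
  fix x assume "x \<in> {0..b}"
  then have "(u' has_integral (u x - u 0)) {0..x}"
    using assms by (intro fundamental_theorem_of_calculus) (auto intro:
        has_vector_derivative_at_within)
  then show "u x = u 0 + integral {0..x} u'"
    by (simp add: integral_unique)
qed

lemma ac_on_add:
  assumes "ac_on b u u'" "ac_on b v v'"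
  shows "ac_on b (\<lambda>x. u x + v x) (\<lambda>x. u' x + v' x)"
  unfolding ac_on_def
proof (intro conjI ballI)
  show "(\<lambda>x. u' x + v' x) absolutely_integrable_on {0..b}"
    by (intro set_integral_add ac_on_absolutely_integrable[OF assms(1)]
        ac_on_absolutely_integrable[OF assms(2)])
  fix x assume x: "x \<in> {0..b}"
  then have "u' integrable_on {0..x}" "v' integrable_on {0..x}"
    using ac_on_absolutely_integrable[OF assms(1)] ac_on_absolutely_integrable[OF assms(2)]
    by (auto intro: integrable_on_subinterval)
  then show "u x + v x = u 0 + v 0 + integral {0..x} (\<lambda>x. u' x + v' x)"
    using ac_on_eq[OF assms(1) x] ac_on_eq[OF assms(2) x]
    by (simp add: Henstock_Kurzweil_Integration.integral_add)
qed

lemma ac_on_cmult: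
  assumes "ac_on b u u'"
  shows "ac_on b (\<lambda>x. c * u x) (\<lambda>x. c * u' x)"
  unfolding ac_on_def
proof (intro conjI ballI)
  show "(\<lambda>x. c * u' x) absolutely_integrable_on {0..b}"
    by (intro absolutely_integrable_continuous_mult ac_on_absolutely_integrable[OF assms]) auto
  show "c * u x = c * u 0 + integral {0..x} (\<lambda>x. c * u' x)" if "x \<in> {0..b}" for x
    using ac_on_eq[OF assms that] by (simp add: distrib_left)
qed

text \<open>The product rule without differentiating at points: the defect \<open>\<Phi>\<close>
  between the product and the integral of the expected density has increments bounded by squared
  increments of \<open>m\<close>, hence is constant.\<close>

lemma ac_on_mult:
  assumes u: "ac_on b u u'" and v: "ac_on b v v'"
  shows "ac_on b (\<lambda>x. u x * v x) (\<lambda>x. u x * v' x + v x * u' x)"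
  unfolding ac_on_def
proof (intro conjI ballI)
  note uv = ac_on_absolutely_integrable[OF u] ac_on_absolutely_integrable[OF v]
  have ai: "(\<lambda>x. u x * v' x) absolutely_integrable_on {0..b}"
    "(\<lambda>x. v x * u' x) absolutely_integrable_on {0..b}"
    using ac_on_continuous[OF u] ac_on_continuous[OF v] uv
    by (auto intro!: absolutely_integrable_continuous_mult)
  show ai': "(\<lambda>x. u x * v' x + v x * u' x) absolutely_integrable_on {0..b}"
    by (intro set_integral_add ai)
  define w where "w = (\<lambda>x. u x * v' x + v x * u' x)"
  define m where "m x = integral {0..x} (\<lambda>x. norm (u' x) + norm (v' x))" for x
  define \<Phi> where "\<Phi> x = u x * v x - integral {0..x} w" for x
  have nu: "(\<lambda>x. norm (u' x) + norm (v' x)) integrable_on {0..b}"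
    by (intro Henstock_Kurzweil_Integration.integrable_add) (use uv in \<open>auto simp:
        absolutely_integrable_on_def\<close>)
  have sub: "f integrable_on {x..y}" if "f absolutely_integrable_on {0..b}" "0 \<le> x" "y \<le> b"
    for f :: "real \<Rightarrow> complex" and x y
    using that by (rule integrable_on_subinterval)
  have subn: "(\<lambda>x. norm (f x)) integrable_on {x..y}" if "f absolutely_integrable_on {0..b}" "0
      \<le> x" "y \<le> b"
    for f :: "real \<Rightarrow> complex" and x y
    using absolutely_integrable_subinterval[OF that] by (simp add: absolutely_integrable_on_def)
  have mdiff: "m y - m x = integral {x..y} (\<lambda>x. norm (u' x)) + integral {x..y} (\<lambda>x. norm (v' x))"
    if "0 \<le> x" "x \<le> y" "y \<le> b" for x y
  proof -
    have "m x + integral {x..y} (\<lambda>x. norm (u' x) + norm (v' x)) = m y"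
      unfolding m_def using that
      by (intro Henstock_Kurzweil_Integration.integral_combine integrable_subinterval_real[OF nu])
          auto
    then show ?thesis
      using that by (simp add: Henstock_Kurzweil_Integration.integral_add subn uv)
  qed
  have nonneg: "0 \<le> integral {x..y} (\<lambda>x. norm (f x))" for f :: "real \<Rightarrow> complex" and x y
    by (cases "(\<lambda>x. norm (f x)) integrable_on {x..y}")
       (auto intro: Henstock_Kurzweil_Integration.integral_nonneg simp: not_integrable_integral)
  have mono: "m x \<le> m y" if "0 \<le> x" "x \<le> y" "y \<le> b" for x y
    using mdiff[OF that] nonneg[where f=u' and x=x and y=y] nonneg[where f=v' and x=x and y=y] by
        linarith
  have incr: "norm (f y - f x) \<le> m y - m x"
    if "ac_on b f f'" "f' = u' \<or> f' = v'" "0 \<le> x" "x \<le> y" "y \<le> b" for f f' x y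
  proof -
    have "norm (integral {x..y} f') \<le> integral {x..y} (\<lambda>x. norm (f' x))"
      using that sub[of f' x y] subn[of f' x y] uv
      by (intro integral_norm_bound_integral) auto
    then show ?thesis
      using that nonneg[where f=u' and x=x and y=y] nonneg[where f=v' and x=x and y=y] mdiff[of x y]
          ac_on_increment[OF that(1), of x y] by auto
  qed
  have "cmod (\<Phi> y - \<Phi> x) \<le> 2 * (m y - m x)\<^sup>2" if xy: "0 \<le> x" "x \<le> y" "y \<le> b" for x y
  proof -
    have int_w: "w integrable_on {0..y}"
      using ai' xy unfolding w_def by (intro sub) auto
    have "integral {0..x} w + integral {x..y} w = integral {0..y} w"
      using xy int_w by (intro Henstock_Kurzweil_Integration.integral_combine) auto
    moreover have "integral {x..y} w = integral {x..y} (\<lambda>s. u s * v' s) + integral {x..y} (\<lambda>s. v s *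
        u' s)"
      unfolding w_def using xy ai by (intro Henstock_Kurzweil_Integration.integral_add sub) auto
    moreover have "u y * v y - u x * v x = u x * (v y - v x) + v y * (u y - u x)"
      by (simp add: algebra_simps)
    moreover have "v y - v x = integral {x..y} v'" "u y - u x = integral {x..y} u'"
      using ac_on_increment u v xy by auto
    ultimately have "\<Phi> y - \<Phi> x = (u x * integral {x..y} v' - integral {x..y} (\<lambda>s. u s * v' s)) +
        (v y * integral {x..y} u' - integral {x..y} (\<lambda>s. v s * u' s))"
      unfolding \<Phi>_def by (simp add: algebra_simps)
    also have "u x * integral {x..y} v' - integral {x..y} (\<lambda>s. u s * v' s)
        = integral {x..y} (\<lambda>s. u x * v' s - u s * v' s)"
      using xy ai uv sub[of v' x y]
      by (subst Henstock_Kurzweil_Integration.integral_diff) (auto intro!: sub)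
    also have "v y * integral {x..y} u' - integral {x..y} (\<lambda>s. v s * u' s)
        = integral {x..y} (\<lambda>s. v y * u' s - v s * u' s)"
      using xy ai uv sub[of u' x y]
      by (subst Henstock_Kurzweil_Integration.integral_diff) (auto intro!: sub)
    finally have "norm (\<Phi> y - \<Phi> x) \<le> norm (integral {x..y} (\<lambda>s. u x * v' s - u s * v' s))
        + norm (integral {x..y} (\<lambda>s. v y * u' s - v s * u' s))"
      by (simp add: norm_triangle_ineq)
    also have "norm (integral {x..y} (\<lambda>s. u x * v' s - u s * v' s))
        \<le> integral {x..y} (\<lambda>s. (m y - m x) * norm (v' s))"
    proof (rule integral_norm_bound_integral)
      show "(\<lambda>s. u x * v' s - u s * v' s) integrable_on {x..y}"
        using xy ai uv sub[of v' x y] by (intro Henstock_Kurzweil_Integration.integrable_diff sub)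
            auto
      show "(\<lambda>s. (m y - m x) * norm (v' s)) integrable_on {x..y}"
        using xy by (intro integrable_on_mult_right subn uv) auto
      fix s assume s: "s \<in> {x..y}"
      have "norm (u s - u x) \<le> m y - m x"
        using incr[OF u, of x s] mono[of s y] s xy by auto
      then have "norm ((u x - u s) * v' s) \<le> (m y - m x) * norm (v' s)"
        by (simp add: norm_mult norm_minus_commute mult_right_mono)
      then show "norm (u x * v' s - u s * v' s) \<le> (m y - m x) * norm (v' s)"
        by (simp add: algebra_simps)
    qed
    also have "norm (integral {x..y} (\<lambda>s. v y * u' s - v s * u' s))
        \<le> integral {x..y} (\<lambda>s. (m y - m x) * norm (u' s))"
    proof (rule integral_norm_bound_integral)
      show "(\<lambda>s. v y * u' s - v s * u' s) integrable_on {x..y}"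
        using xy ai uv sub[of u' x y] by (intro Henstock_Kurzweil_Integration.integrable_diff sub)
            auto
      show "(\<lambda>s. (m y - m x) * norm (u' s)) integrable_on {x..y}"
        using xy by (intro integrable_on_mult_right subn uv) auto
      fix s assume s: "s \<in> {x..y}"
      have "norm (v y - v s) \<le> m y - m x"
        using incr[OF v, of s y] mono[of x s] s xy by auto
      then have "norm ((v y - v s) * u' s) \<le> (m y - m x) * norm (u' s)"
        by (simp add: norm_mult mult_right_mono)
      then show "norm (v y * u' s - v s * u' s) \<le> (m y - m x) * norm (u' s)"
        by (simp add: algebra_simps)
    qed
    finally have "norm (\<Phi> y - \<Phi> x) \<le> (m y - m x) * integral {x..y} (\<lambda>s. norm (v' s))
        + (m y - m x) * integral {x..y} (\<lambda>s. norm (u' s))"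
      by simp
    also have "\<dots> = (m y - m x)\<^sup>2"
      unfolding power2_eq_square mdiff[OF xy] by (simp add: algebra_simps)
    finally show ?thesis
      using zero_le_power2[of "m y - m x"] by linarith
  qed
  moreover have "continuous_on {0..b} m"
    unfolding m_def by (intro indefinite_integral_continuous_1 nu)
  ultimately show "u x * v x = u 0 * v 0 + integral {0..x} (\<lambda>x. u x * v' x + v x * u' x)"
    if "x \<in> {0..b}" for x
    using quadratic_increments_imp_constant[of 0 b \<Phi> 2 m x] mono that
    by (simp add: \<Phi>_def w_def algebra_simps)
qed

lemma ac_on_cong:
  assumes "ac_on b u u'" "\<And>x. x \<in> {0..b} \<Longrightarrow> u x = v x" "\<And>x. x \<in> {0..b} \<Longrightarrow> u' x = v' x"
  shows "ac_on b v v'"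
  unfolding ac_on_def
proof (intro conjI ballI)
  show "v' absolutely_integrable_on {0..b}"
    using assms by (metis ac_on_absolutely_integrable set_integrable_cong)
  fix x assume x: "x \<in> {0..b}"
  have "integral {0..x} u' = integral {0..x} v'"
    using x assms(3) by (intro integral_cong) auto
  then show "v x = v 0 + integral {0..x} v'"
    using ac_on_eq[OF assms(1) x] assms(2)[of x] assms(2)[of 0] x by auto
qed

text \<open>Cauchy's estimate supplies the integrable majorant
  of the difference quotients.\<close>
lemma holomorphic_integral:
  fixes f :: "real \<Rightarrow> complex \<Rightarrow> complex"
  assumes int: "\<And>z. (\<lambda>x. f x z) integrable_on {a..b}"
    and holo: "\<And>x. x \<in> {a..b} \<Longrightarrow> f x holomorphic_on UNIV"
    and bound: "\<And>r. \<exists>g. g integrable_on {a..b} \<and> (\<forall>x\<in>{a..b}. \<forall>z. cmod z \<le> r \<longrightarrow> cmod (f x z) \<le> g x)"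
  shows "(\<lambda>z. integral {a..b} (\<lambda>x. f x z)) holomorphic_on UNIV"
proof (rule holomorphic_onI)
  fix z0 :: complex
  obtain g where g: "g integrable_on {a..b}"
    and fg: "\<And>x z. x \<in> {a..b} \<Longrightarrow> cmod z \<le> cmod z0 + 2 \<Longrightarrow> cmod (f x z) \<le> g x"
    using bound[of "cmod z0 + 2"] by auto
  define q where "q z x = (f x z - f x z0) / (z - z0)" for z x
  \<comment> \<open>Circles of radius 1 about points within distance 1 of \<open>z0\<close> stay in
    the disc of radius \<open>cmod z0 + 2\<close>, where \<open>g\<close> dominates.\<close>
  have deriv_bound: "cmod (deriv (f x) z) \<le> g x" if "x \<in> {a..b}" "cmod (z - z0) \<le> 1" for x z
  proof -
    have "cmod ((deriv ^^ 1) (f x) z) \<le> fact 1 * g x / 1 ^ 1"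
    proof (rule Cauchy_inequality)
      show "f x holomorphic_on ball z 1" "continuous_on (cball z 1) (f x)"
        using holo[OF that(1)] by (auto intro: holomorphic_on_subset
            continuous_on_subset[OF holomorphic_on_imp_continuous_on])
      fix w assume "cmod (z - w) = 1"
      then have "cmod w \<le> cmod z0 + 2"
        using that(2) norm_triangle_ineq2[of w z] norm_triangle_ineq2[of z z0]
        by (simp add: norm_minus_commute)
      then show "cmod (f x w) \<le> g x" using fg that by blast
    qed auto
    then show ?thesis by simp
  qed
  have q_bound: "cmod (q z x) \<le> g x" if "x \<in> {a..b}" "cmod (z - z0) \<le> 1" for x z
  proof -
    have "cmod (f x z - f x z0) \<le> g x * cmod (z - z0)"
    proof (rule field_differentiable_bound[of "cball z0 1"])
      show "(f x has_field_derivative deriv (f x) w) (at w within cball z0 1)" for w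
        using holo[OF that(1)] by (meson UNIV_I holomorphic_derivI has_field_derivative_at_within
            open_UNIV)
      show "cmod (deriv (f x) w) \<le> g x" if "w \<in> cball z0 1" for w
        using deriv_bound[OF \<open>x \<in> _\<close>, of w] that by (simp add: dist_norm norm_minus_commute)
    qed (use that in \<open>auto simp: dist_norm norm_minus_commute\<close>)
    moreover have "0 \<le> g x"
      using fg[OF that(1), of z0] norm_ge_zero[of "f x z0"] by (smt (verit))
    ultimately show ?thesis
      unfolding q_def by (cases "z = z0") (auto simp: norm_divide divide_simps mult.commute)
  qed
  have "(\<lambda>z. integral {a..b} (q z)) \<midarrow>z0\<rightarrow> integral {a..b} (\<lambda>x. deriv (f x) z0)"
    unfolding tendsto_at_iff_sequentially comp_def
  proof safe
    fix X :: "nat \<Rightarrow> complex"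
    assume X: "\<forall>i. X i \<in> UNIV - {z0}" and lim: "X \<longlonglongrightarrow> z0"
    obtain N where N: "\<And>n. n \<ge> N \<Longrightarrow> cmod (X n - z0) < 1"
      using LIMSEQ_D[OF lim, of 1] by auto
    have "(\<lambda>n. integral {a..b} (q (X (n + N)))) \<longlonglongrightarrow> integral {a..b} (\<lambda>x. deriv (f x) z0)"
    proof (rule dominated_convergence(2)[OF _ g])
      show "q (X (n + N)) integrable_on {a..b}" for n
        unfolding q_def by (intro integrable_on_divide Henstock_Kurzweil_Integration.integrable_diff
            int)
      show "norm (q (X (n + N)) x) \<le> g x" if "x \<in> {a..b}" for n x
        using q_bound[OF that, of "X (n + N)"] N[of "n + N"] by auto
      show "(\<lambda>n. q (X (n + N)) x) \<longlonglongrightarrow> deriv (f x) z0" if "x \<in> {a..b}" for x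
      proof -
        have "(f x has_field_derivative deriv (f x) z0) (at z0)"
          using holo[OF that] by (meson UNIV_I holomorphic_derivI open_UNIV)
        then have "(\<lambda>z. q z x) \<midarrow>z0\<rightarrow> deriv (f x) z0"
          by (simp add: q_def has_field_derivative_iff)
        then have "(\<lambda>n. q (X n) x) \<longlonglongrightarrow> deriv (f x) z0"
          using X lim unfolding tendsto_at_iff_sequentially comp_def by blast
        then show ?thesis by (rule LIMSEQ_ignore_initial_segment)
      qed
    qed
    then show "(\<lambda>n. integral {a..b} (q (X n))) \<longlonglongrightarrow> integral {a..b} (\<lambda>x. deriv (f x) z0)"
      by (rule LIMSEQ_offset)
  qed
  then have "((\<lambda>z. integral {a..b} (\<lambda>x. f x z)) has_field_derivative
      integral {a..b} (\<lambda>x. deriv (f x) z0)) (at z0)"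
    unfolding has_field_derivative_iff
  proof (rule Lim_transform_eventually, intro always_eventually allI)
    fix z
    show "integral {a..b} (q z) = (integral {a..b} (\<lambda>x. f x z) - integral {a..b} (\<lambda>x. f x z0)) / (z
        - z0)"
      unfolding q_def by (simp add: Henstock_Kurzweil_Integration.integral_diff int)
  qed
  then show "(\<lambda>z. integral {a..b} (\<lambda>x. f x z)) field_differentiable at z0 within UNIV"
    by (auto simp: field_differentiable_def)
qed

section \<open>Oscillatory integrals and bounded variation\<close>

text \<open>The total variation on \<open>{a..x}\<close> serves as \<open>v\<close>: a partition of
  \<open>{a..x}\<close> can always be prolonged by the jump from \<open>x\<close> to
  \<open>y\<close>.\<close>

lemma bounded_variation_increasing_majorant:
  assumes "bounded_variation_on f a b"
  obtains v :: "real \<Rightarrow> real" where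
    "\<And>x y. a \<le> x \<Longrightarrow> x \<le> y \<Longrightarrow> y \<le> b \<Longrightarrow> cmod (f y - f x) \<le> v y - v x"
proof -
  define P :: "real \<Rightarrow> (nat \<times> (nat \<Rightarrow> real)) set" where "P x = {(n, p). mono_on {..n} p
      \<and> p ` {..n} \<subseteq> {a..x}}" for x
  define S where "S = (\<lambda>(n::nat, p::nat \<Rightarrow> real). \<Sum>i<n. cmod (f (p (Suc i)) - f (p i)))"
  obtain V where V: "\<And>n p. mono_on {..n} p \<Longrightarrow> p ` {..n} \<subseteq> {a..b} \<Longrightarrow> S (n, p) \<le> V"
    using assms unfolding bounded_variation_on_def S_def by auto
  define v where "v x = Sup (S ` P x)" for x
  have "cmod (f y - f x) \<le> v y - v x" if xy: "a \<le> x" "x \<le> y" "y \<le> b" for x y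
  proof -
    have "S np + cmod (f y - f x) \<le> v y" if np: "np \<in> P x" for np
    proof -
      obtain n p where [simp]: "np = (n, p)" by force
      have p: "mono_on {..n} p" "p ` {..n} \<subseteq> {a..x}" using np by (auto simp: P_def)
      \<comment> \<open>Two points are appended, first \<open>x\<close> and then \<open>y\<close>.
        The step from \<open>p n\<close> to \<open>x\<close> only adds a nonnegative term.\<close>
      define p' where "p' i = (if i \<le> n then p i else if i = Suc n then x else y)" for i
      have pn: "a \<le> p i" "p i \<le> x" if "i \<le> n" for i
        using p(2) that by auto
      have "p' r \<le> p' s" if "r \<le> s" for r s
        using mono_onD[OF p(1), of r s] pn[of r] pn[of s] that xy by (auto simp: p'_def)
      moreover have "a \<le> p' i \<and> p' i \<le> y" for i
        using pn[of i] xy by (auto simp: p'_def)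
      ultimately have "(Suc (Suc n), p') \<in> P y"
        by (auto simp: P_def mono_on_def)
      moreover have "bdd_above (S ` P y)"
      proof (rule bdd_aboveI2)
        fix np assume "np \<in> P y"
        moreover have "{a..y} \<subseteq> {a..b}" using xy by auto
        ultimately show "S np \<le> V" unfolding P_def by (auto intro!: V elim: order_trans)
      qed
      ultimately have "S (Suc (Suc n), p') \<le> v y"
        unfolding v_def by (intro cSup_upper) auto
      moreover have "S (Suc (Suc n), p') = S np + cmod (f x - f (p n)) + cmod (f y - f x)"
        by (simp add: S_def p'_def)
      ultimately show ?thesis
        using norm_ge_zero[of "f x - f (p n)"] by linarith
    qed
    moreover have "(0, \<lambda>_. a) \<in> P x" using xy by (auto simp: P_def mono_on_def)
    ultimately have "v x \<le> v y - cmod (f y - f x)"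
      unfolding v_def[of x] by (intro cSup_least) (auto simp: algebra_simps)
    then show ?thesis by simp
  qed
  then show ?thesis using that by blast
qed

text \<open>The last clause is what bounded variation yields by the second mean value theorem, in a form
    that
  is stable under multiplication by absolutely continuous functions.\<close>
definition damped_on :: "real \<Rightarrow> (real \<Rightarrow> complex) \<Rightarrow> bool" where
  "damped_on b f \<longleftrightarrow> f absolutely_integrable_on {0..b} \<and> (\<exists>B. \<forall>x\<in>{0..b}. cmod (f x) \<le> B) \<and>
     (\<exists>C\<ge>0. \<forall>F K. continuous_on {0..b} F \<longrightarrow>
        (\<forall>c d. 0 \<le> c \<longrightarrow> c \<le> d \<longrightarrow> d \<le> b \<longrightarrow> cmod (integral {c..d} F) \<le> K) \<longrightarrow>
        (\<forall>x\<in>{0..b}. cmod (integral {0..x} (\<lambda>s. F s * f s)) \<le> C * K))"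

lemma damped_on_I:
  assumes "f absolutely_integrable_on {0..b}" "\<And>x. x \<in> {0..b} \<Longrightarrow> cmod (f x) \<le> B" "0 \<le> C"
    and "\<And>F K x. continuous_on {0..b} F \<Longrightarrow>
      (\<And>c d. 0 \<le> c \<Longrightarrow> c \<le> d \<Longrightarrow> d \<le> b \<Longrightarrow> cmod (integral {c..d} F) \<le> K) \<Longrightarrow>
      x \<in> {0..b} \<Longrightarrow> cmod (integral {0..x} (\<lambda>s. F s * f s)) \<le> C * K"
  shows "damped_on b f"
  using assms unfolding damped_on_def by metis

lemma damped_on_absolutely_integrable: "damped_on b f \<Longrightarrow> f absolutely_integrable_on {0..b}"
  by (simp add: damped_on_def)

lemma damped_onE:
  assumes "damped_on b f"
  obtains B C where "0 < B" "\<And>x. x \<in> {0..b} \<Longrightarrow> cmod (f x) \<le> B" "0 \<le> C"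
    "\<And>F K x. continuous_on {0..b} F \<Longrightarrow>
        (\<And>c d. 0 \<le> c \<Longrightarrow> c \<le> d \<Longrightarrow> d \<le> b \<Longrightarrow> cmod (integral {c..d} F) \<le> K) \<Longrightarrow>
        x \<in> {0..b} \<Longrightarrow> cmod (integral {0..x} (\<lambda>s. F s * f s)) \<le> C * K"
proof -
  obtain B C where B: "\<forall>x\<in>{0..b}. cmod (f x) \<le> B" and C: "0 \<le> C"
    "\<forall>F K. continuous_on {0..b} F \<longrightarrow>
        (\<forall>c d. 0 \<le> c \<longrightarrow> c \<le> d \<longrightarrow> d \<le> b \<longrightarrow> cmod (integral {c..d} F) \<le> K) \<longrightarrow>
        (\<forall>x\<in>{0..b}. cmod (integral {0..x} (\<lambda>s. F s * f s)) \<le> C * K)"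
    using assms unfolding damped_on_def by blast
  have *: "cmod (f x) \<le> max B 1" if "x \<in> {0..b}" for x
    using B that by (auto simp: max.coboundedI1)
  show ?thesis
  proof (rule that[of "max B 1" C, OF _ * C(1)])
    show "cmod (integral {0..x} (\<lambda>s. F s * f s)) \<le> C * K"
      if "continuous_on {0..b} F" "\<And>c d. 0 \<le> c \<Longrightarrow> c \<le> d \<Longrightarrow> d \<le> b \<Longrightarrow> cmod (integral {c..d} F) \<le> K"
        "x \<in> {0..b}" for F K x
      using C(2) that by blast
  qed auto
qed

lemma integrable_on_initial:
  fixes f :: "real \<Rightarrow> complex"
  assumes "f absolutely_integrable_on {0..b}" "x \<in> {0..b}"
  shows "f integrable_on {0..x}"
  using assms by (intro integrable_on_subinterval[OF assms(1)]) auto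

text \<open>The second mean value theorem leaves two values of \<open>g\<close> times integrals of
  \<open>F\<close> over subintervals. As a real statement it is applied to the real and the
  imaginary part of \<open>F\<close>; each costs \<open>2 * G * K\<close>, hence
  \<open>4 * G\<close>.\<close>

lemma damped_on_increasing:
  fixes g :: "real \<Rightarrow> real"
  assumes mono: "\<And>x y. 0 \<le> x \<Longrightarrow> x \<le> y \<Longrightarrow> y \<le> b \<Longrightarrow> g x \<le> g y"
  shows "damped_on b (\<lambda>x. of_real (g x))"
proof (rule damped_on_I)
  define G where "G = \<bar>g 0\<bar> + \<bar>g b\<bar>"
  have G: "\<bar>g x\<bar> \<le> G" if "x \<in> {0..b}" for x
    using mono[of 0 x] mono[of x b] that by (auto simp: G_def)
  then show "cmod (of_real (g x)) \<le> G" if "x \<in> {0..b}" for x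
    using that by simp
  show "0 \<le> 4 * G" by (simp add: G_def)
  have g_int: "g absolutely_integrable_on {0..b}"
  proof (rule measurable_bounded_by_integrable_imp_absolutely_integrable)
    have "mono_on {0..b} g" using mono by (auto simp: mono_on_def)
    then have "g integrable_on {0..b}" by (rule integrable_on_mono_on)
    then show "g \<in> borel_measurable (lebesgue_on {0..b})" by (rule integrable_imp_measurable)
    show "(\<lambda>_. G) integrable_on {0..b}" by (rule integrable_const_ivl)
  qed (use G in auto)
  show "(\<lambda>x. complex_of_real (g x)) absolutely_integrable_on {0..b}"
    using absolutely_integrable_linear[OF g_int bounded_linear_of_real] by (simp add: comp_def)
  fix F :: "real \<Rightarrow> complex" and K x
  assume F: "continuous_on {0..b} F" and x: "x \<in> {0..b}"
    and K: "\<And>c d. 0 \<le> c \<Longrightarrow> c \<le> d \<Longrightarrow> d \<le> b \<Longrightarrow> cmod (integral {c..d} F) \<le> K"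
  have cont: "continuous_on {c..d} F" if "c \<in> {0..b}" "d \<in> {0..b}" for c d
    using F that by (auto intro: continuous_on_subset)
  have main: "\<bar>integral {0..x} (\<lambda>s. g s * h (F s))\<bar> \<le> 2 * G * K"
    if h: "bounded_linear h" "\<And>z. \<bar>h z\<bar> \<le> cmod z" for h :: "complex \<Rightarrow> real"
  proof -
    have hF: "continuous_on {c..d} (\<lambda>s. h (F s))" if "c \<in> {0..b}" "d \<in> {0..b}" for c d
      using cont[OF that] by (rule bounded_linear.continuous_on[OF h(1)])
    have "\<bar>integral {c..d} (\<lambda>s. h (F s))\<bar> \<le> K" if "0 \<le> c" "c \<le> d" "d \<le> b" for c d
    proof -
      have "F integrable_on {c..d}"
        using cont[of c d] that by (intro integrable_continuous_interval) auto
      then have "integral {c..d} (\<lambda>s. h (F s)) = h (integral {c..d} F)"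
        using integral_linear[OF _ h(1)] by (simp add: comp_def)
      then show ?thesis using h(2) K[OF that] order_trans by metis
    qed
    moreover obtain c where "c \<in> {0..x}"
      "integral {0..x} (\<lambda>s. g s * h (F s))
         = g 0 * integral {0..c} (\<lambda>s. h (F s)) + g x * integral {c..x} (\<lambda>s. h (F s))"
      using second_mean_value_theorem[of "\<lambda>s. h (F s)" 0 x g] hF[of 0 x] x mono
      by (auto intro: integrable_continuous_interval)
    moreover have "\<bar>g 0\<bar> \<le> G" "\<bar>g x\<bar> \<le> G" using G[of 0] G[of x] x by auto
    ultimately have "\<bar>integral {0..x} (\<lambda>s. g s * h (F s))\<bar>
        \<le> \<bar>g 0\<bar> * \<bar>integral {0..c} (\<lambda>s. h (F s))\<bar> + \<bar>g x\<bar> * \<bar>integral {c..x} (\<lambda>s. h (F s))\<bar>"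
      "\<bar>g 0\<bar> * \<bar>integral {0..c} (\<lambda>s. h (F s))\<bar> \<le> G * K"
      "\<bar>g x\<bar> * \<bar>integral {c..x} (\<lambda>s. h (F s))\<bar> \<le> G * K"
      using x by (auto simp: abs_mult intro!: abs_triangle_ineq[THEN order_trans] mult_mono)
    then show ?thesis by linarith
  qed
  have int: "(\<lambda>s. F s * of_real (g s)) integrable_on {0..x}"
    using \<open>(\<lambda>x. complex_of_real (g x)) absolutely_integrable_on {0..b}\<close> F x
    by (intro integrable_on_initial[where b = b] absolutely_integrable_continuous_mult)
  have "Re (integral {0..x} (\<lambda>s. F s * of_real (g s))) = integral {0..x} (\<lambda>s. g s * Re (F s))"
    using integral_linear[OF int bounded_linear_Re] by (simp add: comp_def mult.commute)
  moreover have "Im (integral {0..x} (\<lambda>s. F s * of_real (g s)))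
      = integral {0..x} (\<lambda>s. g s * Im (F s))"
    using integral_linear[OF int bounded_linear_Im] by (simp add: comp_def mult.commute)
  ultimately show "cmod (integral {0..x} (\<lambda>s. F s * of_real (g s))) \<le> 4 * G * K"
    using main[OF bounded_linear_Re abs_Re_le_cmod] main[OF bounded_linear_Im abs_Im_le_cmod]
      cmod_le[of "integral {0..x} (\<lambda>s. F s * of_real (g s))"] by linarith
qed

lemma damped_on_add:
  assumes "damped_on b f" "damped_on b g"
  shows "damped_on b (\<lambda>x. f x + g x)"
proof -
  obtain B1 C1 where f: "\<And>x. x \<in> {0..b} \<Longrightarrow> cmod (f x) \<le> B1" "C1 \<ge> 0"
    "\<And>F K x. continuous_on {0..b} F \<Longrightarrow>
        (\<And>c d. 0 \<le> c \<Longrightarrow> c \<le> d \<Longrightarrow> d \<le> b \<Longrightarrow> cmod (integral {c..d} F) \<le> K) \<Longrightarrow>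
        x\<in>{0..b} \<Longrightarrow> cmod (integral {0..x} (\<lambda>s. F s * f s)) \<le> C1 * K"
    by (rule damped_onE[OF assms(1)]) blast
  obtain B2 C2 where g: "\<And>x. x \<in> {0..b} \<Longrightarrow> cmod (g x) \<le> B2" "C2 \<ge> 0"
    "\<And>F K x. continuous_on {0..b} F \<Longrightarrow>
        (\<And>c d. 0 \<le> c \<Longrightarrow> c \<le> d \<Longrightarrow> d \<le> b \<Longrightarrow> cmod (integral {c..d} F) \<le> K) \<Longrightarrow>
        x\<in>{0..b} \<Longrightarrow> cmod (integral {0..x} (\<lambda>s. F s * g s)) \<le> C2 * K"
    by (rule damped_onE[OF assms(2)]) blast
  note ai = damped_on_absolutely_integrable[OF assms(1)] damped_on_absolutely_integrable[OF
      assms(2)]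
  show ?thesis
  proof (rule damped_on_I[of _ _ "B1 + B2" "C1 + C2"])
    show "(\<lambda>x. f x + g x) absolutely_integrable_on {0..b}"
      using ai by (rule set_integral_add)
    show "cmod (f x + g x) \<le> B1 + B2" if "x \<in> {0..b}" for x
      using f(1) g(1) that by (intro norm_triangle_mono) auto
    show "0 \<le> C1 + C2" using f g by simp
    fix F :: "real \<Rightarrow> complex" and K x
    assume F: "continuous_on {0..b} F" and x: "x \<in> {0..b}"
      and K: "\<And>c d. 0 \<le> c \<Longrightarrow> c \<le> d \<Longrightarrow> d \<le> b \<Longrightarrow> cmod (integral {c..d} F) \<le> K"
    have "integral {0..x} (\<lambda>s. F s * (f s + g s)) =
        integral {0..x} (\<lambda>s. F s * f s) + integral {0..x} (\<lambda>s. F s * g s)"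
      unfolding distrib_left using ai F x
      by (intro Henstock_Kurzweil_Integration.integral_add integrable_on_initial[where b = b]
          absolutely_integrable_continuous_mult)
    then show "cmod (integral {0..x} (\<lambda>s. F s * (f s + g s))) \<le> (C1 + C2) * K"
      using norm_triangle_mono[OF f(3)[OF F K x] g(3)[OF F K x]] by (simp add: distrib_right)
  qed
qed

text \<open>Integration by parts with the primitive \<open>P\<close> of \<open>F * f\<close>, which
  damping bounds by \<open>C * K\<close>. Only the supremum \<open>U\<close> of \<open>u\<close> and
  the integral \<open>I\<close> of its absolute density enter the new constant.\<close>

lemma damped_on_mult_ac:
  assumes f: "damped_on b f" and u: "ac_on b u u'"
  shows "damped_on b (\<lambda>x. u x * f x)"
proof -
  obtain B C where f': "B > 0" "\<And>x. x \<in> {0..b} \<Longrightarrow> cmod (f x) \<le> B" "C \<ge> 0"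
    "\<And>F K x. continuous_on {0..b} F \<Longrightarrow>
        (\<And>c d. 0 \<le> c \<Longrightarrow> c \<le> d \<Longrightarrow> d \<le> b \<Longrightarrow> cmod (integral {c..d} F) \<le> K) \<Longrightarrow>
        x\<in>{0..b} \<Longrightarrow> cmod (integral {0..x} (\<lambda>s. F s * f s)) \<le> C * K"
    by (rule damped_onE[OF f]) blast
  note ai = damped_on_absolutely_integrable[OF f] ac_on_absolutely_integrable[OF u]
  obtain U where U: "0 \<le> U" "\<And>x. x \<in> {0..b} \<Longrightarrow> norm (u x) \<le> U"
    by (rule continuous_on_interval_bounded[OF ac_on_continuous[OF u]]) blast
  define I where "I = integral {0..b} (\<lambda>x. norm (u' x))"
  have nu': "(\<lambda>x. norm (u' x)) integrable_on {0..b}"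
    using ai(2) by (simp add: absolutely_integrable_on_def)
  have I: "I \<ge> 0"
    unfolding I_def by (intro Henstock_Kurzweil_Integration.integral_nonneg nu') auto
  have ai_mult: "(\<lambda>x. u x * f x) absolutely_integrable_on {0..b}"
    using ai(1) ac_on_continuous[OF u] by (rule absolutely_integrable_continuous_mult)
  show ?thesis
  proof (rule damped_on_I[of _ _ "U * B" "C * (U + I)", OF ai_mult])
    show "cmod (u x * f x) \<le> U * B" if "x \<in> {0..b}" for x
      using U(1) U(2)[OF that] f'(1) f'(2)[OF that] U(1)
      unfolding norm_mult by (intro mult_mono) (assumption | simp)+
    show "0 \<le> C * (U + I)" using f'(3) I U(1) by simp
    fix F :: "real \<Rightarrow> complex" and K x
    assume F: "continuous_on {0..b} F" and x: "x \<in> {0..b}"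
      and K: "\<And>c d. 0 \<le> c \<Longrightarrow> c \<le> d \<Longrightarrow> d \<le> b \<Longrightarrow> cmod (integral {c..d} F) \<le> K"
    define P where "P x = integral {0..x} (\<lambda>s. F s * f s)" for x
    have P: "cmod (P y) \<le> C * K" if "y \<in> {0..b}" for y
      using f'(4)[OF F K that] by (simp add: P_def)
    then have CK: "0 \<le> C * K" using x norm_ge_zero order_trans by blast
    have acP: "ac_on b P (\<lambda>s. F s * f s)"
      using ac_on_integral[OF absolutely_integrable_continuous_mult[OF ai(1) F], of 0]
      by (simp add: P_def[abs_def])
    have aiP: "(\<lambda>s. P s * u' s) absolutely_integrable_on {0..b}"
      "(\<lambda>s. u s * (F s * f s)) absolutely_integrable_on {0..b}"
      by (rule absolutely_integrable_continuous_mult[OF ai(2) ac_on_continuous[OF acP]],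
          rule absolutely_integrable_continuous_mult[OF ac_on_absolutely_integrable[OF acP]
              ac_on_continuous[OF u]])
    have "P x * u x = integral {0..x} (\<lambda>s. P s * u' s + u s * (F s * f s))"
      using ac_on_eq[OF ac_on_mult[OF acP u] x] by (simp add: P_def)
    also have "\<dots> = integral {0..x} (\<lambda>s. P s * u' s) + integral {0..x} (\<lambda>s. u s * (F s * f s))"
      using x aiP by (intro Henstock_Kurzweil_Integration.integral_add integrable_on_initial)
    finally have eq: "integral {0..x} (\<lambda>s. F s * (u s * f s))
        = P x * u x - integral {0..x} (\<lambda>s. P s * u' s)"
      by (simp add: algebra_simps)
    have "cmod (integral {0..x} (\<lambda>s. P s * u' s)) \<le> integral {0..x} (\<lambda>s. C * K * norm (u' s))"
      using x P aiP by (intro integral_norm_bound_integral integrable_on_initial[where b = b]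
          integrable_on_mult_right integrable_subinterval_real[OF nu'])
        (auto simp: norm_mult intro!: mult_right_mono)
    also have "\<dots> \<le> C * K * I"
      unfolding I_def using x CK
      by (auto intro!: mult_left_mono integral_subset_le integrable_subinterval_real[OF nu'] nu')
    finally have "cmod (integral {0..x} (\<lambda>s. P s * u' s)) \<le> C * K * I" .
    moreover have "cmod (P x * u x) \<le> C * K * U"
      using P[OF x] U(2)[OF x] CK by (auto simp: norm_mult intro!: mult_mono)
    ultimately show "cmod (integral {0..x} (\<lambda>s. F s * (u s * f s))) \<le> C * (U + I) * K"
      unfolding eq by (intro norm_triangle_ineq4[THEN order_trans]) (simp add: algebra_simps)
  qed
qed

lemma damped_on_cmult: "damped_on b f \<Longrightarrow> damped_on b (\<lambda>x. c * f x)"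
  by (rule damped_on_mult_ac[where u' = "\<lambda>_. 0"])
    (auto intro!: ac_on_has_vector_derivative derivative_eq_intros)

text \<open>Jordan decomposition: with the increasing majorant \<open>v\<close>, also
  \<open>v\<close> minus the real part and \<open>v\<close> minus the imaginary part of
  \<open>f\<close> are increasing, and \<open>f\<close> is a linear combination of the
  three.\<close>

lemma damped_on_bounded_variation:
  assumes "bounded_variation_on f 0 b"
  shows "damped_on b f"
proof -
  obtain v where v: "\<And>x y. 0 \<le> x \<Longrightarrow> x \<le> y \<Longrightarrow> y \<le> b \<Longrightarrow> cmod (f y - f x) \<le> v y - v x"
    by (rule bounded_variation_increasing_majorant[OF assms]) blast
  have inc: "v x \<le> v y \<and> v x - Re (f x) \<le> v y - Re (f y) \<and> v x - Im (f x) \<le> v y - Im (f y)"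
    if "0 \<le> x" "x \<le> y" "y \<le> b" for x y
    using v[OF that] abs_Re_le_cmod[of "f y - f x"] abs_Im_le_cmod[of "f y - f x"] by auto
  have "damped_on b (\<lambda>x. of_real (v x) + ((-1) * of_real (v x - Re (f x)) +
      \<i> * (of_real (v x) + (-1) * of_real (v x - Im (f x)))))"
    using inc by (intro damped_on_add damped_on_cmult damped_on_increasing) auto
  also have "(\<lambda>x. of_real (v x) + ((-1) * of_real (v x - Re (f x)) +
      \<i> * (of_real (v x) + (-1) * of_real (v x - Im (f x))))) = f"
    by (auto simp: complex_eq_iff)
  finally show ?thesis .
qed

text \<open>The integral of the exponential over any subinterval is a difference of two boundary
  values divided by \<open>\<i> * \<mu>\<close>. This gives the decay in \<mu> and a factor
  2.\<close>

lemma damped_on_exp: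
  assumes "damped_on b f" "0 \<le> b"
  obtains C where "0 \<le> C" "\<And>\<mu> x. \<mu> \<noteq> 0 \<Longrightarrow> x \<in> {0..b} \<Longrightarrow>
    cmod (integral {0..x} (\<lambda>s. exp (\<i> * \<mu> * of_real s) * f s)) \<le> C * exp (b * \<bar>Im \<mu>\<bar>) / cmod \<mu>"
proof -
  obtain C where C: "C \<ge> 0"
    "\<And>F K x. continuous_on {0..b} F \<Longrightarrow>
        (\<And>c d. 0 \<le> c \<Longrightarrow> c \<le> d \<Longrightarrow> d \<le> b \<Longrightarrow> cmod (integral {c..d} F) \<le> K) \<Longrightarrow>
        x\<in>{0..b} \<Longrightarrow> cmod (integral {0..x} (\<lambda>s. F s * f s)) \<le> C * K"
    by (rule damped_onE[OF assms(1)]) blast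
  have "cmod (integral {0..x} (\<lambda>s. exp (\<i> * \<mu> * of_real s) * f s))
      \<le> C * (2 * exp (b * \<bar>Im \<mu>\<bar>) / cmod \<mu>)"
    if \<mu>: "\<mu> \<noteq> 0" and x: "x \<in> {0..b}" for \<mu> x
  proof (rule C(2)[OF _ _ x])
    show "continuous_on {0..b} (\<lambda>s. exp (\<i> * \<mu> * of_real s))"
      by (intro continuous_intros)
    fix c d assume cd: "0 \<le> c" "c \<le> d" "d \<le> b"
    have deriv: "((\<lambda>s. exp (\<i> * \<mu> * of_real s) / (\<i> * \<mu>)) has_vector_derivative
        exp (\<i> * \<mu> * of_real s)) (at s within {c..d})" for s
      using \<mu> by (intro has_vector_derivative_real_field) (auto intro!: derivative_eq_intros)
    have "((\<lambda>s. exp (\<i> * \<mu> * of_real s)) has_integral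
        (exp (\<i> * \<mu> * of_real d) / (\<i> * \<mu>) - exp (\<i> * \<mu> * of_real c) / (\<i> * \<mu>))) {c..d}"
      using cd deriv by (intro fundamental_theorem_of_calculus) auto
    then have "integral {c..d} (\<lambda>s. exp (\<i> * \<mu> * of_real s))
        = (exp (\<i> * \<mu> * of_real d) - exp (\<i> * \<mu> * of_real c)) / (\<i> * \<mu>)"
      by (simp add: integral_unique diff_divide_distrib)
    moreover have "cmod (exp (\<i> * \<mu> * of_real s)) \<le> exp (b * \<bar>Im \<mu>\<bar>)" if "0 \<le> s" "s \<le> b" for s
    proof -
      have "- (Im \<mu> * s) \<le> \<bar>Im \<mu>\<bar> * s"
        using that by (metis abs_ge_minus_self mult_minus_left mult_right_mono)
      also have "\<dots> \<le> \<bar>Im \<mu>\<bar> * b" using that by (intro mult_left_mono) auto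
      finally show ?thesis by (simp add: mult.commute)
    qed
    then have "cmod (exp (\<i> * \<mu> * of_real d) - exp (\<i> * \<mu> * of_real c)) \<le> 2 * exp (b * \<bar>Im \<mu>\<bar>)"
      using cd norm_triangle_ineq4[of "exp (\<i> * \<mu> * of_real d)" "exp (\<i> * \<mu> * of_real c)"]
      by (smt (verit))
    ultimately show "cmod (integral {c..d} (\<lambda>s. exp (\<i> * \<mu> * of_real s)))
        \<le> 2 * exp (b * \<bar>Im \<mu>\<bar>) / cmod \<mu>"
      using \<mu> by (simp add: norm_divide norm_mult divide_right_mono)
  qed
  then show ?thesis using that[of "2 * C"] C(1) by (simp add: algebra_simps)
qed

section \<open>The fundamental matrix\<close>

definition bounded_integrable :: "real \<Rightarrow> real \<Rightarrow> (real \<Rightarrow> complex) \<Rightarrow> bool" where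
  "bounded_integrable b B p \<longleftrightarrow> p absolutely_integrable_on {0..b} \<and> (\<forall>x\<in>{0..b}. cmod (p x) \<le> B)"

lemma bounded_integrableD:
  assumes "bounded_integrable b B p"
  shows "p absolutely_integrable_on {0..b}" "x \<in> {0..b} \<Longrightarrow> cmod (p x) \<le> B"
  using assms by (auto simp: bounded_integrable_def)

lemma bounded_integrable_uminus: "bounded_integrable b B p \<Longrightarrow> bounded_integrable b B (\<lambda>x. - p x)"
  using absolutely_integrable_continuous_mult[of 0 b p "\<lambda>_. -1"]
  by (auto simp: bounded_integrable_def)

lemma norm_integral_initial_le:
  fixes f :: "real \<Rightarrow> complex"
  assumes "f absolutely_integrable_on {0..b}" "\<And>x. x \<in> {0..b} \<Longrightarrow> cmod (f x) \<le> K" "x \<in> {0..b}"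
  shows "cmod (integral {0..x} f) \<le> K * b"
proof -
  have "cmod (integral {0..x} f) \<le> integral {0..x} (\<lambda>_. K)"
    using assms by (intro integral_norm_bound_integral integrable_on_initial[OF assms(1)]) auto
  also have "\<dots> = K * x" using assms(3) by simp
  also have "\<dots> \<le> K * b"
    using order_trans[OF norm_ge_zero assms(2)[OF assms(3)]] assms(3) by (intro mult_left_mono) auto
  finally show ?thesis .
qed

text \<open>Iterated integrals of the Picard iteration for \<open>e' = p f\<close>, \<open>f' = q e\<close>, \<open>e 0 = f 0 = 1\<close>;
  the solution is \<open>e = volterra_sum p q\<close>, \<open>f = volterra_sum q p\<close>.\<close>
primrec volterra :: "nat \<Rightarrow> (real \<Rightarrow> complex) \<Rightarrow> (real \<Rightarrow> complex) \<Rightarrow> real \<Rightarrow> complex" where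
  "volterra 0 p q = (\<lambda>x. 1)"
| "volterra (Suc n) p q = (\<lambda>x. integral {0..x} (\<lambda>s. p s * volterra n q p s))"

definition volterra_sum :: "(real \<Rightarrow> complex) \<Rightarrow> (real \<Rightarrow> complex) \<Rightarrow> real \<Rightarrow> complex" where
  "volterra_sum p q x = (\<Sum>n. volterra n p q x)"

lemma volterra_term_absolutely_integrable:
  assumes "bounded_integrable b B p" "continuous_on {0..b} f"
  shows "(\<lambda>s. p s * f s) absolutely_integrable_on {0..b}"
  using absolutely_integrable_continuous_mult[OF bounded_integrableD(1)[OF assms(1)] assms(2)]
  by (simp add: mult.commute)

lemma volterra_continuous:
  assumes "bounded_integrable b B p" "bounded_integrable b B q"
  shows "continuous_on {0..b} (volterra n p q)"
  using assms
proof (induction n arbitrary: p q)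
  case (Suc n)
  then have "(\<lambda>s. p s * volterra n q p s) absolutely_integrable_on {0..b}"
    by (intro volterra_term_absolutely_integrable) auto
  then show ?case
    unfolding volterra.simps
    by (intro indefinite_integral_continuous_1) (auto simp: absolutely_integrable_on_def)
qed auto

lemma volterra_bound:
  assumes "bounded_integrable b B p" "bounded_integrable b B q" "x \<in> {0..b}" "0 \<le> B"
  shows "cmod (volterra n p q x) \<le> (B * x) ^ n / fact n"
  using assms
proof (induction n arbitrary: p q x)
  case (Suc n)
  have ai: "(\<lambda>s. p s * volterra n q p s) absolutely_integrable_on {0..b}"
    using Suc.prems by (intro volterra_term_absolutely_integrable volterra_continuous)
  have "((\<lambda>s. B * ((B * s) ^ n / fact n)) has_integral
      ((B * x) ^ Suc n / fact (Suc n) - (B * 0) ^ Suc n / fact (Suc n))) {0..x}"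
  proof (rule fundamental_theorem_of_calculus)
    fix s :: real
    have "((\<lambda>s. (B * s) ^ Suc n / fact (Suc n)) has_real_derivative
        ((1 + of_nat n) * (B * (B * s) ^ n)) / fact (Suc n)) (at s within {0..x})"
      by (intro DERIV_cdivide DERIV_power_Suc) (auto intro!: derivative_eq_intros)
    also have "((1 + of_nat n) * (B * (B * s) ^ n)) / fact (Suc n) = B * ((B * s) ^ n / fact n)"
      by (simp add: fact_Suc divide_simps)
    finally show "((\<lambda>s. (B * s) ^ Suc n / fact (Suc n)) has_vector_derivative
        B * ((B * s) ^ n / fact n)) (at s within {0..x})"
      by (simp add: has_real_derivative_iff_has_vector_derivative)
  qed (use Suc.prems in auto)
  then have int: "((\<lambda>s. B * ((B * s) ^ n / fact n)) has_integral (B * x) ^ Suc n / fact (Suc n))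
      {0..x}"
    by simp
  have "cmod (volterra (Suc n) p q x) \<le> integral {0..x} (\<lambda>s. B * ((B * s) ^ n / fact n))"
    unfolding volterra.simps
  proof (rule integral_norm_bound_integral)
    show "(\<lambda>s. p s * volterra n q p s) integrable_on {0..x}"
      using ai Suc.prems by (intro integrable_on_initial)
    show "(\<lambda>s. B * ((B * s) ^ n / fact n)) integrable_on {0..x}"
      using int by blast
    fix s assume "s \<in> {0..x}"
    then show "cmod (p s * volterra n q p s) \<le> B * ((B * s) ^ n / fact n)"
      unfolding norm_mult using Suc.prems Suc.IH[of q p s] bounded_integrableD(2)[OF Suc.prems(1),
          of s]
      by (intro mult_mono) auto
  qed
  then show ?case using integral_unique[OF int] by simp
qed auto

lemma volterra_bound_uniform:
  assumes "bounded_integrable b B p" "bounded_integrable b B q" "x \<in> {0..b}" "0 \<le> B"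
  shows "cmod (volterra n p q x) \<le> (B * b) ^ n / fact n"
  using assms by (intro order_trans[OF volterra_bound[OF assms]] divide_right_mono power_mono
      mult_mono) auto

lemma summable_exp_bound: "summable (\<lambda>n. (B * b) ^ n / fact n :: real)"
  using summable_exp[of "B * b"] by (simp add: divide_inverse mult.commute)

lemma suminf_exp_bound: "(\<Sum>n. (B * b) ^ n / fact n) = exp (B * b :: real)"
  by (simp add: exp_def divide_inverse mult.commute)

lemma volterra_sums:
  assumes "bounded_integrable b B p" "bounded_integrable b B q" "x \<in> {0..b}" "0 \<le> B"
  shows "(\<lambda>n. volterra n p q x) sums volterra_sum p q x"
  unfolding volterra_sum_def
  by (intro summable_sums summable_comparison_test[OF _ summable_exp_bound])
    (use volterra_bound_uniform[OF assms] in auto)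

lemma volterra_partial_sum_bound:
  assumes "bounded_integrable b B p" "bounded_integrable b B q" "x \<in> {0..b}" "0 \<le> B"
  shows "cmod (\<Sum>n<N. volterra n p q x) \<le> exp (B * b)"
proof -
  have "cmod (\<Sum>n<N. volterra n p q x) \<le> (\<Sum>n<N. (B * b) ^ n / fact n)"
    by (intro sum_norm_le volterra_bound_uniform[OF assms])
  also have "\<dots> \<le> (\<Sum>n. (B * b) ^ n / fact n)"
    using assms by (intro sum_le_suminf summable_exp_bound) auto
  finally show ?thesis by (simp add: suminf_exp_bound)
qed

lemma volterra_sum_bound:
  assumes "bounded_integrable b B p" "bounded_integrable b B q" "x \<in> {0..b}" "0 \<le> B"
  shows "cmod (volterra_sum p q x) \<le> exp (B * b)"
  using tendsto_norm[OF volterra_sums[OF assms, unfolded sums_def]]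
  by (rule Lim_bounded) (use volterra_partial_sum_bound[OF assms] in auto)

text \<open>Summing the recursion and passing to the limit under the integral by dominated
  convergence turns the series into a solution of the integral equation.\<close>

lemma volterra_sum_ac:
  assumes p: "bounded_integrable b B p" and q: "bounded_integrable b B q" and B: "0 \<le> B"
  shows "ac_on b (volterra_sum p q) (\<lambda>x. p x * volterra_sum q p x)"
    and "0 \<le> b \<Longrightarrow> volterra_sum p q 0 = 1"
proof -
  have ai: "(\<lambda>s. p s * (\<Sum>n<N. volterra n q p s)) absolutely_integrable_on {0..b}" for N
    using p q by (intro volterra_term_absolutely_integrable continuous_on_sum volterra_continuous)
  \<comment> \<open>Continuity of the sum is a consequence of the integral equation. Until that is
    proved, measurability as a pointwise limit makes the integrand integrable.\<close>
  have meas: "volterra_sum q p \<in> borel_measurable (lebesgue_on {0..b})"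
  proof (rule borel_measurable_LIMSEQ_metric)
    show "(\<lambda>x. \<Sum>n<N. volterra n q p x) \<in> borel_measurable (lebesgue_on {0..b})" for N
      using p q by (intro continuous_imp_measurable_on_sets_lebesgue continuous_on_sum
          volterra_continuous) auto
    show "(\<lambda>N. \<Sum>n<N. volterra n q p x) \<longlonglongrightarrow> volterra_sum q p x"
      if "x \<in> space (lebesgue_on {0..b})" for x
      using volterra_sums[OF q p _ B, of x] that by (simp add: sums_def)
  qed
  have ai': "(\<lambda>s. p s * volterra_sum q p s) absolutely_integrable_on {0..b}"
    using absolutely_integrable_bounded_mult[OF bounded_integrableD(1)[OF p] meas
        volterra_sum_bound[OF q p _ B]] by (simp add: mult.commute)
  have int: "volterra_sum p q x = 1 + integral {0..x} (\<lambda>s. p s * volterra_sum q p s)"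
    if x: "x \<in> {0..b}" for x
  proof -
    have "(\<lambda>N. integral {0..x} (\<lambda>s. p s * (\<Sum>n<N. volterra n q p s)))
        \<longlonglongrightarrow> integral {0..x} (\<lambda>s. p s * volterra_sum q p s)"
    proof (rule dominated_convergence(2))
      show "(\<lambda>s. p s * (\<Sum>n<N. volterra n q p s)) integrable_on {0..x}" for N
        using ai x by (rule integrable_on_initial)
      show "(\<lambda>s. B * exp (B * b)) integrable_on {0..x}" by (rule integrable_const_ivl)
      fix s assume s: "s \<in> {0..x}"
      then show "norm (p s * (\<Sum>n<N. volterra n q p s)) \<le> B * exp (B * b)" for N
        unfolding norm_mult using x B bounded_integrableD(2)[OF p, of s]
          volterra_partial_sum_bound[OF q p _ B, of s N]
        by (intro mult_mono) auto
      show "(\<lambda>N. p s * (\<Sum>n<N. volterra n q p s)) \<longlonglongrightarrow> p s * volterra_sum q p s"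
        using volterra_sums[OF q p _ B, of s] s x by (intro tendsto_mult_left) (auto simp: sums_def)
    qed
    also have "(\<lambda>N. integral {0..x} (\<lambda>s. p s * (\<Sum>n<N. volterra n q p s)))
        = (\<lambda>N. \<Sum>n<N. volterra (Suc n) p q x)"
    proof
      fix N
      have "(\<lambda>s. p s * volterra n q p s) integrable_on {0..x}" for n
        using x p q by (intro integrable_on_initial volterra_term_absolutely_integrable
            volterra_continuous)
      then show "integral {0..x} (\<lambda>s. p s * (\<Sum>n<N. volterra n q p s))
          = (\<Sum>n<N. volterra (Suc n) p q x)"
        by (simp add: sum_distrib_left Henstock_Kurzweil_Integration.integral_sum)
    qed
    finally have "(\<lambda>n. volterra (Suc n) p q x) sums integral {0..x} (\<lambda>s. p s * volterra_sum q p s)"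
      by (simp add: sums_def)
    then have "(\<lambda>n. volterra n p q x) sums (integral {0..x} (\<lambda>s. p s * volterra_sum q p s) +
        volterra 0 p q x)"
      by (rule sums_Suc)
    with volterra_sums[OF p q x B] have
      "volterra_sum p q x = integral {0..x} (\<lambda>s. p s * volterra_sum q p s) + volterra 0 p q x"
      by (rule sums_unique2)
    then show ?thesis by simp
  qed
  show 0: "volterra_sum p q 0 = 1" if "0 \<le> b"
    using int[of 0] that by simp
  show "ac_on b (volterra_sum p q) (\<lambda>x. p x * volterra_sum q p x)"
    unfolding ac_on_def
  proof (intro conjI ballI ai')
    fix x assume x: "x \<in> {0..b}"
    then have "0 \<le> b" by auto
    then show "volterra_sum p q x = volterra_sum p q 0 + integral {0..x} (\<lambda>x. p x * volterra_sum q p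
        x)"
      using int[OF x] 0 by simp
  qed
qed

lemma volterra_holomorphic:
  fixes p q :: "complex \<Rightarrow> real \<Rightarrow> complex"
  assumes bi: "\<And>r. \<exists>B\<ge>0. \<forall>z. cmod z \<le> r \<longrightarrow> bounded_integrable b B (p z)
      \<and> bounded_integrable b B (q z)"
    and holo: "\<And>s. (\<lambda>z. p z s) holomorphic_on UNIV" "\<And>s. (\<lambda>z. q z s) holomorphic_on UNIV"
    and x: "x \<in> {0..b}"
  shows "(\<lambda>z. volterra n (p z) (q z) x) holomorphic_on UNIV"
  using assms
proof (induction n arbitrary: p q x)
  case (Suc n)
  note x = \<open>x \<in> {0..b}\<close>
  have bi: "\<exists>B\<ge>0. \<forall>z. cmod z \<le> r \<longrightarrow> bounded_integrable b B (q z) \<and> bounded_integrable b B (p z)"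
      for r
    using Suc.prems(1)[of r] by blast
  show ?case
    unfolding volterra.simps
  proof (rule holomorphic_integral)
    show "(\<lambda>s. p z s * volterra n (q z) (p z) s) integrable_on {0..x}" for z
    proof -
      obtain B where B: "bounded_integrable b B (p z)" "bounded_integrable b B (q z)"
        using bi[of "cmod z"] by auto
      then show ?thesis
        using x by (intro integrable_on_initial volterra_term_absolutely_integrable
            volterra_continuous)
    qed
    show "(\<lambda>z. p z s * volterra n (q z) (p z) s) holomorphic_on UNIV" if "s \<in> {0..x}" for s
      using that x by (intro holomorphic_on_mult Suc.prems Suc.IH bi) auto
    fix r
    obtain B where B: "B \<ge> 0" "\<And>z. cmod z \<le> r \<Longrightarrow> bounded_integrable b B (p z)
        \<and> bounded_integrable b B (q z)"
      using bi[of r] by blast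
    have "cmod (p z s * volterra n (q z) (p z) s) \<le> B * ((B * b) ^ n / fact n)"
      if "s \<in> {0..x}" "cmod z \<le> r" for s z
      unfolding norm_mult using that x B bounded_integrableD(2)[of b B "p z" s]
        volterra_bound_uniform[of b B "q z" "p z" s n]
      by (intro mult_mono) auto
    then show "\<exists>g. g integrable_on {0..x} \<and>
        (\<forall>s\<in>{0..x}. \<forall>z. cmod z \<le> r \<longrightarrow> cmod (p z s * volterra n (q z) (p z) s) \<le> g s)"
      by (intro exI[of _ "\<lambda>_. B * ((B * b) ^ n / fact n)"]) auto
  qed
qed auto

text \<open>On a unit disc about \<open>z0\<close> one bound \<open>B\<close> serves all parameters,
  so the exponential majorant gives uniform convergence of holomorphic partial sums.\<close>

lemma volterra_sum_holomorphic:
  fixes p q :: "complex \<Rightarrow> real \<Rightarrow> complex"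
  assumes bi: "\<And>r. \<exists>B\<ge>0. \<forall>z. cmod z \<le> r \<longrightarrow> bounded_integrable b B (p z)
      \<and> bounded_integrable b B (q z)"
    and holo: "\<And>s. (\<lambda>z. p z s) holomorphic_on UNIV" "\<And>s. (\<lambda>z. q z s) holomorphic_on UNIV"
    and x: "x \<in> {0..b}"
  shows "(\<lambda>z. volterra_sum (p z) (q z) x) holomorphic_on UNIV"
proof (rule holomorphic_uniform_sequence)
  show "(\<lambda>z. \<Sum>n<N. volterra n (p z) (q z) x) holomorphic_on UNIV" for N
    by (intro holomorphic_on_sum volterra_holomorphic[OF assms])
  show "\<exists>d>0. cball z0 d \<subseteq> UNIV \<and> uniform_limit (cball z0 d) (\<lambda>N z. \<Sum>n<N. volterra n (p z) (q z) x)
      (\<lambda>z. volterra_sum (p z) (q z) x) sequentially" for z0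
  proof (intro exI[of _ 1] conjI)
    obtain B where B: "B \<ge> 0" "\<And>z. cmod z \<le> cmod z0 + 1 \<Longrightarrow> bounded_integrable b B (p z)
        \<and> bounded_integrable b B (q z)"
      using bi[of "cmod z0 + 1"] by blast
    have "cmod z \<le> cmod z0 + 1" if "z \<in> cball z0 1" for z
      using that norm_triangle_ineq2[of z z0] by (simp add: dist_norm norm_minus_commute)
    then show "uniform_limit (cball z0 1) (\<lambda>N z. \<Sum>n<N. volterra n (p z) (q z) x)
      (\<lambda>z. volterra_sum (p z) (q z) x) sequentially"
      unfolding volterra_sum_def using B x
      by (intro Weierstrass_m_test[OF _ summable_exp_bound] volterra_bound_uniform) auto
  qed auto
qed auto

text \<open>Integration by parts trades the smallness of the primitives of the coefficients.\<close>
lemma volterra_sum_near_1: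
  assumes p: "bounded_integrable b B p" and q: "bounded_integrable b B q" and B: "0 \<le> B"
    and small: "\<And>x. x \<in> {0..b} \<Longrightarrow> cmod (integral {0..x} p) \<le> \<epsilon>"
    and x: "x \<in> {0..b}"
  shows "cmod (volterra_sum p q x - 1) \<le> \<epsilon> * ((1 + B * b) * exp (B * b))"
proof -
  define P where "P x = integral {0..x} p" for x
  define E where "E = exp (B * b)"
  have P: "ac_on b P p"
    using ac_on_integral[OF bounded_integrableD(1)[OF p], of 0] by (simp add: P_def[abs_def])
  have \<epsilon>: "0 \<le> \<epsilon>" using small[OF x] norm_ge_zero order_trans by blast
  note V = volterra_sum_ac(1)[OF p q B] volterra_sum_ac(1)[OF q p B]
  note bound = volterra_sum_bound[OF p q _ B, folded E_def] volterra_sum_bound[OF q p _ B, folded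
      E_def]
  have ai: "(\<lambda>s. P s * (q s * volterra_sum p q s)) absolutely_integrable_on {0..b}"
    "(\<lambda>s. volterra_sum q p s * p s) absolutely_integrable_on {0..b}"
    by (intro absolutely_integrable_continuous_mult ac_on_continuous[OF P] ac_on_continuous[OF V(2)]
        ac_on_absolutely_integrable[OF V(2)] bounded_integrableD(1)[OF p])+
  have "volterra_sum p q x - 1 = integral {0..x} (\<lambda>s. volterra_sum q p s * p s)"
    using ac_on_eq[OF V(1) x] volterra_sum_ac(2)[OF p q B] x by (simp add: mult.commute)
  also have "\<dots> = integral {0..x} (\<lambda>s. P s * (q s * volterra_sum p q s) + volterra_sum q p s * p s)
      - integral {0..x} (\<lambda>s. P s * (q s * volterra_sum p q s))"
    using ai x by (subst Henstock_Kurzweil_Integration.integral_add) (auto intro: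
        integrable_on_initial)
  also have "integral {0..x} (\<lambda>s. P s * (q s * volterra_sum p q s) + volterra_sum q p s * p s)
      = P x * volterra_sum q p x"
    using ac_on_eq[OF ac_on_mult[OF P V(2)] x] by (simp add: P_def)
  finally have eq: "volterra_sum p q x - 1
      = P x * volterra_sum q p x - integral {0..x} (\<lambda>s. P s * (q s * volterra_sum p q s))" .
  have "cmod (integral {0..x} (\<lambda>s. P s * (q s * volterra_sum p q s))) \<le> (\<epsilon> * (B * E)) * b"
  proof (rule norm_integral_initial_le[OF ai(1) _ x])
    fix s assume "s \<in> {0..b}"
    then show "cmod (P s * (q s * volterra_sum p q s)) \<le> \<epsilon> * (B * E)"
      unfolding norm_mult P_def using small[of s] bound(1)[of s] bounded_integrableD(2)[OF q, of s]
          B \<epsilon>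
      by (intro mult_mono) auto
  qed
  moreover have "cmod (P x * volterra_sum q p x) \<le> \<epsilon> * E"
    unfolding norm_mult P_def using small[OF x] bound(2)[OF x] \<epsilon> by (intro mult_mono) auto
  ultimately show ?thesis
    unfolding eq E_def[symmetric]
    by (intro norm_triangle_ineq4[THEN order_trans]) (simp add: algebra_simps)
qed

text \<open>The fundamental matrix of \<open>\<zeta>\<^sub>1' = p \<zeta>\<^sub>2\<close>, \<open>\<zeta>\<^sub>2' = q \<zeta>\<^sub>1\<close> has rows \<open>(vcosh p q, vsinh p q)\<close>
  and \<open>(vsinh q p, vcosh q p)\<close>.\<close>
definition vcosh :: "(real \<Rightarrow> complex) \<Rightarrow> (real \<Rightarrow> complex) \<Rightarrow> real \<Rightarrow> complex" where
  "vcosh p q x = (volterra_sum p q x + volterra_sum (\<lambda>x. - p x) (\<lambda>x. - q x) x) / 2"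

definition vsinh :: "(real \<Rightarrow> complex) \<Rightarrow> (real \<Rightarrow> complex) \<Rightarrow> real \<Rightarrow> complex" where
  "vsinh p q x = (volterra_sum p q x - volterra_sum (\<lambda>x. - p x) (\<lambda>x. - q x) x) / 2"

text \<open>Negating both coefficients multiplies the n-th Picard term by (-1)^n, so
  \<open>vcosh\<close> and \<open>vsinh\<close> are the even and the odd part of the series.
  Equivalently, solutions with initial values (1, 1) and (1, -1) are averaged to get those with (1,
  0) and (0, 1).\<close>

lemma
  assumes p: "bounded_integrable b B p" and q: "bounded_integrable b B q" and B: "0 \<le> B"
  shows vcosh_ac: "ac_on b (vcosh p q) (\<lambda>x. p x * vsinh q p x)"
    and vsinh_ac: "ac_on b (vsinh p q) (\<lambda>x. p x * vcosh q p x)"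
    and vcosh_0: "0 \<le> b \<Longrightarrow> vcosh p q 0 = 1"
    and vsinh_0: "0 \<le> b \<Longrightarrow> vsinh p q 0 = 0"
    and vcosh_bound: "x \<in> {0..b} \<Longrightarrow> cmod (vcosh p q x) \<le> exp (B * b)"
    and vsinh_bound: "x \<in> {0..b} \<Longrightarrow> cmod (vsinh p q x) \<le> exp (B * b)"
proof -
  note p' = bounded_integrable_uminus[OF p] and q' = bounded_integrable_uminus[OF q]
  note V = volterra_sum_ac[OF p q B] volterra_sum_ac[OF p' q' B]
  show "ac_on b (vcosh p q) (\<lambda>x. p x * vsinh q p x)"
    by (rule ac_on_cong[OF ac_on_add[OF ac_on_cmult[OF V(1), of "1/2"] ac_on_cmult[OF V(3), of
        "1/2"]]])
      (auto simp: vcosh_def vsinh_def field_simps)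
  show "ac_on b (vsinh p q) (\<lambda>x. p x * vcosh q p x)"
    by (rule ac_on_cong[OF ac_on_add[OF ac_on_cmult[OF V(1), of "1/2"] ac_on_cmult[OF V(3), of
        "-1/2"]]])
      (auto simp: vcosh_def vsinh_def field_simps)
  show "0 \<le> b \<Longrightarrow> vcosh p q 0 = 1" "0 \<le> b \<Longrightarrow> vsinh p q 0 = 0"
    using V by (auto simp: vcosh_def vsinh_def)
  assume x: "x \<in> {0..b}"
  have "cmod (volterra_sum p q x) \<le> exp (B * b)"
    "cmod (volterra_sum (\<lambda>x. - p x) (\<lambda>x. - q x) x) \<le> exp (B * b)"
    using volterra_sum_bound[OF p q x B] volterra_sum_bound[OF p' q' x B] by auto
  then show "cmod (vcosh p q x) \<le> exp (B * b)" "cmod (vsinh p q x) \<le> exp (B * b)"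
    unfolding vcosh_def vsinh_def
    using norm_triangle_ineq[of "volterra_sum p q x" "volterra_sum (\<lambda>x. - p x) (\<lambda>x. - q x) x"]
      norm_triangle_ineq4[of "volterra_sum p q x" "volterra_sum (\<lambda>x. - p x) (\<lambda>x. - q x) x"]
    by (auto simp: norm_divide)
qed

lemma
  assumes p: "bounded_integrable b B p" and q: "bounded_integrable b B q" and B: "0 \<le> B"
    and small: "\<And>x. x \<in> {0..b} \<Longrightarrow> cmod (integral {0..x} p) \<le> \<epsilon>"
    and x: "x \<in> {0..b}"
  shows vcosh_near_1: "cmod (vcosh p q x - 1) \<le> \<epsilon> * ((1 + B * b) * exp (B * b))"
    and vsinh_near_0: "cmod (vsinh p q x) \<le> \<epsilon> * ((1 + B * b) * exp (B * b))"
proof -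
  define K where "K = \<epsilon> * ((1 + B * b) * exp (B * b))"
  define u where "u = volterra_sum p q x - 1"
  define v where "v = volterra_sum (\<lambda>x. - p x) (\<lambda>x. - q x) x - 1"
  have "cmod u \<le> K" "cmod v \<le> K"
    using volterra_sum_near_1[OF p q B small x]
      volterra_sum_near_1[OF bounded_integrable_uminus[OF p] bounded_integrable_uminus[OF q] B _ x,
          of \<epsilon>] small
    by (auto simp: u_def v_def K_def)
  then have "cmod ((u + v) / 2) \<le> K" "cmod ((u - v) / 2) \<le> K"
    using norm_triangle_ineq[of u v] norm_triangle_ineq4[of u v] by (auto simp: norm_divide)
  moreover have "vcosh p q x - 1 = (u + v) / 2" "vsinh p q x = (u - v) / 2"
    by (auto simp: vcosh_def vsinh_def u_def v_def field_simps)
  ultimately show "cmod (vcosh p q x - 1) \<le> K" "cmod (vsinh p q x) \<le> K"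
    by (simp_all only:)
qed

lemma
  fixes p q :: "complex \<Rightarrow> real \<Rightarrow> complex"
  assumes bi: "\<And>r. \<exists>B\<ge>0. \<forall>z. cmod z \<le> r \<longrightarrow> bounded_integrable b B (p z)
      \<and> bounded_integrable b B (q z)"
    and holo: "\<And>s. (\<lambda>z. p z s) holomorphic_on UNIV" "\<And>s. (\<lambda>z. q z s) holomorphic_on UNIV"
    and x: "x \<in> {0..b}"
  shows vcosh_holomorphic: "(\<lambda>z. vcosh (p z) (q z) x) holomorphic_on UNIV"
    and vsinh_holomorphic: "(\<lambda>z. vsinh (p z) (q z) x) holomorphic_on UNIV"
proof -
  have "\<exists>B\<ge>0. \<forall>z. cmod z \<le> r \<longrightarrow> bounded_integrable b B (\<lambda>x. - p z x)
      \<and> bounded_integrable b B (\<lambda>x. - q z x)" for r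
    using bi[of r] bounded_integrable_uminus by blast
  then have "(\<lambda>z. volterra_sum (\<lambda>x. - p z x) (\<lambda>x. - q z x) x) holomorphic_on UNIV"
    using holo x by (intro volterra_sum_holomorphic) (auto intro: holomorphic_intros)
  moreover have "(\<lambda>z. volterra_sum (p z) (q z) x) holomorphic_on UNIV"
    by (rule volterra_sum_holomorphic[OF assms])
  ultimately show "(\<lambda>z. vcosh (p z) (q z) x) holomorphic_on UNIV"
    "(\<lambda>z. vsinh (p z) (q z) x) holomorphic_on UNIV"
    unfolding vcosh_def vsinh_def by (auto intro!: holomorphic_intros)
qed

text \<open>Liouville's formula for a coefficient matrix with zero diagonal: by the product rule the
  density of the determinant cancels identically.\<close>

lemma fundamental_det:
  assumes p: "bounded_integrable b B p" and q: "bounded_integrable b B q" and B: "0 \<le> B"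
    and x: "x \<in> {0..b}"
  shows "vcosh p q x * vcosh q p x - vsinh p q x * vsinh q p x = 1"
proof -
  note * = ac_on_add[OF ac_on_mult[OF vcosh_ac[OF p q B] vcosh_ac[OF q p B]]
      ac_on_cmult[OF ac_on_mult[OF vsinh_ac[OF p q B] vsinh_ac[OF q p B]], of "-1"]]
  have "0 \<le> b" using x by auto
  moreover have "integral {0..x} (\<lambda>s. vcosh p q s * (q s * vsinh p q s) + vcosh q p s * (p s * vsinh
      q p s) +
      (-1) * (vsinh p q s * (q s * vcosh p q s) + vsinh q p s * (p s * vcosh q p s)))
          = integral {0..x} (\<lambda>s. 0)"
    by (intro integral_cong) (simp add: algebra_simps)
  ultimately show ?thesis
    using ac_on_eq[OF * x] by (simp add: vcosh_0[OF p q B] vcosh_0[OF q p B] vsinh_0[OF p q B])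
qed

text \<open>With determinant 1 the inverse of the fundamental matrix is its adjugate. Applied to the
  solution it produces functions whose densities contain nothing but the forcing; multiplying back
  recovers the solution.\<close>

lemma variation_of_constants:
  assumes p: "bounded_integrable b B p" and q: "bounded_integrable b B q" and B: "0 \<le> B"
    and \<zeta>1: "ac_on b \<zeta>1 (\<lambda>x. p x * \<zeta>2 x + \<phi>1 x)" and \<zeta>2: "ac_on b \<zeta>2 (\<lambda>x. q x * \<zeta>1 x + \<phi>2 x)"
    and x: "x \<in> {0..b}"
  defines "w1 \<equiv> \<lambda>x. integral {0..x} (\<lambda>s. vcosh q p s * \<phi>1 s - vsinh p q s * \<phi>2 s)"
    and "w2 \<equiv> \<lambda>x. integral {0..x} (\<lambda>s. vcosh p q s * \<phi>2 s - vsinh q p s * \<phi>1 s)"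
  shows "\<zeta>1 x = vcosh p q x * (\<zeta>1 0 + w1 x) + vsinh p q x * (\<zeta>2 0 + w2 x)"
    and "\<zeta>2 x = vsinh q p x * (\<zeta>1 0 + w1 x) + vcosh q p x * (\<zeta>2 0 + w2 x)"
proof -
  have b: "0 \<le> b" using x by auto
  note init = vcosh_0[OF p q B b] vcosh_0[OF q p B b] vsinh_0[OF p q B b] vsinh_0[OF q p B b]
  note 1 = ac_on_add[OF ac_on_mult[OF vcosh_ac[OF q p B] \<zeta>1]
      ac_on_cmult[OF ac_on_mult[OF vsinh_ac[OF p q B] \<zeta>2], of "-1"]]
  have "integral {0..x} (\<lambda>s. vcosh q p s * (p s * \<zeta>2 s + \<phi>1 s) + \<zeta>1 s * (q s * vsinh p q s) +
     - 1 * (vsinh p q s * (q s * \<zeta>1 s + \<phi>2 s) + \<zeta>2 s * (p s * vcosh q p s))) = w1 x"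
    unfolding w1_def by (intro integral_cong) (simp add: algebra_simps)
  then have w1: "vcosh q p x * \<zeta>1 x - vsinh p q x * \<zeta>2 x = \<zeta>1 0 + w1 x"
    using ac_on_eq[OF 1 x] by (simp add: init)
  note 2 = ac_on_add[OF ac_on_mult[OF vcosh_ac[OF p q B] \<zeta>2]
      ac_on_cmult[OF ac_on_mult[OF vsinh_ac[OF q p B] \<zeta>1], of "-1"]]
  have "integral {0..x} (\<lambda>s. vcosh p q s * (q s * \<zeta>1 s + \<phi>2 s) + \<zeta>2 s * (p s * vsinh q p s) +
     - 1 * (vsinh q p s * (p s * \<zeta>2 s + \<phi>1 s) + \<zeta>1 s * (q s * vcosh p q s))) = w2 x"
    unfolding w2_def by (intro integral_cong) (simp add: algebra_simps)
  then have w2: "vcosh p q x * \<zeta>2 x - vsinh q p x * \<zeta>1 x = \<zeta>2 0 + w2 x"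
    using ac_on_eq[OF 2 x] by (simp add: init)
  have det: "vcosh p q x * vcosh q p x - vsinh p q x * vsinh q p x = 1"
    by (rule fundamental_det[OF p q B x])
  have "(vcosh p q x * vcosh q p x - vsinh p q x * vsinh q p x) * \<zeta>1 x
      = vcosh p q x * (\<zeta>1 0 + w1 x) + vsinh p q x * (\<zeta>2 0 + w2 x)"
    unfolding w1[symmetric] w2[symmetric] by (simp add: algebra_simps)
  then show "\<zeta>1 x = vcosh p q x * (\<zeta>1 0 + w1 x) + vsinh p q x * (\<zeta>2 0 + w2 x)"
    by (simp add: det)
  have "(vcosh p q x * vcosh q p x - vsinh p q x * vsinh q p x) * \<zeta>2 x
      = vsinh q p x * (\<zeta>1 0 + w1 x) + vcosh q p x * (\<zeta>2 0 + w2 x)"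
    unfolding w1[symmetric] w2[symmetric] by (simp add: algebra_simps)
  then show "\<zeta>2 x = vsinh q p x * (\<zeta>1 0 + w1 x) + vcosh q p x * (\<zeta>2 0 + w2 x)"
    by (simp add: det)
qed

lemma norm_integral_exp_le:
  fixes f :: "real \<Rightarrow> complex"
  assumes "f absolutely_integrable_on {0..b}" "x \<in> {0..b}" "0 < \<eta>" "0 \<le> K"
    and "\<And>s. s \<in> {0..b} \<Longrightarrow> cmod (f s) \<le> K * exp (2 * \<eta> * s)"
  shows "cmod (integral {0..x} f) \<le> K * exp (2 * \<eta> * x) / (2 * \<eta>)"
proof -
  have "((\<lambda>s. K * exp (2 * \<eta> * s)) has_integral
      (K * exp (2 * \<eta> * x) / (2 * \<eta>) - K * exp (2 * \<eta> * 0) / (2 * \<eta>))) {0..x}"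
    using assms by (intro fundamental_theorem_of_calculus)
      (auto intro!: derivative_eq_intros simp flip: has_real_derivative_iff_has_vector_derivative)
  note int = this
  have "cmod (integral {0..x} f) \<le> integral {0..x} (\<lambda>s. K * exp (2 * \<eta> * s))"
    using assms int by (intro integral_norm_bound_integral integrable_on_initial[OF assms(1)]) auto
  also have "\<dots> \<le> K * exp (2 * \<eta> * x) / (2 * \<eta>)"
    using integral_unique[OF int] assms by simp
  finally show ?thesis .
qed

text \<open>Both estimates follow from the integral equations by taking suprema, since the double integral
  of \<open>\<bar>p s q r\<bar>\<close> over \<open>r < s\<close> is \<open>O(1/\<eta>)\<close>.\<close>
lemma
  assumes p: "bounded_integrable b B' p" and q: "bounded_integrable b B' q" and B': "0 \<le> B'"
    and \<eta>: "0 < \<eta>" "B\<^sup>2 * b \<le> \<eta>" and B: "0 \<le> B" and b: "0 \<le> b"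
    and pb: "\<And>x. x \<in> {0..b} \<Longrightarrow> cmod (p x) \<le> B * exp (- 2 * \<eta> * x)"
    and qb: "\<And>x. x \<in> {0..b} \<Longrightarrow> cmod (q x) \<le> B * exp (2 * \<eta> * x)"
  shows vcosh_decaying: "cmod (vcosh p q b - 1) \<le> B\<^sup>2 * b / \<eta>"
    and vcosh_growing: "exp (- 2 * \<eta> * b) * cmod (vcosh q p b) \<le> exp (- 2 * \<eta> * b) + B\<^sup>2 * b / \<eta>"
proof -
  note ac = vcosh_ac[OF p q B'] vsinh_ac[OF q p B'] vcosh_ac[OF q p B'] vsinh_ac[OF p q B']
  note ai = ac[THEN ac_on_absolutely_integrable]
  have ratio: "B\<^sup>2 * b / \<eta> \<le> 1" using \<eta> by simp
  have "\<exists>x0\<in>{0..b}. \<forall>x\<in>{0..b}. cmod (vcosh p q x) \<le> cmod (vcosh p q x0)"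
    using b ac_on_continuous[OF ac(1)] by (intro continuous_attains_sup continuous_on_norm) auto
  then obtain x0 where x0: "x0 \<in> {0..b}" "\<And>x. x \<in> {0..b} \<Longrightarrow> cmod (vcosh p q x) \<le> cmod (vcosh p q x0)"
    by blast
  define M where "M = cmod (vcosh p q x0)"
  have M: "0 \<le> M" "\<And>x. x \<in> {0..b} \<Longrightarrow> cmod (vcosh p q x) \<le> M"
    using x0 by (auto simp: M_def)
  have S: "cmod (vsinh q p x) \<le> B * M * exp (2 * \<eta> * x) / (2 * \<eta>)" if x: "x \<in> {0..b}" for x
  proof -
    have "cmod (q s * vcosh p q s) \<le> B * M * exp (2 * \<eta> * s)" if "s \<in> {0..b}" for s
      using mult_mono[OF qb[OF that] M(2)[OF that]] B by (simp add: norm_mult algebra_simps)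
    then show ?thesis
      using norm_integral_exp_le[OF ai(2) x \<eta>(1), of "B * M"] B M ac_on_eq[OF ac(2) x]
        vsinh_0[OF q p B' b] by simp
  qed
  have C: "cmod (vcosh p q x - 1) \<le> B\<^sup>2 * b * M / (2 * \<eta>)" if x: "x \<in> {0..b}" for x
  proof -
    have "cmod (p s * vsinh q p s) \<le> B\<^sup>2 * M / (2 * \<eta>)" if "s \<in> {0..b}" for s
    proof -
      have "cmod (p s * vsinh q p s) \<le> B * exp (- 2 * \<eta> * s) * (B * M * exp (2 * \<eta> * s) / (2 * \<eta>))"
        unfolding norm_mult using pb[OF that] S[OF that] B by (intro mult_mono) auto
      also have "\<dots> = B\<^sup>2 * M / (2 * \<eta>) * (exp (- 2 * \<eta> * s) * exp (2 * \<eta> * s))"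
        by (simp add: power2_eq_square)
      also have "exp (- 2 * \<eta> * s) * exp (2 * \<eta> * s) = 1" by (simp flip: exp_add)
      finally show ?thesis by simp
    qed
    from norm_integral_initial_le[OF ai(1) this x] show ?thesis
      using ac_on_eq[OF ac(1) x] vcosh_0[OF p q B' b] by (simp add: algebra_simps)
  qed
  \<comment> \<open>The ratio \<open>B\<^sup>2 * b / \<eta>\<close> is at most 1, so the maximum is
    bounded by 1 plus half of itself and can be absorbed.\<close>
  have "M \<le> 1 + B\<^sup>2 * b * M / (2 * \<eta>)"
    using C[OF x0(1)] norm_triangle_ineq2[of "vcosh p q x0" 1] by (simp add: M_def)
  also have "B\<^sup>2 * b * M / (2 * \<eta>) = B\<^sup>2 * b / \<eta> * (M / 2)" by simp
  also have "\<dots> \<le> M / 2"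
    using mult_right_mono[OF ratio, of "M / 2"] M by simp
  finally have "M \<le> 2" by simp
  have "cmod (vcosh p q b - 1) \<le> B\<^sup>2 * b / \<eta> * (M / 2)"
    using C[of b] b by simp
  also have "\<dots> \<le> B\<^sup>2 * b / \<eta> * 1"
    using \<open>M \<le> 2\<close> \<eta> b by (intro mult_left_mono) auto
  finally show "cmod (vcosh p q b - 1) \<le> B\<^sup>2 * b / \<eta>" by simp

  \<comment> \<open>\<open>vcosh q p\<close> may grow like \<open>exp (2 * \<eta> * x)\<close>.
    Maximizing it with the reciprocal weight makes the same absorption possible.\<close>
  have "\<exists>x1\<in>{0..b}. \<forall>x\<in>{0..b}. exp (- 2 * \<eta> * x) * cmod (vcosh q p x)
      \<le> exp (- 2 * \<eta> * x1) * cmod (vcosh q p x1)"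
    using b ac_on_continuous[OF ac(3)] by (intro continuous_attains_sup continuous_intros) auto
  then obtain x1 where x1: "x1 \<in> {0..b}" "\<And>x. x \<in> {0..b} \<Longrightarrow>
      exp (- 2 * \<eta> * x) * cmod (vcosh q p x) \<le> exp (- 2 * \<eta> * x1) * cmod (vcosh q p x1)"
    by blast
  define N where "N = exp (- 2 * \<eta> * x1) * cmod (vcosh q p x1)"
  have N: "0 \<le> N" "\<And>x. x \<in> {0..b} \<Longrightarrow> exp (- 2 * \<eta> * x) * cmod (vcosh q p x) \<le> N"
    using x1 by (auto simp: N_def)
  have S': "cmod (vsinh p q x) \<le> B * N * b" if x: "x \<in> {0..b}" for x
  proof -
    have "cmod (p s * vcosh q p s) \<le> B * N" if "s \<in> {0..b}" for s
    proof -
      have "cmod (p s * vcosh q p s) \<le> B * (exp (- 2 * \<eta> * s) * cmod (vcosh q p s))"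
        using mult_right_mono[OF pb[OF that], of "cmod (vcosh q p s)"] by (simp add: norm_mult)
      also have "\<dots> \<le> B * N" using N(2)[OF that] B by (rule mult_left_mono)
      finally show ?thesis .
    qed
    from norm_integral_initial_le[OF ai(4) this x] show ?thesis
      using ac_on_eq[OF ac(4) x] vsinh_0[OF p q B' b] by simp
  qed
  have C': "exp (- 2 * \<eta> * x) * cmod (vcosh q p x) \<le> exp (- 2 * \<eta> * x) + B\<^sup>2 * b / \<eta> * (N / 2)"
    if x: "x \<in> {0..b}" for x
  proof -
    have "cmod (q s * vsinh p q s) \<le> B * (B * N * b) * exp (2 * \<eta> * s)" if "s \<in> {0..b}" for s
      using mult_mono[OF qb[OF that] S'[OF that]] B by (simp add: norm_mult algebra_simps)
    then have "cmod (vcosh q p x - 1) \<le> B * (B * N * b) * exp (2 * \<eta> * x) / (2 * \<eta>)"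
      using norm_integral_exp_le[OF ai(3) x \<eta>(1), of "B * (B * N * b)"] B N b ac_on_eq[OF ac(3) x]
        vcosh_0[OF q p B' b] by simp
    then have "cmod (vcosh q p x) \<le> 1 + B * (B * N * b) * exp (2 * \<eta> * x) / (2 * \<eta>)"
      using norm_triangle_ineq2[of "vcosh q p x" 1] by simp
    then have "exp (- 2 * \<eta> * x) * cmod (vcosh q p x)
        \<le> exp (- 2 * \<eta> * x) * (1 + B * (B * N * b) * exp (2 * \<eta> * x) / (2 * \<eta>))"
      by (intro mult_left_mono) auto
    also have "\<dots> = exp (- 2 * \<eta> * x) + B\<^sup>2 * b / \<eta> * (N / 2) * (exp (- 2 * \<eta> * x) * exp (2 * \<eta> *
        x))"
      by (simp add: field_simps power2_eq_square)
    also have "exp (- 2 * \<eta> * x) * exp (2 * \<eta> * x) = 1" by (simp flip: exp_add)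
    finally show ?thesis by simp
  qed
  have "N \<le> exp (- 2 * \<eta> * x1) + B\<^sup>2 * b / \<eta> * (N / 2)"
    using C'[OF x1(1)] by (simp add: N_def)
  also have "exp (- 2 * \<eta> * x1) \<le> 1" using x1 \<eta> by simp
  also have "B\<^sup>2 * b / \<eta> * (N / 2) \<le> N / 2"
    using mult_right_mono[OF ratio, of "N / 2"] N by simp
  finally have "N \<le> 2" by simp
  have "exp (- 2 * \<eta> * b) * cmod (vcosh q p b) \<le> exp (- 2 * \<eta> * b) + B\<^sup>2 * b / \<eta> * (N / 2)"
    using C'[of b] b by simp
  also have "B\<^sup>2 * b / \<eta> * (N / 2) \<le> B\<^sup>2 * b / \<eta> * 1"
    using \<open>N \<le> 2\<close> \<eta> b by (intro mult_left_mono) auto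
  finally show "exp (- 2 * \<eta> * b) * cmod (vcosh q p b) \<le> exp (- 2 * \<eta> * b) + B\<^sup>2 * b / \<eta>" by simp
qed

section \<open>Nonharmonic Bessel inequality\<close>

definition sq_integrable :: "(real \<Rightarrow> complex) \<Rightarrow> bool" where
  "sq_integrable w \<longleftrightarrow> w \<in> borel_measurable (lebesgue_on {0..pi})
      \<and> (\<lambda>x. (cmod (w x))\<^sup>2) integrable_on {0..pi}"

definition sq_norm :: "(real \<Rightarrow> complex) \<Rightarrow> real" where
  "sq_norm w = integral {0..pi} (\<lambda>x. (cmod (w x))\<^sup>2)"

definition pair_norm :: "(real \<Rightarrow> complex) \<Rightarrow> (real \<Rightarrow> complex) \<Rightarrow> real" where
  "pair_norm v w = sqrt (sq_norm v + sq_norm w)"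

lemma sq_norm_nonneg: "0 \<le> sq_norm w"
  unfolding sq_norm_def
  by (cases "(\<lambda>x. (cmod (w x))\<^sup>2) integrable_on {0..pi}")
    (auto intro: Henstock_Kurzweil_Integration.integral_nonneg simp: not_integrable_integral)

lemma pair_norm_nonneg: "0 \<le> pair_norm v w"
  by (simp add: pair_norm_def sq_norm_nonneg)

lemma sq_integrable_dominated:
  assumes "sq_integrable w" "v \<in> borel_measurable (lebesgue_on {0..pi})"
    and "\<And>x. x \<in> {0..pi} \<Longrightarrow> cmod (v x) \<le> K * cmod (w x)"
  shows "sq_integrable v" and "sq_norm v \<le> K\<^sup>2 * sq_norm w"
proof -
  have le: "(cmod (v x))\<^sup>2 \<le> K\<^sup>2 * (cmod (w x))\<^sup>2" if "x \<in> {0..pi}" for x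
    using power_mono[OF assms(3)[OF that], of 2] by (simp add: power_mult_distrib)
  have int: "(\<lambda>x. K\<^sup>2 * (cmod (w x))\<^sup>2) integrable_on {0..pi}"
    using assms(1) by (intro integrable_on_mult_right) (simp add: sq_integrable_def)
  have "(\<lambda>x. (cmod (v x))\<^sup>2) absolutely_integrable_on {0..pi}"
    using le assms(2) int
    by (intro measurable_bounded_by_integrable_imp_absolutely_integrable[OF _ _ int]) auto
  then have v: "(\<lambda>x. (cmod (v x))\<^sup>2) integrable_on {0..pi}"
    by (rule set_lebesgue_integral_eq_integral(1))
  then show "sq_integrable v" using assms(2) by (simp add: sq_integrable_def)
  have "sq_norm v \<le> integral {0..pi} (\<lambda>x. K\<^sup>2 * (cmod (w x))\<^sup>2)"
    unfolding sq_norm_def by (rule integral_le[OF v int le])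
  then show "sq_norm v \<le> K\<^sup>2 * sq_norm w" by (simp add: sq_norm_def)
qed

lemma sq_integrable_mult_continuous:
  assumes "sq_integrable w" "continuous_on {0..pi} g" "\<And>x. x \<in> {0..pi} \<Longrightarrow> cmod (g x) \<le> K"
  shows "sq_integrable (\<lambda>x. g x * w x)" and "sq_norm (\<lambda>x. g x * w x) \<le> K\<^sup>2 * sq_norm w"
proof -
  have "(\<lambda>x. g x * w x) \<in> borel_measurable (lebesgue_on {0..pi})"
    using assms(1) by (intro borel_measurable_times continuous_imp_measurable_on_sets_lebesgue[OF
        assms(2)])
      (auto simp: sq_integrable_def)
  moreover have "cmod (g x * w x) \<le> K * cmod (w x)" if "x \<in> {0..pi}" for x
    using assms(3)[OF that] by (simp add: norm_mult mult_right_mono)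
  ultimately show "sq_integrable (\<lambda>x. g x * w x)" "sq_norm (\<lambda>x. g x * w x) \<le> K\<^sup>2 * sq_norm w"
    using sq_integrable_dominated[OF assms(1)] by blast+
qed

lemma sq_integrable_absolutely_integrable:
  assumes "sq_integrable w"
  shows "w absolutely_integrable_on {0..pi}"
proof (rule measurable_bounded_by_integrable_imp_absolutely_integrable)
  show "w \<in> borel_measurable (lebesgue_on {0..pi})" using assms by (simp add: sq_integrable_def)
  show "(\<lambda>x. 1 + (cmod (w x))\<^sup>2) integrable_on {0..pi}"
    using assms by (intro Henstock_Kurzweil_Integration.integrable_add) (auto simp:
        sq_integrable_def)
  show "norm (w x) \<le> 1 + (cmod (w x))\<^sup>2" for x
    using zero_le_power2[of "cmod (w x) - 1", unfolded power2_diff one_power2] norm_ge_zero[of "w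
        x"] by linarith
qed auto

text \<open>Cauchy-Schwarz against the constant 1: the square of \<open>cmod (w x)\<close> minus its
  mean \<open>I / pi\<close> has a nonnegative integral.\<close>

lemma l1_le_l2:
  assumes "sq_integrable w"
  shows "(integral {0..pi} (\<lambda>x. cmod (w x)))\<^sup>2 \<le> pi * sq_norm w"
proof -
  define I where "I = integral {0..pi} (\<lambda>x. cmod (w x))"
  have w: "(\<lambda>x. cmod (w x)) integrable_on {0..pi}" "(\<lambda>x. (cmod (w x))\<^sup>2) integrable_on {0..pi}"
    using sq_integrable_absolutely_integrable[OF assms] assms
    by (auto simp: absolutely_integrable_on_def sq_integrable_def)
  have "((\<lambda>x. (cmod (w x))\<^sup>2 - 2 * (I / pi) * cmod (w x) + (I / pi)\<^sup>2) has_integral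
      (sq_norm w - 2 * (I / pi) * I + pi * (I / pi)\<^sup>2)) {0..pi}"
    using w[THEN integrable_integral] has_integral_const_real[of "(I / pi)\<^sup>2" 0 pi]
    by (intro has_integral_add has_integral_diff has_integral_mult_right) (auto simp: I_def
        sq_norm_def)
  then have "0 \<le> sq_norm w - 2 * (I / pi) * I + pi * (I / pi)\<^sup>2"
  proof (rule has_integral_nonneg)
    show "0 \<le> (cmod (w x))\<^sup>2 - 2 * (I / pi) * cmod (w x) + (I / pi)\<^sup>2" for x
      using zero_le_power2[of "cmod (w x) - I / pi"] by (simp add: power2_diff algebra_simps)
  qed
  also have "\<dots> = sq_norm w - I\<^sup>2 / pi" by (simp add: power2_eq_square field_simps)
  finally show ?thesis by (simp add: I_def field_simps)
qed

lemma integral_exp_orthogonal: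
  "integral {0..pi} (\<lambda>x. exp (2 * \<i> * of_int k * of_real x)) = (if k = 0 then of_real pi else 0)"
proof (cases "k = 0")
  case False
  let ?c = "2 * \<i> * of_int k :: complex"
  have "((\<lambda>x. exp (?c * of_real x)) has_integral
      (exp (?c * of_real pi) / ?c - exp (?c * of_real 0) / ?c)) {0..pi}"
    using False by (intro fundamental_theorem_of_calculus has_vector_derivative_real_field)
      (auto intro!: derivative_eq_intros)
  moreover have "exp (?c * of_real pi) = 1"
    by (auto simp: exp_eq_1 intro: exI[of _ k])
  ultimately show ?thesis using False by (simp add: integral_unique)
qed (simp add: scaleR_conv_of_real)

text \<open>The squared distance of \<open>w\<close> from the conjugate of \<open>g / pi\<close> is
  nonnegative. The exponentials have squared norm \<open>pi\<close>, so \<open>g * w\<close>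
  integrates to \<open>S\<close> and the squared modulus of \<open>g\<close> to
  \<open>pi * S\<close>; expanding the square leaves \<open>S / pi \<le> sq_norm w\<close>.\<close>

lemma bessel_inequality:
  assumes w: "sq_integrable w" and F: "finite F"
  shows "(\<Sum>k\<in>F. (cmod (integral {0..pi} (\<lambda>x. exp (2 * \<i> * of_int k * of_real x) * w x)))\<^sup>2)
      \<le> pi * sq_norm w"
proof -
  define e where "e k x = exp (2 * \<i> * of_int k * complex_of_real x)" for k x
  define c where "c k = integral {0..pi} (\<lambda>x. e k x * w x)" for k
  define g where "g x = (\<Sum>k\<in>F. cnj (c k) * e k x)" for x
  define S where "S = (\<Sum>k\<in>F. (cmod (c k))\<^sup>2)"
  have e_cont: "continuous_on A (e k)" for k A
    unfolding e_def by (intro continuous_intros)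
  have g_cont: "continuous_on A g" for A
    unfolding g_def by (intro continuous_intros e_cont)
  have cnj_e: "cnj (e k x) = e (- k) x" for k x
    by (simp add: e_def exp_cnj)
  have e_mult: "e j x * e k x = e (j + k) x" for j k x
    by (simp add: e_def algebra_simps flip: exp_add)
  have w_ai: "w absolutely_integrable_on {0..pi}"
    by (rule sq_integrable_absolutely_integrable[OF w])
  have ew: "(\<lambda>x. e k x * w x) integrable_on {0..pi}" for k
    using absolutely_integrable_continuous_mult[OF w_ai e_cont]
        by (rule set_lebesgue_integral_eq_integral(1))
  have gw: "(\<lambda>x. g x * w x) integrable_on {0..pi}"
    using absolutely_integrable_continuous_mult[OF w_ai g_cont]
        by (rule set_lebesgue_integral_eq_integral(1))
  have "integral {0..pi} (\<lambda>x. g x * w x) = (\<Sum>k\<in>F. integral {0..pi} (\<lambda>x. cnj (c k) * (e k x * w x)))"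
    unfolding g_def sum_distrib_right using F ew
    by (subst Henstock_Kurzweil_Integration.integral_sum[symmetric])
      (auto simp: mult.assoc intro!: integrable_on_mult_right)
  also have "\<dots> = (\<Sum>k\<in>F. cnj (c k) * c k)"
    by (simp add: c_def)
  also have "\<dots> = of_real S"
    by (simp add: S_def mult.commute complex_mult_cnj cmod_power2 flip: complex_norm_square)
  finally have int_gw: "integral {0..pi} (\<lambda>x. g x * w x) = of_real S" .
  have "integral {0..pi} (\<lambda>x. e k x * cnj (g x)) = of_real pi * c k" if "k \<in> F" for k
  proof -
    have "integral {0..pi} (\<lambda>x. e k x * cnj (g x)) = (\<Sum>j\<in>F. integral {0..pi} (\<lambda>x. c j * e (k - j)
        x))"
      unfolding g_def using F
      by (subst Henstock_Kurzweil_Integration.integral_sum[symmetric])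
        (auto simp: sum_distrib_left cnj_e mult.left_commute[of "e _ _" "c _"] e_mult
          intro!: integrable_continuous_interval continuous_intros e_cont)
    also have "\<dots> = (\<Sum>j\<in>F. if j = k then c k * of_real pi else 0)"
      by (intro sum.cong refl) (simp add: e_def integral_exp_orthogonal del: of_int_diff)
    also have "\<dots> = of_real pi * c k" using F that by simp
    finally show ?thesis .
  qed
  note ek = this
  have "integral {0..pi} (\<lambda>x. g x * cnj (g x)) = (\<Sum>k\<in>F. integral {0..pi} (\<lambda>x. cnj (c k) * (e k x *
      cnj (g x))))"
    unfolding g_def[of "_::real"] using F
    by (subst Henstock_Kurzweil_Integration.integral_sum[symmetric])
      (auto simp: sum_distrib_right mult.assoc
        intro!: integrable_continuous_interval continuous_intros e_cont)
  also have "\<dots> = (\<Sum>k\<in>F. cnj (c k) * (of_real pi * c k))"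
    by (intro sum.cong refl) (simp add: ek)
  also have "\<dots> = of_real (pi * S)"
    by (simp add: S_def sum_distrib_left complex_norm_square algebra_simps del: of_real_power)
  finally have "integral {0..pi} (\<lambda>x. g x * cnj (g x)) = of_real (pi * S)" .
  moreover have "g x * cnj (g x) = of_real ((cmod (g x))\<^sup>2)" for x
    by (rule complex_norm_square[symmetric])
  ultimately have "integral {0..pi} (\<lambda>x. complex_of_real ((cmod (g x))\<^sup>2)) = of_real (pi * S)"
    by simp
  moreover have g2: "(\<lambda>x. (cmod (g x))\<^sup>2) integrable_on {0..pi}"
    by (intro integrable_continuous_interval continuous_intros g_cont)
  ultimately have "complex_of_real (integral {0..pi} (\<lambda>x. (cmod (g x))\<^sup>2)) = of_real (pi * S)"
    using integral_linear[OF _ bounded_linear_of_real[where 'a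
        = complex], of "\<lambda>x. (cmod (g x))\<^sup>2" "{0..pi}"]
    by (simp add: comp_def)
  then have int_g2: "integral {0..pi} (\<lambda>x. (cmod (g x))\<^sup>2) = pi * S"
    by (simp only: of_real_eq_iff)
  have Re_gw: "(\<lambda>x. Re (g x * w x)) integrable_on {0..pi}"
    "integral {0..pi} (\<lambda>x. Re (g x * w x)) = S"
    using integrable_linear[OF gw bounded_linear_Re] integral_linear[OF gw bounded_linear_Re] int_gw
    by (auto simp: comp_def)
  have w2: "(\<lambda>x. (cmod (w x))\<^sup>2) integrable_on {0..pi}" using w by (simp add: sq_integrable_def)
  have "0 \<le> integral {0..pi} (\<lambda>x. (cmod (w x))\<^sup>2 - 2 / pi * Re (g x * w x) + (cmod (g x))\<^sup>2 / pi\<^sup>2)"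
  proof (rule Henstock_Kurzweil_Integration.integral_nonneg)
    show "(\<lambda>x. (cmod (w x))\<^sup>2 - 2 / pi * Re (g x * w x) + (cmod (g x))\<^sup>2 / pi\<^sup>2) integrable_on
        {0..pi}"
      using w2 Re_gw g2 by (intro Henstock_Kurzweil_Integration.integrable_add
          Henstock_Kurzweil_Integration.integrable_diff integrable_on_mult_right
              integrable_on_divide)
    fix x
    have "(cmod (w x))\<^sup>2 - 2 / pi * Re (g x * w x) + (cmod (g x))\<^sup>2 / pi\<^sup>2
        = (cmod (w x - cnj (g x) / of_real pi))\<^sup>2"
      unfolding cmod_power2 by (simp add: Re_divide_of_real Im_divide_of_real power2_eq_square
          field_simps)
    then show "0 \<le> (cmod (w x))\<^sup>2 - 2 / pi * Re (g x * w x) + (cmod (g x))\<^sup>2 / pi\<^sup>2" by simp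
  qed
  also have "\<dots> = integral {0..pi} (\<lambda>x. (cmod (w x))\<^sup>2 - 2 / pi * Re (g x * w x))
      + integral {0..pi} (\<lambda>x. (cmod (g x))\<^sup>2 / pi\<^sup>2)"
    using w2 Re_gw g2 by (intro Henstock_Kurzweil_Integration.integral_add
        Henstock_Kurzweil_Integration.integrable_diff integrable_on_mult_right integrable_on_divide)
  also have "integral {0..pi} (\<lambda>x. (cmod (w x))\<^sup>2 - 2 / pi * Re (g x * w x))
      = sq_norm w - integral {0..pi} (\<lambda>x. 2 / pi * Re (g x * w x))"
    unfolding sq_norm_def using w2 Re_gw
    by (intro Henstock_Kurzweil_Integration.integral_diff integrable_on_mult_right)
  also have "integral {0..pi} (\<lambda>x. 2 / pi * Re (g x * w x)) = 2 / pi * S"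
    using Re_gw(2) by (subst integral_mult_right) simp
  also have "integral {0..pi} (\<lambda>x. (cmod (g x))\<^sup>2 / pi\<^sup>2) = S / pi"
    using int_g2 by (simp add: power2_eq_square field_simps)
  finally have "S / pi \<le> sq_norm w" by (simp add: field_simps)
  then show ?thesis
    by (simp add: S_def c_def e_def field_simps)
qed

lemma weighted_cauchy_schwarz:
  fixes a b :: "'i \<Rightarrow> real"
  assumes "\<And>j. j \<in> J \<Longrightarrow> 0 \<le> a j"
  shows "(\<Sum>j\<in>J. a j * b j)\<^sup>2 \<le> (\<Sum>j\<in>J. a j) * (\<Sum>j\<in>J. a j * (b j)\<^sup>2)"
proof -
  have "(\<Sum>j\<in>J. sqrt (a j) * (sqrt (a j) * b j))\<^sup>2 \<le> (\<Sum>j\<in>J. (sqrt (a j))\<^sup>2) * (\<Sum>j\<in>J. (sqrt (a j) * b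
      j)\<^sup>2)"
    by (rule Cauchy_Schwarz_ineq_sum)
  then show ?thesis
    using assms by (simp add: power_mult_distrib flip: mult.assoc cong: sum.cong)
qed

text \<open>By Taylor expansion of \<open>exp (\<i> (\<nu> - 2k) x)\<close>
  as in Duffin and Schaeffer's treatment of nonharmonic Fourier series.\<close>
lemma nonharmonic_bessel:
  assumes w: "sq_integrable w" and \<Lambda>: "finite \<Lambda>"
    and near: "\<And>\<nu>. \<nu> \<in> \<Lambda> \<Longrightarrow> cmod (\<nu> - 2 * of_int (k \<nu>)) \<le> B"
    and mult: "\<And>j. card {\<nu>\<in>\<Lambda>. k \<nu> = j} \<le> N"
  shows "(\<Sum>\<nu>\<in>\<Lambda>. (cmod (integral {0..pi} (\<lambda>x. exp (\<i> * \<nu> * of_real x) * w x)))\<^sup>2)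
    \<le> real N * pi * (exp (B * pi))\<^sup>2 * sq_norm w"
proof (cases "\<Lambda> = {}")
  case True
  then show ?thesis using sq_norm_nonneg[of w] by simp
next
  case False
  then have B: "0 \<le> B" using near norm_ge_zero order_trans by blast
  define e where "e k x = exp (2 * \<i> * of_int k * complex_of_real x)" for k x
  \<comment> \<open>Dividing the Taylor monomials by powers of \<open>pi\<close> makes the weights
    at most 1, so \<open>v j\<close> is no larger than \<open>w\<close>. The compensating factors
    \<open>a j\<close> sum to at most \<open>exp (B * pi)\<close>.\<close>
  define v where "v j x = (complex_of_real (x / pi)) ^ j * w x" for j x
  define c where "c j m = integral {0..pi} (\<lambda>x. e m x * v j x)" for j m
  define a where "a j = (B * pi) ^ j / fact j" for j
  define T where "T n \<nu> = (\<Sum>j<n. (\<i> * (\<nu> - 2 * of_int (k \<nu>)) * of_real pi) ^ j / fact j * c j (k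
      \<nu>))" for n \<nu>
  have v: "sq_integrable (v j)" "sq_norm (v j) \<le> 1\<^sup>2 * sq_norm w" for j
    unfolding v_def by (intro sq_integrable_mult_continuous[OF w, where K = 1] continuous_intros;
        simp add: norm_power norm_divide power_le_one)+
  have w_ai: "w absolutely_integrable_on {0..pi}"
    by (rule sq_integrable_absolutely_integrable[OF w])
  have ev: "(\<lambda>x. e m x * v j x) integrable_on {0..pi}" for m j
    unfolding e_def
    by (intro set_lebesgue_integral_eq_integral(1) absolutely_integrable_continuous_mult
        sq_integrable_absolutely_integrable[OF v(1)] continuous_intros)
  have lim: "(\<lambda>n. T n \<nu>) \<longlonglongrightarrow> integral {0..pi} (\<lambda>x. exp (\<i> * \<nu> * of_real x) * w x)" if \<nu>: "\<nu> \<in> \<Lambda>" for \<nu>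
  proof -
    define \<mu> where "\<mu> = \<nu> - 2 * of_int (k \<nu>)"
    have \<mu>: "cmod \<mu> \<le> B" using near[OF \<nu>] by (simp add: \<mu>_def)
    define f where "f n x = (\<Sum>j<n. (\<i> * \<mu> * of_real x) ^ j / fact j) * (e (k \<nu>) x * w x)" for n x
    have term_eq: "(\<i> * \<mu> * of_real pi) ^ j / fact j * (e (k \<nu>) x * v j x) =
        (\<i> * \<mu> * of_real x) ^ j / fact j * (e (k \<nu>) x * w x)" for j x
      by (simp add: v_def power_mult_distrib power_divide)
    have f_eq: "f n = (\<lambda>x. \<Sum>j<n. (\<i> * \<mu> * of_real pi) ^ j / fact j * (e (k \<nu>) x * v j x))" for n
      unfolding f_def sum_distrib_right term_eq ..
    have "(\<lambda>n. integral {0..pi} (f n)) \<longlonglongrightarrow> integral {0..pi} (\<lambda>x. exp (\<i> * \<mu> * of_real x) * (e (k \<nu>) x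
        * w x))"
    proof (rule dominated_convergence(2))
      show "f n integrable_on {0..pi}" for n
        unfolding f_eq using ev by (intro integrable_sum integrable_on_mult_right) auto
      show "(\<lambda>x. exp (B * pi) * cmod (w x)) integrable_on {0..pi}"
        using w_ai by (intro integrable_on_mult_right) (simp add: absolutely_integrable_on_def)
      fix x assume x: "x \<in> {0..pi}"
      have "cmod (\<Sum>j<n. (\<i> * \<mu> * of_real x) ^ j / fact j) \<le> exp (B * pi)" for n
      proof -
        have "cmod (\<Sum>j<n. (\<i> * \<mu> * of_real x) ^ j / fact j) \<le> (\<Sum>j<n. (B * pi) ^ j / fact j)"
          using x \<mu> B
          by (intro sum_norm_le) (auto simp: norm_divide norm_power norm_mult intro!:
              divide_right_mono power_mono mult_mono)
        also have "\<dots> \<le> (\<Sum>j. (B * pi) ^ j / fact j)"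
          using B by (intro sum_le_suminf summable_exp_bound) auto
        finally show ?thesis by (simp add: suminf_exp_bound)
      qed
      moreover have "cmod (e (k \<nu>) x) = 1" by (simp add: e_def)
      ultimately show "norm (f n x) \<le> exp (B * pi) * cmod (w x)" for n
        by (simp add: f_def norm_mult mult_right_mono)
      have "(\<lambda>n. \<Sum>j<n. (\<i> * \<mu> * of_real x) ^ j / fact j) \<longlonglongrightarrow> exp (\<i> * \<mu> * of_real x)"
        using exp_converges[of "\<i> * \<mu> * of_real x"]
        by (simp add: sums_def scaleR_conv_of_real divide_inverse mult.commute)
      then show "(\<lambda>n. f n x) \<longlonglongrightarrow> exp (\<i> * \<mu> * of_real x) * (e (k \<nu>) x * w x)"
        unfolding f_def by (intro tendsto_mult_right)
    qed
    moreover have "integral {0..pi} (f n) = T n \<nu>" for n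
      unfolding f_eq T_def c_def \<mu>_def[symmetric] using ev
      by (subst Henstock_Kurzweil_Integration.integral_sum) (auto intro!: integrable_on_mult_right)
    moreover have "exp (\<i> * \<mu> * of_real x) * (e (k \<nu>) x * w x) = exp (\<i> * \<nu> * of_real x) * w x"
        for x
      by (simp add: e_def \<mu>_def algebra_simps flip: exp_add)
    ultimately show ?thesis by simp
  qed
  have a: "0 \<le> a j" "(\<Sum>j<n. a j) \<le> exp (B * pi)" for j n
  proof -
    show *: "0 \<le> a j" for j using B by (simp add: a_def)
    have "(\<Sum>j<n. a j) \<le> (\<Sum>j. a j)"
      using * by (intro sum_le_suminf) (auto simp: a_def summable_exp_bound)
    then show "(\<Sum>j<n. a j) \<le> exp (B * pi)" by (simp add: a_def suminf_exp_bound)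
  qed
  have bessel: "(\<Sum>\<nu>\<in>\<Lambda>. (cmod (c j (k \<nu>)))\<^sup>2) \<le> real N * (pi * sq_norm w)" for j
  proof -
    \<comment> \<open>At most \<open>N\<close> points share an integer, so grouping by the fibres of
      \<open>k\<close> reduces the sum to Bessel's inequality over distinct integers.\<close>
    have "(\<Sum>\<nu>\<in>\<Lambda>. (cmod (c j (k \<nu>)))\<^sup>2) = (\<Sum>m\<in>k ` \<Lambda>. \<Sum>\<nu>\<in>{\<nu>\<in>\<Lambda>. k \<nu> = m}. (cmod (c j (k \<nu>)))\<^sup>2)"
      using \<Lambda> by (rule sum.image_gen)
    also have "\<dots> = (\<Sum>m\<in>k ` \<Lambda>. real (card {\<nu>\<in>\<Lambda>. k \<nu> = m}) * (cmod (c j m))\<^sup>2)"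
      by (intro sum.cong) auto
    also have "\<dots> \<le> (\<Sum>m\<in>k ` \<Lambda>. real N * (cmod (c j m))\<^sup>2)"
      using mult by (intro sum_mono mult_right_mono) auto
    also have "\<dots> = real N * (\<Sum>m\<in>k ` \<Lambda>. (cmod (c j m))\<^sup>2)"
      by (simp add: sum_distrib_left)
    also have "\<dots> \<le> real N * (pi * sq_norm (v j))"
      using bessel_inequality[OF v(1), of "k ` \<Lambda>" j] \<Lambda> by (intro mult_left_mono) (auto simp: c_def
          e_def)
    also have "\<dots> \<le> real N * (pi * sq_norm w)"
      using v(2)[of j] by (intro mult_left_mono) auto
    finally show ?thesis .
  qed
  have "(\<Sum>\<nu>\<in>\<Lambda>. (cmod (T n \<nu>))\<^sup>2) \<le> real N * pi * (exp (B * pi))\<^sup>2 * sq_norm w" for n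
  proof -
    have "(\<Sum>\<nu>\<in>\<Lambda>. (cmod (T n \<nu>))\<^sup>2) \<le> (\<Sum>\<nu>\<in>\<Lambda>. exp (B * pi) * (\<Sum>j<n. a j * (cmod (c j (k \<nu>)))\<^sup>2))"
    proof (rule sum_mono)
      fix \<nu> assume \<nu>: "\<nu> \<in> \<Lambda>"
      have "cmod (T n \<nu>) \<le> (\<Sum>j<n. a j * cmod (c j (k \<nu>)))"
        unfolding T_def a_def using near[OF \<nu>] B
        by (intro sum_norm_le) (auto simp: norm_mult norm_divide norm_power
            intro!: mult_right_mono divide_right_mono power_mono)
      then have "(cmod (T n \<nu>))\<^sup>2 \<le> (\<Sum>j<n. a j * cmod (c j (k \<nu>)))\<^sup>2"
        by (intro power_mono) auto
      \<comment> \<open>Distributing the weights \<open>a j\<close> over both factors keeps the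
        bound independent of \<open>n\<close>; after exchanging the sums, every \<open>j\<close>
        meets the same Bessel bound.\<close>
      also have "\<dots> \<le> (\<Sum>j<n. a j) * (\<Sum>j<n. a j * (cmod (c j (k \<nu>)))\<^sup>2)"
        using a by (intro weighted_cauchy_schwarz)
      also have "\<dots> \<le> exp (B * pi) * (\<Sum>j<n. a j * (cmod (c j (k \<nu>)))\<^sup>2)"
        using a by (intro mult_right_mono sum_nonneg) auto
      finally show "(cmod (T n \<nu>))\<^sup>2 \<le> exp (B * pi) * (\<Sum>j<n. a j * (cmod (c j (k \<nu>)))\<^sup>2)" .
    qed
    also have "\<dots> = exp (B * pi) * (\<Sum>j<n. a j * (\<Sum>\<nu>\<in>\<Lambda>. (cmod (c j (k \<nu>)))\<^sup>2))"
      by (subst sum_distrib_left[symmetric], subst sum.swap) (simp add: sum_distrib_left)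
    also have "\<dots> \<le> exp (B * pi) * (\<Sum>j<n. a j * (real N * (pi * sq_norm w)))"
      using a bessel by (intro mult_left_mono sum_mono) auto
    also have "\<dots> = exp (B * pi) * (\<Sum>j<n. a j) * (real N * (pi * sq_norm w))"
      by (simp add: sum_distrib_right)
    also have "\<dots> \<le> exp (B * pi) * exp (B * pi) * (real N * (pi * sq_norm w))"
      using a sq_norm_nonneg[of w] by (intro mult_right_mono mult_left_mono) auto
    finally show ?thesis by (simp add: power2_eq_square algebra_simps)
  qed
  moreover have "(\<lambda>n. \<Sum>\<nu>\<in>\<Lambda>. (cmod (T n \<nu>))\<^sup>2) \<longlonglongrightarrow>
      (\<Sum>\<nu>\<in>\<Lambda>. (cmod (integral {0..pi} (\<lambda>x. exp (\<i> * \<nu> * of_real x) * w x)))\<^sup>2)"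
    by (intro tendsto_sum tendsto_power tendsto_norm lim)
  ultimately show ?thesis
    by (intro tendsto_upperbound[OF _ always_eventually]) auto
qed

section \<open>Exponentials of primitives, and sampling over sets close to the even integers\<close>

lemma ac_on_power:
  assumes "ac_on b u u'"
  shows "ac_on b (\<lambda>x. u x ^ Suc n) (\<lambda>x. of_nat (Suc n) * (u' x * u x ^ n))"
proof (induction n)
  case 0
  show ?case using assms by simp
next
  case (Suc n)
  show ?case
    by (rule ac_on_cong[OF ac_on_mult[OF assms Suc]]) (auto simp: algebra_simps)
qed

text \<open>The chain rule for the exponential is read off from the Picard series with both
  coefficients equal to \<open>f\<close>, whose terms are powers of the primitive over
  factorials.\<close>

lemma ac_on_exp:
  assumes f: "bounded_integrable b B f" and B: "0 \<le> B"
  shows "ac_on b (\<lambda>x. exp (integral {0..x} f)) (\<lambda>x. f x * exp (integral {0..x} f))"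
proof -
  define u where "u x = integral {0..x} f" for x
  have u: "ac_on b u f"
    using ac_on_integral[OF bounded_integrableD(1)[OF f], of 0] by (simp add: u_def[abs_def])
  have "volterra n f f x = u x ^ n / fact n" if "x \<in> {0..b}" for n x
    using that
  proof (induction n arbitrary: x)
    case (Suc n)
    have "volterra (Suc n) f f x = integral {0..x} (\<lambda>s. f s * u s ^ n / fact n)"
      unfolding volterra.simps using Suc by (intro integral_cong) auto
    moreover have "u x ^ Suc n = u 0 ^ Suc n + integral {0..x} (\<lambda>s. of_nat (Suc n) * (f s * u s ^
        n))"
      using ac_on_eq[OF ac_on_power[OF u] Suc.prems] .
    then have "u x ^ Suc n = of_nat (Suc n) * integral {0..x} (\<lambda>s. f s * u s ^ n)"
      by (simp add: u_def del: of_nat_Suc)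
    ultimately show ?case
      by (simp add: fact_Suc del: of_nat_Suc power_Suc)
  qed simp
  then have sum_eq: "volterra_sum f f x = exp (u x)" if "x \<in> {0..b}" for x
    using that by (simp add: volterra_sum_def exp_def scaleR_conv_of_real divide_inverse
        mult.commute)
  show ?thesis
    unfolding u_def[symmetric]
    by (rule ac_on_cong[OF volterra_sum_ac(1)[OF f f B]]) (auto simp: sum_eq)
qed

text \<open>Describes finite sets of large eigenvalues. Even integers appear because the
  exponentials with frequencies 2k are orthogonal on \<open>{0..pi}\<close>. All later constants
  depend on \<open>B\<close> and \<open>N\<close> alone, hence neither on the set nor on
  \<omega>.\<close>

definition lattice_like :: "real \<Rightarrow> nat \<Rightarrow> complex set \<Rightarrow> bool" where
  "lattice_like B N \<Lambda> \<longleftrightarrow> finite \<Lambda> \<and> (\<forall>l\<in>\<Lambda>. 1 \<le> cmod l) \<and>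
     (\<exists>k::complex \<Rightarrow> int. (\<forall>l\<in>\<Lambda>. cmod (l - 2 * of_int (k l)) \<le> B) \<and> (\<forall>j. card {l\<in>\<Lambda>. k l = j} \<le> N))"

lemma lattice_like_uminus:
  assumes "lattice_like B N \<Lambda>"
  shows "lattice_like B N (uminus ` \<Lambda>)"
proof -
  obtain k :: "complex \<Rightarrow> int" where k: "\<And>l. l \<in> \<Lambda> \<Longrightarrow> cmod (l - 2 * of_int (k l)) \<le> B"
    "\<And>j. card {l\<in>\<Lambda>. k l = j} \<le> N"
    using assms unfolding lattice_like_def by blast
  have "cmod (l - 2 * of_int (- k (- l))) \<le> B" if "l \<in> uminus ` \<Lambda>" for l
  proof -
    from that have "- l \<in> \<Lambda>" by auto
    then have "cmod (- (- l - 2 * of_int (k (- l)))) \<le> B" using k(1) by (metis norm_minus_cancel)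
    then show ?thesis by (simp add: algebra_simps)
  qed
  moreover have "card {l \<in> uminus ` \<Lambda>. - k (- l) = j} \<le> N" for j
  proof -
    have "{l \<in> uminus ` \<Lambda>. - k (- l) = j} = uminus ` {l\<in>\<Lambda>. k l = - j}"
      by (auto simp: image_iff)
    then show ?thesis using k(2)[of "- j"] by (simp add: card_image)
  qed
  ultimately show ?thesis
    using assms unfolding lattice_like_def
    by (intro conjI exI[of _ "\<lambda>l. - k (- l)"] ballI allI) auto
qed

lemma lattice_like_Im:
  assumes "lattice_like B N \<Lambda>" "l \<in> \<Lambda>"
  shows "\<bar>Im l\<bar> \<le> B"
proof -
  obtain k :: "complex \<Rightarrow> int" where "cmod (l - 2 * of_int (k l)) \<le> B"
    using assms unfolding lattice_like_def by blast
  then show ?thesis using abs_Im_le_cmod[of "l - 2 * of_int (k l)"] by simp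
qed

text \<open>Each nonzero integer \<open>k l\<close> has modulus at most
  \<open>(1 + B) * cmod l\<close>, and each integer is hit at most \<open>N\<close> times, so the
  sum compares with that of the inverse squares of the integers.\<close>

lemma lattice_like_inverse_squares:
  obtains D where "0 \<le> D" "\<And>\<Lambda>. lattice_like B N \<Lambda> \<Longrightarrow> (\<Sum>l\<in>\<Lambda>. 1 / (cmod l)\<^sup>2) \<le> D"
proof -
  \<comment> \<open>Since \<open>inverse 0 = 0\<close>, the value at 0 has to be raised to 1; it
    pays for the points with \<open>k l = 0\<close>.\<close>
  define g where "g n = inverse (real n ^ 2) + (if n = 0 then 1 else 0)" for n
  have g: "summable g" "\<And>n. 0 \<le> g n"
    unfolding g_def by (auto intro!: summable_add inverse_power_summable summable_single[of 0 "\<lambda>_.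
        1"])
  define G where "G = suminf g"
  have G: "0 \<le> G" unfolding G_def using g by (intro suminf_nonneg)
  have ints: "(\<Sum>j\<in>J. g (nat \<bar>j\<bar>)) \<le> 2 * G" if "finite J" for J
  proof -
    have half: "(\<Sum>j\<in>A. g (nat \<bar>j\<bar>)) \<le> G" if "finite A" "inj_on (\<lambda>j. nat \<bar>j\<bar>) A" for A
    proof -
      have "(\<Sum>j\<in>A. g (nat \<bar>j\<bar>)) = sum g ((\<lambda>j. nat \<bar>j\<bar>) ` A)"
        using that by (simp add: sum.reindex comp_def)
      also have "\<dots> \<le> G"
        unfolding G_def using g that by (intro sum_le_suminf) auto
      finally show ?thesis .
    qed
    have "J = {j\<in>J. 0 \<le> j} \<union> {j\<in>J. j < 0}" by auto
    then have "(\<Sum>j\<in>J. g (nat \<bar>j\<bar>)) = (\<Sum>j\<in>{j\<in>J. 0 \<le> j}. g (nat \<bar>j\<bar>)) + (\<Sum>j\<in>{j\<in>J. j < 0}. g (nat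
        \<bar>j\<bar>))"
      using that by (subst sum.union_disjoint[symmetric]) auto
    also have "\<dots> \<le> G + G"
      using that by (intro add_mono half) (auto simp: inj_on_def)
    finally show ?thesis by simp
  qed
  have "(\<Sum>l\<in>\<Lambda>. 1 / (cmod l)\<^sup>2) \<le> (1 + B)\<^sup>2 * (real N * (2 * G))" if "lattice_like B N \<Lambda>" for \<Lambda>
  proof -
    obtain k :: "complex \<Rightarrow> int" where k: "\<And>l. l \<in> \<Lambda> \<Longrightarrow> cmod (l - 2 * of_int (k l)) \<le> B"
      "\<And>j. card {l\<in>\<Lambda>. k l = j} \<le> N" and \<Lambda>: "finite \<Lambda>" "\<And>l. l \<in> \<Lambda> \<Longrightarrow> 1 \<le> cmod l"
      using \<open>lattice_like B N \<Lambda>\<close> unfolding lattice_like_def by blast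
    have inverse_le: "1 / b \<le> c * inverse a" if "a \<le> c * b" "0 < a" "0 < b" for a b c :: real
      using that by (simp add: field_simps)
    have pointwise: "1 / (cmod l)\<^sup>2 \<le> (1 + B)\<^sup>2 * g (nat \<bar>k l\<bar>)" if l: "l \<in> \<Lambda>" for l
    proof -
      have B: "0 \<le> B" using k(1)[OF l] norm_ge_zero order_trans by blast
      show ?thesis
      proof (cases "k l = 0")
        case True
        have "1 / (cmod l)\<^sup>2 \<le> 1" using one_le_power[OF \<Lambda>(2)[OF l], of 2]
            by (auto simp: divide_le_eq)
        also have "1 \<le> (1 + B)\<^sup>2" using B by (simp add: one_le_power)
        finally show ?thesis by (simp add: True g_def)
      next
        case False
        have "2 * real_of_int \<bar>k l\<bar> = cmod (2 * of_int (k l))" by simp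
        also have "\<dots> \<le> cmod l + B"
          using k(1)[OF l] norm_triangle_ineq2[of "2 * of_int (k l)" l]
              by (simp add: norm_minus_commute)
        also have "B \<le> B * cmod l" using mult_left_mono[OF \<Lambda>(2)[OF l] B] by simp
        finally have "real_of_int \<bar>k l\<bar> \<le> (1 + B) * cmod l" by (simp add: algebra_simps)
        then have "(real_of_int \<bar>k l\<bar>)\<^sup>2 \<le> ((1 + B) * cmod l)\<^sup>2" by (intro power_mono) auto
        then have "(real_of_int \<bar>k l\<bar>)\<^sup>2 \<le> (1 + B)\<^sup>2 * (cmod l)\<^sup>2"
            by (simp only: power_mult_distrib)
        moreover have "0 < (real_of_int \<bar>k l\<bar>)\<^sup>2" "0 < (cmod l)\<^sup>2" using False \<Lambda>(2)[OF l] by auto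
        ultimately have "1 / (cmod l)\<^sup>2 \<le> (1 + B)\<^sup>2 * inverse ((real_of_int \<bar>k l\<bar>)\<^sup>2)"
          by (rule inverse_le)
        also have "real_of_int \<bar>k l\<bar> = real (nat \<bar>k l\<bar>)" by simp
        finally show ?thesis using False by (simp add: g_def)
      qed
    qed
    have "(\<Sum>l\<in>\<Lambda>. g (nat \<bar>k l\<bar>)) = (\<Sum>j\<in>k ` \<Lambda>. \<Sum>l\<in>{l\<in>\<Lambda>. k l = j}. g (nat \<bar>k l\<bar>))"
      using \<Lambda>(1) by (rule sum.image_gen)
    also have "\<dots> = (\<Sum>j\<in>k ` \<Lambda>. real (card {l\<in>\<Lambda>. k l = j}) * g (nat \<bar>j\<bar>))"
      by (intro sum.cong) auto
    also have "\<dots> \<le> (\<Sum>j\<in>k ` \<Lambda>. real N * g (nat \<bar>j\<bar>))"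
      using k(2) g by (intro sum_mono mult_right_mono) auto
    also have "\<dots> \<le> real N * (2 * G)"
      using ints[of "k ` \<Lambda>"] \<Lambda>(1) by (simp add: mult_left_mono flip: sum_distrib_left)
    finally have "(1 + B)\<^sup>2 * (\<Sum>l\<in>\<Lambda>. g (nat \<bar>k l\<bar>)) \<le> (1 + B)\<^sup>2 * (real N * (2 * G))"
      by (intro mult_left_mono) auto
    then show ?thesis
      using sum_mono[of \<Lambda> "\<lambda>l. 1 / (cmod l)\<^sup>2", OF pointwise] by (simp flip: sum_distrib_left)
  qed
  then show ?thesis using that[of "(1 + B)\<^sup>2 * (real N * (2 * G))"] G by auto
qed

lemma norm_exp_ii_le:
  assumes "x \<in> {0..pi}" "\<bar>Im l\<bar> \<le> h"
  shows "cmod (exp (\<i> * l * of_real x)) \<le> exp (h * pi)"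
proof -
  have "- Im l * x \<le> \<bar>Im l\<bar> * x" using assms by (intro mult_right_mono) auto
  also have "\<dots> \<le> h * pi" using assms by (intro mult_mono) auto
  finally show ?thesis by simp
qed

text \<open>Write \<theta> as \<delta> plus an error. The constant part is covered by
  \<open>nonharmonic_bessel\<close>. The error costs \<open>C0 / cmod l\<close> at each point, by
  passing from the L1 to the L2 norm of \<open>w\<close>, and its squares are summable over
  \<Lambda>.\<close>

lemma sampling_bound_pos:
  obtains C where "0 \<le> C" "\<And>\<Lambda> w \<theta> \<delta>. lattice_like B N \<Lambda> \<Longrightarrow> sq_integrable w \<Longrightarrow>
    (\<And>l. l \<in> \<Lambda> \<Longrightarrow> continuous_on {0..pi} (\<theta> l)) \<Longrightarrow>
    (\<And>l x. l \<in> \<Lambda> \<Longrightarrow> x \<in> {0..pi} \<Longrightarrow> cmod (\<theta> l x - \<delta>) \<le> C0 / cmod l) \<Longrightarrow> cmod \<delta> \<le> 1 \<Longrightarrow>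
    (\<Sum>l\<in>\<Lambda>. (cmod (integral {0..pi} (\<lambda>x. exp (\<i> * l * of_real x) * \<theta> l x * w x)))\<^sup>2) \<le> C * sq_norm w"
proof -
  obtain D where D: "0 \<le> D" "\<And>\<Lambda>. lattice_like B N \<Lambda> \<Longrightarrow> (\<Sum>l\<in>\<Lambda>. 1 / (cmod l)\<^sup>2) \<le> D"
    by (rule lattice_like_inverse_squares[where B = B and N = N]) blast
  define C1 where "C1 = real N * pi * (exp (B * pi))\<^sup>2"
  define C2 where "C2 = (C0 * exp (B * pi))\<^sup>2 * pi"
  have main: "(\<Sum>l\<in>\<Lambda>. (cmod (integral {0..pi} (\<lambda>x. exp (\<i> * l * of_real x) * \<theta> l x * w x)))\<^sup>2)
      \<le> (2 * C1 + 2 * (C2 * D)) * sq_norm w"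
    if \<Lambda>: "lattice_like B N \<Lambda>" and w: "sq_integrable w"
      and cont: "\<And>l. l \<in> \<Lambda> \<Longrightarrow> continuous_on {0..pi} (\<theta> l)"
      and near: "\<And>l x. l \<in> \<Lambda> \<Longrightarrow> x \<in> {0..pi} \<Longrightarrow> cmod (\<theta> l x - \<delta>) \<le> C0 / cmod l"
      and \<delta>: "cmod \<delta> \<le> 1"
    for \<Lambda> w \<theta> \<delta>
  proof -
    define F where "F l = integral {0..pi} (\<lambda>x. exp (\<i> * l * of_real x) * w x)" for l
    define H where "H l = integral {0..pi} (\<lambda>x. exp (\<i> * l * of_real x) * \<theta> l x * w x)" for l
    have w_ai: "w absolutely_integrable_on {0..pi}"
      by (rule sq_integrable_absolutely_integrable[OF w])
    have wn: "(\<lambda>x. cmod (w x)) integrable_on {0..pi}"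
      using w_ai by (simp add: absolutely_integrable_on_def)
    have pointwise: "(cmod (H l))\<^sup>2 \<le> 2 * (cmod (F l))\<^sup>2 + 2 * (C2 * (1 / (cmod l)\<^sup>2) * sq_norm w)"
      if l: "l \<in> \<Lambda>" for l
    proof -
      define K where "K = C0 / cmod l * exp (B * pi)"
      have eF: "(\<lambda>x. exp (\<i> * l * of_real x) * w x) integrable_on {0..pi}"
        by (intro set_lebesgue_integral_eq_integral(1) absolutely_integrable_continuous_mult w_ai
            continuous_intros)
      have eH: "(\<lambda>x. exp (\<i> * l * of_real x) * \<theta> l x * w x) integrable_on {0..pi}"
        by (intro set_lebesgue_integral_eq_integral(1) absolutely_integrable_continuous_mult w_ai
            continuous_intros cont l)
      have "H l - \<delta> * F l = integral {0..pi} (\<lambda>x. exp (\<i> * l * of_real x) * \<theta> l x * w x - \<delta> * (exp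
          (\<i> * l * of_real x) * w x))"
        unfolding H_def F_def using eF eH
        by (subst Henstock_Kurzweil_Integration.integral_diff) (auto intro:
            integrable_on_mult_right)
      also have "cmod \<dots> \<le> integral {0..pi} (\<lambda>x. K * cmod (w x))"
      proof (rule integral_norm_bound_integral)
        show "(\<lambda>x. exp (\<i> * l * of_real x) * \<theta> l x * w x - \<delta> * (exp (\<i> * l * of_real x) * w x))
            integrable_on {0..pi}"
          using eF eH by (intro Henstock_Kurzweil_Integration.integrable_diff
              integrable_on_mult_right)
        show "(\<lambda>x. K * cmod (w x)) integrable_on {0..pi}" using wn
            by (rule integrable_on_mult_right)
        fix x assume x: "x \<in> {0..pi}"
        have "cmod ((\<theta> l x - \<delta>) * exp (\<i> * l * of_real x)) \<le> K"
          unfolding norm_mult K_def using near[OF l x] norm_exp_ii_le[OF x lattice_like_Im[OF \<Lambda> l]]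
          by (intro mult_mono) (auto intro: order_trans[OF norm_ge_zero])
        then have "cmod ((\<theta> l x - \<delta>) * exp (\<i> * l * of_real x) * w x) \<le> K * cmod (w x)"
          by (simp add: norm_mult mult_right_mono)
        then show "cmod (exp (\<i> * l * of_real x) * \<theta> l x * w x - \<delta> * (exp (\<i> * l * of_real x) * w
            x)) \<le> K * cmod (w x)"
          by (simp add: algebra_simps)
      qed
      finally have diff: "cmod (H l - \<delta> * F l) \<le> K * integral {0..pi} (\<lambda>x. cmod (w x))" by simp
      have "(cmod (H l - \<delta> * F l))\<^sup>2 \<le> (K * integral {0..pi} (\<lambda>x. cmod (w x)))\<^sup>2"
        by (rule power_mono[OF diff]) simp
      also have "\<dots> = K\<^sup>2 * (integral {0..pi} (\<lambda>x. cmod (w x)))\<^sup>2" by (simp add: power_mult_distrib)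
      also have "\<dots> \<le> K\<^sup>2 * (pi * sq_norm w)" by (intro mult_left_mono l1_le_l2[OF w]) auto
      also have "\<dots> = C2 * (1 / (cmod l)\<^sup>2) * sq_norm w"
        by (simp add: K_def C2_def power_mult_distrib power_divide)
      finally have 1: "(cmod (H l - \<delta> * F l))\<^sup>2 \<le> C2 * (1 / (cmod l)\<^sup>2) * sq_norm w" .
      have "cmod (\<delta> * F l) \<le> cmod (F l)"
        using mult_right_mono[OF \<delta>, of "cmod (F l)"] by (simp add: norm_mult)
      then have 2: "(cmod (\<delta> * F l))\<^sup>2 \<le> (cmod (F l))\<^sup>2" by (intro power_mono) auto
      have "(cmod (H l))\<^sup>2 \<le> (cmod (\<delta> * F l) + cmod (H l - \<delta> * F l))\<^sup>2"
        using norm_triangle_ineq[of "\<delta> * F l" "H l - \<delta> * F l"] by (intro power_mono) auto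
      also have "\<dots> \<le> 2 * (cmod (\<delta> * F l))\<^sup>2 + 2 * (cmod (H l - \<delta> * F l))\<^sup>2"
        using sum_squares_bound[of "cmod (\<delta> * F l)" "cmod (H l - \<delta> * F l)"]
            by (simp add: power2_sum)
      finally show ?thesis using 1 2 by linarith
    qed
    obtain k :: "complex \<Rightarrow> int" where k: "\<And>l. l \<in> \<Lambda> \<Longrightarrow> cmod (l - 2 * of_int (k l)) \<le> B"
      "\<And>j. card {l\<in>\<Lambda>. k l = j} \<le> N" and "finite \<Lambda>"
      using \<Lambda> unfolding lattice_like_def by blast
    then have F: "(\<Sum>l\<in>\<Lambda>. (cmod (F l))\<^sup>2) \<le> C1 * sq_norm w"
      unfolding F_def C1_def by (intro nonharmonic_bessel[OF w])
    have "(\<Sum>l\<in>\<Lambda>. (cmod (H l))\<^sup>2) \<le> (\<Sum>l\<in>\<Lambda>. 2 * (cmod (F l))\<^sup>2 + 2 * (C2 * (1 / (cmod l)\<^sup>2) * sq_norm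
        w))"
      by (intro sum_mono pointwise)
    also have "\<dots> = 2 * (\<Sum>l\<in>\<Lambda>. (cmod (F l))\<^sup>2) + 2 * (C2 * (\<Sum>l\<in>\<Lambda>. 1 / (cmod l)\<^sup>2) * sq_norm w)"
      by (simp only: sum.distrib sum_distrib_left sum_distrib_right)
    also have "\<dots> \<le> 2 * (C1 * sq_norm w) + 2 * (C2 * D * sq_norm w)"
      using F D(2)[OF \<Lambda>] sq_norm_nonneg[of w]
      by (intro add_mono mult_left_mono mult_right_mono) (auto simp: C2_def)
    finally show ?thesis by (simp add: H_def algebra_simps)
  qed
  show ?thesis
    by (rule that[OF _ main]) (use D(1) in \<open>auto simp: C1_def C2_def\<close>)
qed

text \<open>Adds the opposite sign of the exponent, needed for the second eigenvector of J.
  Reflecting \<Lambda> at the origin preserves \<open>lattice_like\<close> with the same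
  constants.\<close>

lemma sampling_bound:
  obtains C where "0 \<le> C" "\<And>\<Lambda> w \<theta> \<delta> \<sigma>. lattice_like B N \<Lambda> \<Longrightarrow> sq_integrable w \<Longrightarrow>
    (\<And>l. l \<in> \<Lambda> \<Longrightarrow> continuous_on {0..pi} (\<theta> l)) \<Longrightarrow>
    (\<And>l x. l \<in> \<Lambda> \<Longrightarrow> x \<in> {0..pi} \<Longrightarrow> cmod (\<theta> l x - \<delta>) \<le> C0 / cmod l) \<Longrightarrow> cmod \<delta> \<le> 1 \<Longrightarrow> \<sigma> = 1 \<or> \<sigma> = -1 \<Longrightarrow>
    (\<Sum>l\<in>\<Lambda>. (cmod (integral {0..pi} (\<lambda>x. exp (\<i> * (\<sigma> * l) * of_real x) * \<theta> l x * w x)))\<^sup>2)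
        \<le> C * sq_norm w"
proof -
  obtain C where C: "0 \<le> C" "\<And>\<Lambda> w \<theta> \<delta>. lattice_like B N \<Lambda> \<Longrightarrow> sq_integrable w \<Longrightarrow>
    (\<And>l. l \<in> \<Lambda> \<Longrightarrow> continuous_on {0..pi} (\<theta> l)) \<Longrightarrow>
    (\<And>l x. l \<in> \<Lambda> \<Longrightarrow> x \<in> {0..pi} \<Longrightarrow> cmod (\<theta> l x - \<delta>) \<le> C0 / cmod l) \<Longrightarrow> cmod \<delta> \<le> 1 \<Longrightarrow>
    (\<Sum>l\<in>\<Lambda>. (cmod (integral {0..pi} (\<lambda>x. exp (\<i> * l * of_real x) * \<theta> l x * w x)))\<^sup>2) \<le> C * sq_norm w"
    by (rule sampling_bound_pos) blast
  show ?thesis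
  proof (rule that[OF C(1)])
    fix \<Lambda> w \<theta> and \<delta> \<sigma> :: complex
    assume \<Lambda>: "lattice_like B N \<Lambda>" and w: "sq_integrable w"
      and cont: "\<And>l. l \<in> \<Lambda> \<Longrightarrow> continuous_on {0..pi} (\<theta> l)"
      and near: "\<And>l x. l \<in> \<Lambda> \<Longrightarrow> x \<in> {0..pi} \<Longrightarrow> cmod (\<theta> l x - \<delta>) \<le> C0 / cmod l"
      and \<delta>: "cmod \<delta> \<le> 1" and \<sigma>: "\<sigma> = 1 \<or> \<sigma> = -1"
    show "(\<Sum>l\<in>\<Lambda>. (cmod (integral {0..pi} (\<lambda>x. exp (\<i> * (\<sigma> * l) * of_real x) * \<theta> l x * w x)))\<^sup>2)
        \<le> C * sq_norm w"
    proof (cases "\<sigma> = 1")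
      case True
      then show ?thesis using C(2)[OF \<Lambda> w cont near \<delta>] by simp
    next
      case False
      then have [simp]: "\<sigma> = -1" using \<sigma> by simp
      have "(\<Sum>l\<in>uminus ` \<Lambda>. (cmod (integral {0..pi} (\<lambda>x. exp (\<i> * l * of_real x) * \<theta> (- l) x * w
          x)))\<^sup>2) \<le> C * sq_norm w"
        using cont near by (intro C(2)[OF lattice_like_uminus[OF \<Lambda>] w _ _ \<delta>]) auto
      then show ?thesis by (subst (asm) sum.reindex) (auto simp: comp_def)
    qed
  qed
qed

section \<open>The characteristic function and its zeros\<close>

lemma cauchy_deriv_bound:
  assumes "f holomorphic_on UNIV" "\<And>w. cmod (w - z) = 1 \<Longrightarrow> cmod (f w) \<le> K"
  shows "cmod (deriv f z) \<le> K"
proof -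
  have "cmod ((deriv ^^ 1) f z) \<le> fact 1 * K / 1 ^ 1"
    using assms by (intro Cauchy_inequality)
      (auto intro: holomorphic_on_subset holomorphic_on_imp_continuous_on simp: norm_minus_commute)
  then show ?thesis by simp
qed

lemma strip_deriv_bound:
  assumes "f holomorphic_on UNIV" "\<And>z. \<bar>Im z\<bar> \<le> h + 1 \<Longrightarrow> cmod (f z) \<le> K" "\<bar>Im z\<bar> \<le> h"
  shows "cmod (deriv f z) \<le> K"
proof (rule cauchy_deriv_bound[OF assms(1)])
  fix w assume "cmod (w - z) = 1"
  then show "cmod (f w) \<le> K"
    using abs_Im_le_cmod[of "w - z"] assms(3) by (intro assms(2)) auto
qed

lemma entire_has_derivative:
  assumes "f holomorphic_on UNIV"
  shows "(f has_field_derivative deriv f z) (at z within A)"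
  using assms by (meson UNIV_I holomorphic_derivI has_field_derivative_at_within open_UNIV)

text \<open>Quantitative local injectivity: within distance \<open>c / (2 * K + 1)\<close> of
  \<open>l\<close> the derivative varies by at most \<open>c / 2\<close>, less than its modulus at
  \<open>l\<close>, so \<open>f\<close> cannot return to the value \<open>f l\<close>.\<close>

lemma strip_separation:
  assumes f: "f holomorphic_on UNIV" and K: "\<And>z. \<bar>Im z\<bar> \<le> h + 3 \<Longrightarrow> cmod (f z) \<le> K"
    and l: "\<bar>Im l\<bar> \<le> h" and c: "0 < c" "c \<le> cmod (deriv f l)" and K0: "0 \<le> K"
    and eq: "f l' = f l" and close: "cmod (l' - l) < min 1 (c / (2 * K + 1))"
  shows "l' = l"
proof (rule ccontr)
  assume ne: "l' \<noteq> l"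
  have f': "deriv f holomorphic_on UNIV" using f by (intro holomorphic_deriv) auto
  \<comment> \<open>Each Cauchy estimate uses circles of radius 1 and narrows the strip by 1.
    Starting with \<open>h + 3\<close> leaves \<open>h + 1\<close> for the second derivative, and
    that strip contains the ball about \<open>l\<close>.\<close>
  have K1: "cmod (deriv f z) \<le> K" if "\<bar>Im z\<bar> \<le> h + 2" for z
    using strip_deriv_bound[OF f, of "h + 2" K z] K that by auto
  have K2: "cmod (deriv (deriv f) z) \<le> K" if "\<bar>Im z\<bar> \<le> h + 1" for z
    using strip_deriv_bound[OF f', of "h + 1" K z] K1 that by auto
  define r where "r = cmod (l' - l)"
  have r: "0 < r" "r < 1" "r < c / (2 * K + 1)" using ne close by (auto simp: r_def)
  have Im_ball: "\<bar>Im z\<bar> \<le> h + 1" if "z \<in> cball l r" for z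
    using abs_Im_le_cmod[of "z - l"] that l r by (auto simp: dist_norm norm_minus_commute)
  have lip: "cmod (deriv f z - deriv f l) \<le> c / 2" if z: "z \<in> cball l r" for z
  proof -
    have "cmod (deriv f z - deriv f l) \<le> K * cmod (z - l)"
      using Im_ball K2 z r
      by (intro field_differentiable_bound[of "cball l r" _ "deriv (deriv f)"] entire_has_derivative
          f') auto
    also have "\<dots> \<le> K * (c / (2 * K + 1))"
      using z r K0 by (intro mult_left_mono) (auto simp: dist_norm norm_minus_commute)
    also have "\<dots> \<le> c / 2" using K0 c by (simp add: field_simps)
    finally show ?thesis .
  qed
  have "cmod ((f l' - deriv f l * l') - (f l - deriv f l * l)) \<le> c / 2 * cmod (l' - l)"
  proof (rule field_differentiable_bound[of "cball l r" "\<lambda>z. f z - deriv f l * z" "\<lambda>z. deriv f z -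
      deriv f l"])
    show "((\<lambda>z. f z - deriv f l * z) has_field_derivative deriv f z - deriv f l) (at z within cball
        l r)" for z
      by (auto intro!: derivative_eq_intros entire_has_derivative[OF f])
  qed (use r lip in \<open>auto simp: r_def dist_norm norm_minus_commute\<close>)
  also have "(f l' - deriv f l * l') - (f l - deriv f l * l) = - (deriv f l * (l' - l))"
    by (simp add: eq algebra_simps)
  finally have "cmod (deriv f l) * r \<le> c / 2 * r" by (simp add: norm_mult r_def)
  then show False using c r by simp
qed

text \<open>The coefficients belong to \<open>z1' = (- \<i> * l + b11) * z1 + b12 * z2\<close> and
  \<open>z2' = b21 * z1 + (\<i> * l + b22) * z2\<close>. By Liouville's formula \<open>trace\<close>
  keeps the modulus of the monodromy determinant away from 1.\<close>

locale dirac_system =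
  fixes b11 b12 b21 b22 :: "real \<Rightarrow> complex"
  assumes damped: "damped_on pi b11" "damped_on pi b12" "damped_on pi b21" "damped_on pi b22"
    and trace: "Re (integral {0..pi} b11 + integral {0..pi} b22) \<noteq> 0"
begin

definition "\<beta>1 x = integral {0..x} b11"
definition "\<beta>2 x = integral {0..x} b22"
text \<open>Off-diagonal coefficients after the primitives of the diagonal ones have been factored
  out. With the phases of the spectral parameter they become \<open>p\<close> and
  \<open>q\<close>.\<close>

definition "c12 x = exp (\<beta>2 x - \<beta>1 x) * b12 x"
definition "c21 x = exp (\<beta>1 x - \<beta>2 x) * b21 x"
definition "p l x = exp (\<i> * (2 * l) * of_real x) * c12 x"
definition "q l x = exp (\<i> * (- (2 * l)) * of_real x) * c21 x"
definition "Z11 l = vcosh (p l) (q l)"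
definition "Z12 l = vsinh (p l) (q l)"
definition "Z21 l = vsinh (q l) (p l)"
definition "Z22 l = vcosh (q l) (p l)"
text \<open>\<open>m1\<close> and \<open>m2\<close> are the Floquet multipliers of the system with
  its off-diagonal entries removed.\<close>

definition "m1 l = exp (- \<i> * pi * l + \<beta>1 pi)"
definition "m2 l = exp (\<i> * pi * l + \<beta>2 pi)"
definition "D = exp (\<beta>1 pi + \<beta>2 pi)"
text \<open>For the monodromy matrix \<open>diag(m1, m2) Z(pi)\<close>, \<open>T\<close> is the
  trace and \<open>D\<close> the determinant, so \<Delta> is its characteristic polynomial evaluated
  at \<omega>.\<close>

definition "T l = m1 l * Z11 l pi + m2 l * Z22 l pi"
definition "\<Delta> \<omega> l = \<omega>\<^sup>2 - \<omega> * T l + D"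

lemma D_ne_1: "cmod D \<noteq> 1"
  using trace by (simp add: D_def \<beta>1_def \<beta>2_def)

lemma exp_difference_ac:
  assumes "damped_on pi f" "damped_on pi g"
  obtains u' where "ac_on pi (\<lambda>x. exp (integral {0..x} f - integral {0..x} g)) u'"
proof -
  have d: "damped_on pi (\<lambda>x. f x + (-1) * g x)"
    by (intro damped_on_add damped_on_cmult assms)
  obtain B where "0 < B" "\<And>x. x \<in> {0..pi} \<Longrightarrow> cmod (f x + (-1) * g x) \<le> B"
    by (rule damped_onE[OF d]) blast
  then have B: "0 \<le> B" "bounded_integrable pi B (\<lambda>x. f x + (-1) * g x)"
    unfolding bounded_integrable_def using damped_on_absolutely_integrable[OF d] by auto
  have "integral {0..x} (\<lambda>x. f x + (-1) * g x) = integral {0..x} f - integral {0..x} g"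
    if "x \<in> {0..pi}" for x
    using assms[THEN damped_on_absolutely_integrable] that
    by (simp add: Henstock_Kurzweil_Integration.integral_diff integrable_on_initial)
  then show ?thesis
    by (intro that[OF ac_on_cong[OF ac_on_exp[OF B(2,1)]]]) auto
qed

text \<open>The factors coming from the diagonal are absolutely continuous, and damping is stable
  under multiplication by them.\<close>

lemma damped_c: "damped_on pi c12" "damped_on pi c21"
proof -
  obtain u where "ac_on pi (\<lambda>x. exp (\<beta>2 x - \<beta>1 x)) u"
    using exp_difference_ac[OF damped(4) damped(1)] unfolding \<beta>1_def \<beta>2_def by blast
  then show "damped_on pi c12"
    unfolding c12_def[abs_def] by (intro damped_on_mult_ac damped)
  obtain v where "ac_on pi (\<lambda>x. exp (\<beta>1 x - \<beta>2 x)) v"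
    using exp_difference_ac[OF damped(1) damped(4)] unfolding \<beta>1_def \<beta>2_def by blast
  then show "damped_on pi c21"
    unfolding c21_def[abs_def] by (intro damped_on_mult_ac damped)
qed

lemma c_bound:
  obtains B0 where "0 < B0" "\<And>x. x \<in> {0..pi} \<Longrightarrow> cmod (c12 x) \<le> B0" "\<And>x. x \<in> {0..pi} \<Longrightarrow> cmod (c21 x)
      \<le> B0"
proof -
  obtain B1 where B1: "0 < B1" "\<And>x. x \<in> {0..pi} \<Longrightarrow> cmod (c12 x) \<le> B1"
    by (rule damped_onE[OF damped_c(1)]) blast
  obtain B2 where B2: "0 < B2" "\<And>x. x \<in> {0..pi} \<Longrightarrow> cmod (c21 x) \<le> B2"
    by (rule damped_onE[OF damped_c(2)]) blast
  show ?thesis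
    by (rule that[of "max B1 B2"]) (use B1 B2 in \<open>auto simp: max.coboundedI1 max.coboundedI2\<close>)
qed

lemma pq_norm:
  "cmod (p l x) = exp (- 2 * Im l * x) * cmod (c12 x)" "cmod (q l x)
      = exp (2 * Im l * x) * cmod (c21 x)"
  by (auto simp: p_def q_def norm_mult)

lemma pq_absolutely_integrable: "p l absolutely_integrable_on {0..pi}" "q l absolutely_integrable_on
    {0..pi}"
  unfolding p_def[abs_def] q_def[abs_def]
  by (intro absolutely_integrable_continuous_mult damped_c[THEN damped_on_absolutely_integrable]
      continuous_intros)+

lemma pq_bounded_integrable:
  "\<exists>B\<ge>0. \<forall>l. \<bar>Im l\<bar> \<le> h \<longrightarrow> bounded_integrable pi B (p l) \<and> bounded_integrable pi B (q l)"
proof -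
  obtain B0 where B0: "0 < B0" "\<And>x. x \<in> {0..pi} \<Longrightarrow> cmod (c12 x) \<le> B0" "\<And>x. x \<in> {0..pi} \<Longrightarrow>
      cmod (c21 x) \<le> B0"
    by (rule c_bound) blast
  have "cmod (p l x) \<le> exp (2 * h * pi) * B0 \<and> cmod (q l x) \<le> exp (2 * h * pi) * B0"
    if l: "\<bar>Im l\<bar> \<le> h" and x: "x \<in> {0..pi}" for l x
    unfolding p_def q_def norm_mult
    using norm_exp_ii_le[OF x, of "2 * l" "2 * h"] norm_exp_ii_le[OF x, of "- (2 * l)" "2 * h"] l B0
        x
    by (intro conjI mult_mono) auto
  then show ?thesis
    using B0(1) pq_absolutely_integrable unfolding bounded_integrable_def
    by (intro exI[of _ "exp (2 * h * pi) * B0"]) auto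
qed

lemma pq_bounded_integrable_at:
  obtains B where "0 \<le> B" "bounded_integrable pi B (p l)" "bounded_integrable pi B (q l)"
  using pq_bounded_integrable[of "\<bar>Im l\<bar>"] by blast

lemma pq_bounded_integrable_disc:
  "\<exists>B\<ge>0. \<forall>l. cmod l \<le> r \<longrightarrow> bounded_integrable pi B (p l) \<and> bounded_integrable pi B (q l)"
  using pq_bounded_integrable[of r] by (meson abs_Im_le_cmod order_trans)

lemma pq_holomorphic: "(\<lambda>l. p l s) holomorphic_on UNIV" "(\<lambda>l. q l s) holomorphic_on UNIV"
  unfolding p_def q_def by (intro holomorphic_intros)+

lemma Z_holomorphic:
  assumes "x \<in> {0..pi}"
  shows "(\<lambda>l. Z11 l x) holomorphic_on UNIV" "(\<lambda>l. Z12 l x) holomorphic_on UNIV"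
    "(\<lambda>l. Z21 l x) holomorphic_on UNIV" "(\<lambda>l. Z22 l x) holomorphic_on UNIV"
  unfolding Z11_def Z12_def Z21_def Z22_def
  using pq_bounded_integrable_disc pq_holomorphic assms
  by (intro vcosh_holomorphic vsinh_holomorphic; blast)+

lemma Z_continuous:
  "continuous_on {0..pi} (Z11 l)" "continuous_on {0..pi} (Z12 l)"
  "continuous_on {0..pi} (Z21 l)" "continuous_on {0..pi} (Z22 l)"
proof -
  obtain B where B: "0 \<le> B" and pq: "bounded_integrable pi B (p l)" "bounded_integrable pi B (q l)"
    by (rule pq_bounded_integrable_at)
  show "continuous_on {0..pi} (Z11 l)" "continuous_on {0..pi} (Z12 l)"
    "continuous_on {0..pi} (Z21 l)" "continuous_on {0..pi} (Z22 l)"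
    unfolding Z11_def Z12_def Z21_def Z22_def
    using vcosh_ac[OF pq B] vsinh_ac[OF pq B] vcosh_ac[OF pq(2,1) B] vsinh_ac[OF pq(2,1) B]
    by (auto intro: ac_on_continuous)
qed

lemma Z_bound:
  obtains K where "0 \<le> K" "\<And>l x. \<bar>Im l\<bar> \<le> h \<Longrightarrow> x \<in> {0..pi} \<Longrightarrow>
    cmod (Z11 l x) \<le> K \<and> cmod (Z12 l x) \<le> K \<and> cmod (Z21 l x) \<le> K \<and> cmod (Z22 l x) \<le> K"
proof -
  obtain B where B: "0 \<le> B" "\<And>l. \<bar>Im l\<bar> \<le> h \<Longrightarrow> bounded_integrable pi B (p l)
      \<and> bounded_integrable pi B (q l)"
    using pq_bounded_integrable[of h] by blast
  show ?thesis
    by (rule that[of "exp (B * pi)"])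
      (use B in \<open>auto simp: Z11_def Z12_def Z21_def Z22_def intro!: vcosh_bound vsinh_bound\<close>)
qed

lemma Z_det: "x \<in> {0..pi} \<Longrightarrow> Z11 l x * Z22 l x - Z12 l x * Z21 l x = 1"
proof -
  obtain B where B: "0 \<le> B" and pq: "bounded_integrable pi B (p l)" "bounded_integrable pi B (q l)"
    by (rule pq_bounded_integrable_at)
  show "x \<in> {0..pi} \<Longrightarrow> ?thesis"
    unfolding Z11_def Z12_def Z21_def Z22_def by (rule fundamental_det[OF pq B])
qed

text \<open>In a strip the phases in \<open>p\<close> and \<open>q\<close> are bounded, and damping
  makes the primitives of \<open>p\<close> and \<open>q\<close> of order \<open>1 / cmod l\<close>.
  The estimates \<open>vcosh_near_1\<close> and \<open>vsinh_near_0\<close> transfer this to all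
  four entries.\<close>

lemma Z_asymptotics:
  obtains C where "0 \<le> C" "\<And>l x. \<bar>Im l\<bar> \<le> h \<Longrightarrow> l \<noteq> 0 \<Longrightarrow> x \<in> {0..pi} \<Longrightarrow>
    cmod (Z11 l x - 1) \<le> C / cmod l \<and> cmod (Z12 l x) \<le> C / cmod l \<and>
    cmod (Z21 l x) \<le> C / cmod l \<and> cmod (Z22 l x - 1) \<le> C / cmod l"
proof -
  obtain B where B: "0 \<le> B" "\<And>l. \<bar>Im l\<bar> \<le> h \<Longrightarrow> bounded_integrable pi B (p l)
      \<and> bounded_integrable pi B (q l)"
    using pq_bounded_integrable[of h] by blast
  obtain C1 where C1: "0 \<le> C1" "\<And>\<mu> x. \<mu> \<noteq> 0 \<Longrightarrow> x \<in> {0..pi} \<Longrightarrow>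
      cmod (integral {0..x} (\<lambda>s. exp (\<i> * \<mu> * of_real s) * c12 s))
          \<le> C1 * exp (pi * \<bar>Im \<mu>\<bar>) / cmod \<mu>"
    by (rule damped_on_exp[OF damped_c(1)]) auto
  obtain C2 where C2: "0 \<le> C2" "\<And>\<mu> x. \<mu> \<noteq> 0 \<Longrightarrow> x \<in> {0..pi} \<Longrightarrow>
      cmod (integral {0..x} (\<lambda>s. exp (\<i> * \<mu> * of_real s) * c21 s))
          \<le> C2 * exp (pi * \<bar>Im \<mu>\<bar>) / cmod \<mu>"
    by (rule damped_on_exp[OF damped_c(2)]) auto
  define E where "E = (C1 + C2) * exp (2 * pi * h)"
  define K where "K = (1 + B * pi) * exp (B * pi)"
  have small: "cmod (integral {0..x} (p l)) \<le> E / cmod l \<and> cmod (integral {0..x} (q l))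
      \<le> E / cmod l"
    if "\<bar>Im l\<bar> \<le> h" "l \<noteq> 0" "x \<in> {0..pi}" for l x
  proof -
    have *: "C' * exp (pi * \<bar>2 * Im l\<bar>) / cmod (2 * l) \<le> E / cmod l" if "0 \<le> C'" "C' \<le> C1 + C2"
        for C'
    proof -
      have "C' * exp (pi * \<bar>2 * Im l\<bar>) \<le> E"
        unfolding E_def using that \<open>\<bar>Im l\<bar> \<le> h\<close> by (intro mult_mono) (auto simp: abs_mult)
      moreover have "E / (2 * cmod l) \<le> E / cmod l"
        using C1 C2 \<open>l \<noteq> 0\<close> by (intro divide_left_mono) (auto simp: E_def)
      ultimately show ?thesis
        using \<open>l \<noteq> 0\<close> by (auto simp: norm_mult intro: order_trans[OF divide_right_mono])
    qed
    show ?thesis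
      using C1(2)[of "2 * l" x] C2(2)[of "- (2 * l)" x] that *[of C1] *[of C2] C1(1) C2(1)
      unfolding p_def[abs_def] q_def[abs_def] by (auto simp: norm_mult intro: order_trans)
  qed
  show ?thesis
  proof (rule that[of "E * K"])
    show "0 \<le> E * K" using C1 C2 B by (simp add: E_def K_def)
    fix l x assume l: "\<bar>Im l\<bar> \<le> h" "l \<noteq> 0" and x: "x \<in> {0..pi}"
    have pq: "bounded_integrable pi B (p l)" "bounded_integrable pi B (q l)" using B l by auto
    have eq: "E * K / cmod l = E / cmod l * ((1 + B * pi) * exp (B * pi))" by (simp add: K_def)
    show "cmod (Z11 l x - 1) \<le> E * K / cmod l \<and> cmod (Z12 l x) \<le> E * K / cmod l \<and>
      cmod (Z21 l x) \<le> E * K / cmod l \<and> cmod (Z22 l x - 1) \<le> E * K / cmod l"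
      unfolding eq Z11_def Z12_def Z21_def Z22_def
      using small[OF l]
      by (intro conjI vcosh_near_1[OF pq B(1) _ x] vsinh_near_0[OF pq B(1) _ x]
          vcosh_near_1[OF pq(2,1) B(1) _ x] vsinh_near_0[OF pq(2,1) B(1) _ x]) auto
  qed
qed

lemma m_holomorphic: "m1 holomorphic_on UNIV" "m2 holomorphic_on UNIV"
  unfolding m1_def[abs_def] m2_def[abs_def] by (intro holomorphic_intros)+

lemma T_holomorphic: "T holomorphic_on UNIV"
  unfolding T_def[abs_def] by (intro holomorphic_intros m_holomorphic Z_holomorphic) auto

lemma \<Delta>_holomorphic: "\<Delta> \<omega> holomorphic_on UNIV"
  unfolding \<Delta>_def[abs_def] by (intro holomorphic_intros T_holomorphic)

lemma m_mult: "m1 l * m2 l = D"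
  by (simp add: m1_def m2_def D_def flip: exp_add)

lemma m_bound:
  obtains K where "0 \<le> K" "\<And>l. \<bar>Im l\<bar> \<le> h \<Longrightarrow> cmod (m1 l) \<le> K \<and> cmod (m2 l) \<le> K"
proof (rule that)
  fix l assume "\<bar>Im l\<bar> \<le> h"
  then have "pi * Im l \<le> pi * h" "- (pi * Im l) \<le> pi * h"
    using mult_left_mono[of "Im l" h pi] mult_left_mono[of "- Im l" h pi] by auto
  moreover have "cmod (m1 l) = exp (pi * Im l + Re (\<beta>1 pi))" "cmod (m2 l)
      = exp (- (pi * Im l) + Re (\<beta>2 pi))"
    by (simp_all add: m1_def m2_def)
  ultimately show "cmod (m1 l) \<le> exp (pi * h + \<bar>Re (\<beta>1 pi)\<bar> + \<bar>Re (\<beta>2 pi)\<bar>)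
      \<and> cmod (m2 l) \<le> exp (pi * h + \<bar>Re (\<beta>1 pi)\<bar> + \<bar>Re (\<beta>2 pi)\<bar>)"
    by (simp only: exp_le_cancel_iff) linarith
qed auto

lemma T_bound:
  obtains K where "0 \<le> K" "\<And>l. \<bar>Im l\<bar> \<le> h \<Longrightarrow> cmod (T l) \<le> K"
proof -
  obtain K1 where K1: "0 \<le> K1" "\<And>l x. \<bar>Im l\<bar> \<le> h \<Longrightarrow> x \<in> {0..pi} \<Longrightarrow>
    cmod (Z11 l x) \<le> K1 \<and> cmod (Z12 l x) \<le> K1 \<and> cmod (Z21 l x) \<le> K1 \<and> cmod (Z22 l x) \<le> K1"
    by (rule Z_bound[of h]) blast
  obtain K2 where K2: "0 \<le> K2" "\<And>l. \<bar>Im l\<bar> \<le> h \<Longrightarrow> cmod (m1 l) \<le> K2 \<and> cmod (m2 l) \<le> K2"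
    by (rule m_bound[of h]) blast
  have "cmod (T l) \<le> K2 * K1 + K2 * K1" if "\<bar>Im l\<bar> \<le> h" for l
    unfolding T_def using K1(2)[OF that, of pi] K2(2)[OF that] K1(1) K2(1)
    by (intro norm_triangle_mono) (auto simp: norm_mult intro!: mult_mono)
  then show ?thesis using that[of "K2 * K1 + K2 * K1"] K1(1) K2(1) by auto
qed

lemma \<Delta>_zero_iff:
  assumes "cmod \<omega> = 1"
  shows "\<Delta> \<omega> l = 0 \<longleftrightarrow> T l = \<omega> + D / \<omega>"
proof -
  have "\<omega> \<noteq> 0" using assms by auto
  then show ?thesis by (auto simp: \<Delta>_def field_simps power2_eq_square)
qed

lemma norm_\<omega>_plus: "cmod \<omega> = 1 \<Longrightarrow> cmod (\<omega> + D / \<omega>) \<le> 1 + cmod D"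
  by (intro norm_triangle_mono) (auto simp: norm_divide)

text \<open>For large \<open>\<bar>Im l\<bar>\<close> one of the two terms of \<open>T\<close> dominates.\<close>
lemma zeros_confined:
  obtains h where "0 < h" "\<And>\<omega> l. cmod \<omega> = 1 \<Longrightarrow> \<Delta> \<omega> l = 0 \<Longrightarrow> \<bar>Im l\<bar> \<le> h"
proof -
  obtain B0 where B0: "0 < B0" "\<And>x. x \<in> {0..pi} \<Longrightarrow> cmod (c12 x) \<le> B0" "\<And>x. x \<in> {0..pi} \<Longrightarrow>
      cmod (c21 x) \<le> B0"
    by (rule c_bound) blast
  define c where "c = B0\<^sup>2 * pi"
  \<comment> \<open>A lower bound for \<open>cmod (T l)\<close> at height \<eta> from the real axis;
    \<open>E\<close> and \<open>E'\<close> are the moduli of \<open>exp (\<beta>1 pi)\<close> and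
    \<open>exp (\<beta>2 pi)\<close>, the dominant one first.\<close>
  define L where "L E E' \<eta> = exp (pi * \<eta>) * (E * (1 - c / \<eta>) - E' * (exp (- 2 * \<eta> * pi) + c / \<eta>))"
    for E E' \<eta> :: real
  have lim: "filterlim (L E E') at_top at_top" if "E > 0" for E E'
    unfolding L_def using that by real_asymp
  define e1 e2 where "e1 = exp (Re (\<beta>1 pi))" and "e2 = exp (Re (\<beta>2 pi))"
  have "\<forall>\<^sub>F \<eta> in at_top. L e1 e2 \<eta> > 1 + cmod D" "\<forall>\<^sub>F \<eta> in at_top. L e2 e1 \<eta> > 1 + cmod D"
    using lim[of e1 e2] lim[of e2 e1] by (auto simp: e1_def e2_def filterlim_at_top_dense)
  with eventually_ge_at_top[of "max 1 c"]
  have "\<forall>\<^sub>F \<eta> in at_top. L e1 e2 \<eta> > 1 + cmod D \<and> L e2 e1 \<eta> > 1 + cmod D \<and> \<eta> \<ge> max 1 c"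
    by eventually_elim auto
  then obtain h where h: "\<And>\<eta>. \<eta> \<ge> h \<Longrightarrow> L e1 e2 \<eta> > 1 + cmod D \<and> L e2 e1 \<eta> > 1 + cmod D \<and> \<eta> \<ge> max 1 c"
    unfolding eventually_at_top_linorder by blast
  \<comment> \<open>The recessive multiplier is tiny, but its factor \<open>z'\<close> may grow like
    \<open>exp (2 * \<eta> * pi)\<close>. \<open>vcosh_growing\<close> limits their product to a
    fraction of order \<open>c / \<eta>\<close> of the dominant exponential.\<close>
  have split: "L E E' \<eta> \<le> cmod (m * z + m' * z')"
    if "cmod m = exp (pi * \<eta>) * E" "cmod m' = exp (- pi * \<eta>) * E'" "0 < E" "0 < E'"
      "cmod (z - 1) \<le> c / \<eta>" "exp (- 2 * \<eta> * pi) * cmod z' \<le> exp (- 2 * \<eta> * pi) + c / \<eta>"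
    for E E' \<eta> m m' z z'
  proof -
    have "1 - c / \<eta> \<le> cmod z" using that(5) norm_triangle_ineq2[of 1 z]
        by (simp add: norm_minus_commute)
    then have "exp (pi * \<eta>) * (E * (1 - c / \<eta>)) \<le> cmod (m * z)"
      using that(1,3) by (simp add: norm_mult)
    moreover have "cmod (m' * z') = exp (pi * \<eta>) * (E' * (exp (- 2 * \<eta> * pi) * cmod z'))"
      using that(2) by (simp add: norm_mult exp_add[symmetric] algebra_simps flip: mult.assoc)
    then have "cmod (m' * z') \<le> exp (pi * \<eta>) * (E' * (exp (- 2 * \<eta> * pi) + c / \<eta>))"
      using that(4,6) by simp
    moreover have "cmod (m * z) - cmod (m' * z') \<le> cmod (m * z + m' * z')"
      using norm_diff_ineq by blast
    ultimately show ?thesis by (simp add: L_def algebra_simps)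
  qed
  have "cmod (T l) > 1 + cmod D" if l: "\<bar>Im l\<bar> \<ge> h" for l
  proof -
    define \<eta> where "\<eta> = \<bar>Im l\<bar>"
    have \<eta>: "0 < \<eta>" "B0\<^sup>2 * pi \<le> \<eta>" using h[of \<eta>] l by (auto simp: \<eta>_def c_def)
    obtain B where B: "0 \<le> B" and pq: "bounded_integrable pi B (p l)" "bounded_integrable pi B (q
        l)"
      by (rule pq_bounded_integrable_at)
    show ?thesis
    proof (cases "0 \<le> Im l")
      case True
      have pb: "cmod (p l x) \<le> B0 * exp (- 2 * \<eta> * x)" if "x \<in> {0..pi}" for x
        using B0(2)[OF that] True by (simp add: pq_norm \<eta>_def mult.commute)
      have qb: "cmod (q l x) \<le> B0 * exp (2 * \<eta> * x)" if "x \<in> {0..pi}" for x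
        using B0(3)[OF that] True by (simp add: pq_norm \<eta>_def mult.commute)
      have "L e1 e2 \<eta> \<le> cmod (T l)"
        unfolding T_def Z11_def Z22_def c_def[symmetric]
        using vcosh_decaying[OF pq B \<eta> less_imp_le[OF B0(1)] pi_ge_zero pb qb]
          vcosh_growing[OF pq B \<eta> less_imp_le[OF B0(1)] pi_ge_zero pb qb] True
        by (intro split) (auto simp: m1_def m2_def e1_def e2_def c_def \<eta>_def exp_add[symmetric])
      then show ?thesis using h[of \<eta>] l by (simp add: \<eta>_def)
    next
      case False
      have pb: "cmod (p l x) \<le> B0 * exp (2 * \<eta> * x)" if "x \<in> {0..pi}" for x
        using B0(2)[OF that] False by (simp add: pq_norm \<eta>_def mult.commute)
      have qb: "cmod (q l x) \<le> B0 * exp (- 2 * \<eta> * x)" if "x \<in> {0..pi}" for x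
        using B0(3)[OF that] False by (simp add: pq_norm \<eta>_def mult.commute)
      have "L e2 e1 \<eta> \<le> cmod (m2 l * Z22 l pi + m1 l * Z11 l pi)"
        unfolding Z11_def Z22_def c_def[symmetric]
        using vcosh_decaying[OF pq(2,1) B \<eta> less_imp_le[OF B0(1)] pi_ge_zero qb pb]
          vcosh_growing[OF pq(2,1) B \<eta> less_imp_le[OF B0(1)] pi_ge_zero qb pb] False
        by (intro split) (auto simp: m1_def m2_def e1_def e2_def c_def \<eta>_def exp_add[symmetric])
      then show ?thesis using h[of \<eta>] l by (simp add: \<eta>_def T_def add.commute)
    qed
  qed
  then have "\<bar>Im l\<bar> \<le> max h 1" if "cmod \<omega> = 1" "\<Delta> \<omega> l = 0" for \<omega> l
    using norm_\<omega>_plus[OF that(1)] that \<Delta>_zero_iff[OF that(1), of l] by (smt (verit) max.coboundedI1)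
  then show ?thesis using that[of "max h 1"] by auto
qed

text \<open>At a zero \<open>m1 + m2 \<approx> T = \<omega> + D / \<omega>\<close> and \<open>m1 m2 = D\<close>, so \<open>T' \<approx> \<i> \<pi> (m2 - m1)\<close> is close to
  \<open>\<plusminus> \<i> \<pi> (\<omega> - D / \<omega>)\<close>, which stays away from zero because \<open>\<bar>D\<bar> \<noteq> 1\<close>.\<close>
lemma deriv_T_lower_bound:
  obtains c M where "0 < c" "2 \<le> M"
    "\<And>\<omega> l. cmod \<omega> = 1 \<Longrightarrow> \<Delta> \<omega> l = 0 \<Longrightarrow> M \<le> cmod l \<Longrightarrow> c \<le> cmod (deriv T l)"
proof -
  obtain h where h: "0 < h" "\<And>\<omega> l. cmod \<omega> = 1 \<Longrightarrow> \<Delta> \<omega> l = 0 \<Longrightarrow> \<bar>Im l\<bar> \<le> h"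
    by (rule zeros_confined) blast
  obtain C1 where C1: "0 \<le> C1" "\<And>l x. \<bar>Im l\<bar> \<le> h + 1 \<Longrightarrow> l \<noteq> 0 \<Longrightarrow> x \<in> {0..pi} \<Longrightarrow>
    cmod (Z11 l x - 1) \<le> C1 / cmod l \<and> cmod (Z12 l x) \<le> C1 / cmod l \<and>
    cmod (Z21 l x) \<le> C1 / cmod l \<and> cmod (Z22 l x - 1) \<le> C1 / cmod l"
    by (rule Z_asymptotics[of "h + 1"]) blast
  obtain K where K: "0 \<le> K" "\<And>l. \<bar>Im l\<bar> \<le> h + 1 \<Longrightarrow> cmod (m1 l) \<le> K \<and> cmod (m2 l) \<le> K"
    by (rule m_bound[of "h + 1"]) blast
  define C where "C = 2 * K * C1"
  define R where "R l = T l - (m1 l + m2 l)" for l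
  have C: "0 \<le> C" using C1 K by (simp add: C_def)
  have R: "cmod (R l) \<le> C / cmod l" if "\<bar>Im l\<bar> \<le> h + 1" "l \<noteq> 0" for l
  proof -
    have "R l = m1 l * (Z11 l pi - 1) + m2 l * (Z22 l pi - 1)"
      by (simp add: R_def T_def algebra_simps)
    also have "cmod \<dots> \<le> K * (C1 / cmod l) + K * (C1 / cmod l)"
      using C1(2)[OF that, of pi] K(2)[OF that(1)] K(1)
      by (intro order_trans[OF norm_triangle_ineq] add_mono) (auto simp: norm_mult simp del:
          times_divide_eq_right intro!: mult_mono)
    finally show ?thesis by (simp add: C_def mult.commute)
  qed
  have R_holo: "R holomorphic_on UNIV"
    unfolding R_def[abs_def] by (intro holomorphic_intros T_holomorphic m_holomorphic)
  \<comment> \<open>A lower bound for \<open>\<omega> - D / \<omega>\<close> that is the same for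
    all unimodular \<omega>.\<close>
  define d where "d = \<bar>1 - cmod D\<bar>"
  have d: "0 < d" using D_ne_1 by (simp add: d_def)
  define A where "A = (2 * (1 + cmod D) + C) * C"
  have A: "0 \<le> A" using C by (simp add: A_def)
  \<comment> \<open>The second summand is chosen to make the derivative of \<open>R\<close> at most
    \<open>d / 2\<close>; the third keeps the perturbation of the squared multiplier difference
    below \<open>d\<^sup>2 / 4\<close>.\<close>
  define M where "M = 2 + 2 * C / d + 4 * A / d\<^sup>2"
  have M: "2 \<le> M" "4 * A / d\<^sup>2 \<le> M" "1 + 2 * C / d \<le> M"
    using d C A by (auto simp: M_def)
  have "d / 2 \<le> cmod (deriv T l)" if \<omega>: "cmod \<omega> = 1" and zero: "\<Delta> \<omega> l = 0" and l: "M \<le> cmod l"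
      for \<omega> l
  proof -
    have Im: "\<bar>Im l\<bar> \<le> h" using h(2)[OF \<omega> zero] .
    have l0: "l \<noteq> 0" "1 < cmod l" "0 < cmod l" using l M by auto
    define \<tau> where "\<tau> = \<omega> + D / \<omega>"
    define r where "r = R l"
    have r: "cmod r \<le> C / cmod l" using R[of l] Im l0 by (simp add: r_def)
    also have "\<dots> \<le> C / 1" using C l0 by (intro divide_left_mono) auto
    finally have r1: "cmod r \<le> C" by simp
    have T: "T l = \<tau>" using \<Delta>_zero_iff[OF \<omega>] zero by (simp add: \<tau>_def)
    then have sum_m: "m1 l + m2 l = \<tau> - r" by (simp add: r_def R_def)
    have \<omega>0: "\<omega> \<noteq> 0" using \<omega> by auto
    \<comment> \<open>The discriminant involves only the sum and the product of the multipliers: at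
      a zero the sum is \<open>\<tau> - r\<close>, and the product is exactly
      \<open>D\<close>.\<close>
    have "(m2 l - m1 l)\<^sup>2 = (m1 l + m2 l)\<^sup>2 - 4 * (m1 l * m2 l)"
      by (simp add: power2_eq_square algebra_simps)
    also have "\<dots> = (\<tau> - r)\<^sup>2 - 4 * D" by (simp add: sum_m m_mult)
    also have "\<dots> = (\<omega> - D / \<omega>)\<^sup>2 - (2 * \<tau> - r) * r"
      using \<omega>0 by (simp add: \<tau>_def power2_eq_square field_simps)
    finally have sq: "(m2 l - m1 l)\<^sup>2 = (\<omega> - D / \<omega>)\<^sup>2 - (2 * \<tau> - r) * r" .
    have "cmod ((2 * \<tau> - r) * r) \<le> (2 * (1 + cmod D) + C) * (C / cmod l)"
      unfolding norm_mult using norm_triangle_ineq4[of "2 * \<tau>" r] norm_\<omega>_plus[OF \<omega>, folded \<tau>_def] r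
          r1 C
      by (intro mult_mono) (auto simp: norm_mult)
    also have "\<dots> = A / cmod l" by (simp add: A_def)
    also have "\<dots> \<le> d\<^sup>2 / 4"
    proof -
      have "4 * A / d\<^sup>2 \<le> cmod l" using M(2) l by linarith
      then have "4 * A \<le> cmod l * d\<^sup>2" using d by (simp add: pos_divide_le_eq)
      then show ?thesis using l0(3) by (simp add: field_simps)
    qed
    finally have err: "cmod ((2 * \<tau> - r) * r) \<le> d\<^sup>2 / 4" .
    have "d \<le> cmod (\<omega> - D / \<omega>)"
      using norm_triangle_ineq3[of \<omega> "D / \<omega>"] \<omega> by (simp add: d_def norm_divide)
    then have "d\<^sup>2 \<le> cmod ((\<omega> - D / \<omega>)\<^sup>2)" using d by (simp add: norm_power power_mono)
    then have "d\<^sup>2 - d\<^sup>2 / 4 \<le> cmod ((m2 l - m1 l)\<^sup>2)"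
      unfolding sq using err norm_triangle_ineq2[of "(\<omega> - D / \<omega>)\<^sup>2" "(2 * \<tau> - r) * r"] by linarith
    then have "(d / 2)\<^sup>2 \<le> (cmod (m2 l - m1 l))\<^sup>2"
    proof -
      have "(d / 2)\<^sup>2 = d\<^sup>2 / 4" by (simp add: power_divide)
      moreover have "cmod ((m2 l - m1 l)\<^sup>2) = (cmod (m2 l - m1 l))\<^sup>2" by (rule norm_power)
      ultimately show "(d / 2)\<^sup>2 \<le> (cmod (m2 l - m1 l))\<^sup>2"
        using \<open>d\<^sup>2 - d\<^sup>2 / 4 \<le> _\<close> zero_le_power2[of d] by linarith
    qed
    then have mdiff: "d / 2 \<le> cmod (m2 l - m1 l)" by (rule power2_le_imp_le) simp
    have "cmod (deriv R l) \<le> C / (cmod l - 1)"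
    proof (rule cauchy_deriv_bound[OF R_holo])
      fix w assume w: "cmod (w - l) = 1"
      have "\<bar>Im w\<bar> \<le> h + 1" using abs_Im_le_cmod[of "w - l"] w Im by auto
      moreover have wl: "cmod l - 1 \<le> cmod w"
        using norm_triangle_ineq2[of l w] w by (simp add: norm_minus_commute)
      moreover from this have "w \<noteq> 0" using l0 by auto
      ultimately have "cmod (R w) \<le> C / cmod w" by (intro R)
      also have "\<dots> \<le> C / (cmod l - 1)"
        using wl l0 C by (intro divide_left_mono mult_pos_pos) auto
      finally show "cmod (R w) \<le> C / (cmod l - 1)" .
    qed
    also have "\<dots> \<le> d / 2"
    proof -
      have "2 * C / d \<le> cmod l - 1" using M(3) l by simp
      then show ?thesis using d l0 by (simp add: field_simps)
    qed
    finally have R': "cmod (deriv R l) \<le> d / 2" .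
    have "((\<lambda>z. R z + (m1 z + m2 z)) has_field_derivative
        deriv R l + (- \<i> * pi * m1 l + \<i> * pi * m2 l)) (at l)"
      unfolding m1_def m2_def
      by (auto intro!: derivative_eq_intros entire_has_derivative[OF R_holo])
    then have "deriv T l = deriv R l + (- \<i> * pi * m1 l + \<i> * pi * m2 l)"
      by (intro DERIV_imp_deriv) (simp add: R_def)
    then have eq: "deriv T l = \<i> * pi * (m2 l - m1 l) + deriv R l" by (simp add: algebra_simps)
    \<comment> \<open>As \<open>pi\<close> is at least 2, the main term is at least
      \<open>d\<close>, and \<open>d / 2\<close> survives the loss from the derivative of
      \<open>R\<close>.\<close>
    have "2 * (d / 2) \<le> pi * cmod (m2 l - m1 l)"
      using mdiff d pi_ge_two by (intro mult_mono) auto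
    also have "\<dots> = cmod (\<i> * pi * (m2 l - m1 l))" by (simp add: norm_mult)
    also have "\<dots> \<le> cmod (deriv T l) + cmod (deriv R l)"
      unfolding eq by (metis add.commute norm_diff_ineq diff_le_eq)
    finally show ?thesis using R' by simp
  qed
  then show ?thesis using that[of "d / 2" M] d M by auto
qed

text \<open>All zeros of \<Delta> for one \<omega> are points where \<open>T\<close> takes the same
  value \<open>\<omega> + D / \<omega>\<close>. The lower bound for the derivative of
  \<open>T\<close> therefore separates the large ones by a distance \<open>r\<close> independent of
  \<omega>, and a covering argument counts those near a given even integer.\<close>

lemma zeros_lattice_like:
  obtains M B N where "2 \<le> M" "\<And>\<omega> \<Lambda>. cmod \<omega> = 1 \<Longrightarrow> finite \<Lambda> \<Longrightarrow>
    (\<And>l. l \<in> \<Lambda> \<Longrightarrow> \<Delta> \<omega> l = 0 \<and> M \<le> cmod l) \<Longrightarrow> lattice_like B N \<Lambda>"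
proof -
  obtain h where h: "0 < h" "\<And>\<omega> l. cmod \<omega> = 1 \<Longrightarrow> \<Delta> \<omega> l = 0 \<Longrightarrow> \<bar>Im l\<bar> \<le> h"
    by (rule zeros_confined) blast
  obtain c M where c: "0 < c" "2 \<le> M"
    "\<And>\<omega> l. cmod \<omega> = 1 \<Longrightarrow> \<Delta> \<omega> l = 0 \<Longrightarrow> M \<le> cmod l \<Longrightarrow> c \<le> cmod (deriv T l)"
    by (rule deriv_T_lower_bound) blast
  obtain K where K: "0 \<le> K" "\<And>l. \<bar>Im l\<bar> \<le> h + 3 \<Longrightarrow> cmod (T l) \<le> K"
    by (rule T_bound[of "h + 3"]) blast
  define r where "r = min 1 (c / (2 * K + 1))"
  have r: "0 < r" using c K by (simp add: r_def)
  have cover: "cball (0::complex) (h + 1) \<subseteq> (\<Union>x\<in>cball 0 (h + 1). ball x (r / 2))"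
    using r by auto
  obtain P where P: "finite P" "cball (0::complex) (h + 1) \<subseteq> (\<Union>x\<in>P. ball x (r / 2))"
    by (rule compactE_image[OF compact_cball _ cover]) (simp, blast)
  show ?thesis
  proof (rule that[OF c(2), where B = "h + 1" and N = "card P"])
    fix \<omega> \<Lambda> assume \<omega>: "cmod \<omega> = 1" and fin: "finite \<Lambda>"
      and \<Lambda>: "\<And>l. l \<in> \<Lambda> \<Longrightarrow> \<Delta> \<omega> l = 0 \<and> M \<le> cmod l"
    have sep: "l' = l" if "l \<in> \<Lambda>" "l' \<in> \<Lambda>" "cmod (l' - l) < r" for l l'
    proof (rule strip_separation[OF T_holomorphic K(2) _ c(1) _ K(1)])
      have z: "\<Delta> \<omega> l = 0" "\<Delta> \<omega> l' = 0" "M \<le> cmod l" using that(1,2) \<Lambda> by blast+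
      show "T l' = T l" using z(1,2) unfolding \<Delta>_zero_iff[OF \<omega>] by simp
      show "\<bar>Im l\<bar> \<le> h" "c \<le> cmod (deriv T l)"
        using h(2)[OF \<omega> z(1)] c(3)[OF \<omega> z(1,3)] .
      show "cmod (l' - l) < min 1 (c / (2 * K + 1))" using that(3) by (simp only: r_def)
    qed
    \<comment> \<open>Rounding costs at most 1 in the real direction, and the imaginary part is at
      most \<open>h\<close>.\<close>
    have near: "cmod (l - 2 * of_int (round (Re l / 2))) \<le> h + 1" if "l \<in> \<Lambda>" for l
    proof -
      have "\<bar>Re l - 2 * of_int (round (Re l / 2))\<bar> \<le> 1"
        using of_int_round_abs_le[of "Re l / 2"] by linarith
      then show ?thesis
        using cmod_le[of "l - 2 * of_int (round (Re l / 2))"] h(2)[OF \<omega>, of l] \<Lambda>[OF that] by simp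
    qed
    have "card {l\<in>\<Lambda>. round (Re l / 2) = j} \<le> card P" for j
    proof -
      \<comment> \<open>The centre of a covering ball that contains the translated zero. Two zeros
        with the same integer and the same centre are closer than \<open>r\<close>, hence equal, so
        the centres count the zeros.\<close>
      define cen where "cen l = (SOME x. x \<in> P \<and> l - 2 * of_int j \<in> ball x (r / 2))"
          for l :: complex
      have cen: "cen l \<in> P \<and> l - 2 * of_int j \<in> ball (cen l) (r / 2)"
        if "l \<in> {l\<in>\<Lambda>. round (Re l / 2) = j}" for l
        unfolding cen_def using near[of l] that P(2)
        by (intro someI_ex[of "\<lambda>x. x \<in> P \<and> l - 2 * of_int j \<in> ball x (r / 2)"]) (auto simp:
            subset_iff)
      show ?thesis
      proof (rule card_inj_on_le[OF _ _ P(1), of cen])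
        show "inj_on cen {l\<in>\<Lambda>. round (Re l / 2) = j}"
        proof (rule inj_onI)
          fix l l' assume l: "l \<in> {l\<in>\<Lambda>. round (Re l / 2)
              = j}" and l': "l' \<in> {l\<in>\<Lambda>. round (Re l / 2) = j}"
            and "cen l = cen l'"
          then have "dist (l - 2 * of_int j) (l' - 2 * of_int j) < r"
            using cen[OF l] cen[OF l'] dist_triangle_half_r[of "cen l" "l - 2 * of_int j" r "l' - 2
                * of_int j"] by auto
          then show "l = l'" using sep[of l' l] l l' by (auto simp: dist_norm)
        qed
      qed (use cen in auto)
    qed
    moreover have "1 \<le> cmod l" if "l \<in> \<Lambda>" for l
      using \<Lambda>[OF that] c(2) by linarith
    ultimately show "lattice_like (h + 1) (card P) \<Lambda>"
      unfolding lattice_like_def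
      by (intro conjI ballI allI exI[of _ "\<lambda>l. round (Re l / 2)"] fin near)
  qed
qed

text \<open>Confinement to a strip provides a point on the imaginary axis where \<Delta> does not
  vanish, so it is not identically zero and its zeros are isolated.\<close>

lemma finite_zeros:
  assumes \<omega>: "cmod \<omega> = 1"
  shows "finite {z \<in> cball 0 r. \<Delta> \<omega> z = 0}"
proof (cases "\<exists>z. \<Delta> \<omega> z = 0")
  case True
  obtain h where h: "0 < h" "\<And>\<omega> l. cmod \<omega> = 1 \<Longrightarrow> \<Delta> \<omega> l = 0 \<Longrightarrow> \<bar>Im l\<bar> \<le> h"
    by (rule zeros_confined) blast
  have "\<Delta> \<omega> (\<i> * of_real (h + 1)) \<noteq> 0"
    using h(2)[OF \<omega>, of "\<i> * of_real (h + 1)"] h(1) by auto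
  then have "\<not> \<Delta> \<omega> constant_on UNIV"
    using True unfolding constant_on_def by (metis UNIV_I)
  then show ?thesis
    by (intro holomorphic_compact_finite_zeros[OF \<Delta>_holomorphic]) auto
qed auto

text \<open>For one \<omega> some radius avoids the finitely many moduli of zeros, and the bound on
  that circle persists for nearby \<omega>. Compactness of the unit circle makes \<epsilon> uniform,
  while the radius may change with \<omega>.\<close>

lemma uniform_circle:
  assumes M: "0 < M"
  obtains \<epsilon> where "0 < \<epsilon>" "\<And>\<omega>. cmod \<omega> = 1 \<Longrightarrow>
    \<exists>R. M < R \<and> R < M + 1 \<and> (\<forall>z. cmod z = R \<longrightarrow> \<epsilon> \<le> cmod (\<Delta> \<omega> z))"
proof -
  define S where "S = sphere (0::complex) 1"
  obtain K where K: "0 \<le> K" "\<And>l. \<bar>Im l\<bar> \<le> M + 1 \<Longrightarrow> cmod (T l) \<le> K"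
    by (rule T_bound[of "M + 1"]) blast
  have ex: "\<exists>R \<epsilon>. M < R \<and> R < M + 1 \<and> 0 < \<epsilon> \<and> (\<forall>z. cmod z = R \<longrightarrow> \<epsilon> \<le> cmod (\<Delta> \<omega> z))"
    if \<omega>: "\<omega> \<in> S" for \<omega>
  proof -
    have \<omega>': "cmod \<omega> = 1" using \<omega> by (simp add: S_def)
    have "infinite ({M<..<M+1} - cmod ` {z \<in> cball 0 (M + 1). \<Delta> \<omega> z = 0})"
      using finite_zeros[OF \<omega>'] by (intro Diff_infinite_finite) (auto simp: infinite_Ioo)
    then have "{M<..<M+1} - cmod ` {z \<in> cball 0 (M + 1). \<Delta> \<omega> z = 0} \<noteq> {}"
      by (rule infinite_imp_nonempty)
    then obtain R where R: "R \<in> {M<..<M+1} - cmod ` {z \<in> cball 0 (M + 1). \<Delta> \<omega> z = 0}"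
      by blast
    have cont: "continuous_on (sphere 0 R) (\<lambda>z. cmod (\<Delta> \<omega> z))"
      using holomorphic_on_imp_continuous_on[OF \<Delta>_holomorphic, of \<omega>]
      by (intro continuous_on_norm) (auto intro: continuous_on_subset)
    have "of_real R \<in> sphere (0::complex) R" using R M by auto
    then obtain z0 where z0: "z0 \<in> sphere 0 R" "\<And>z. z \<in> sphere 0 R \<Longrightarrow> cmod (\<Delta> \<omega> z0) \<le> cmod (\<Delta> \<omega> z)"
      using continuous_attains_inf[OF _ _ cont] by (metis compact_sphere empty_iff)
    have "\<Delta> \<omega> z0 \<noteq> 0" using R z0(1) by force
    then show ?thesis
      using R z0 by (intro exI[of _ R] exI[of _ "cmod (\<Delta> \<omega> z0)"]) auto
  qed
  then obtain Rad eps where Re: "\<And>\<omega>. \<omega> \<in> S \<Longrightarrow> M < Rad \<omega> \<and> Rad \<omega> < M + 1 \<and> 0 < eps \<omega> \<and>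
      (\<forall>z. cmod z = Rad \<omega> \<longrightarrow> eps \<omega> \<le> cmod (\<Delta> \<omega> z))"
    by metis
  \<comment> \<open>Replacing one \<omega> by another changes \<Delta> by at most
    \<open>2 + K\<close> times their distance on the relevant circle; within \<rho> at most half of
    \<open>eps\<close> is lost.\<close>
  define \<rho> where "\<rho> \<omega> = eps \<omega> / (2 * (2 + K))" for \<omega>
  have \<rho>: "0 < \<rho> \<omega>" if "\<omega> \<in> S" for \<omega> using Re[OF that] K(1) by (simp add: \<rho>_def)
  have compact_S: "compact S" by (simp add: S_def)
  have cover: "S \<subseteq> (\<Union>\<omega>\<in>S. ball \<omega> (\<rho> \<omega>))" using \<rho> by auto
  obtain P where P: "P \<subseteq> S" "finite P" "S \<subseteq> (\<Union>\<omega>\<in>P. ball \<omega> (\<rho> \<omega>))"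
    by (rule compactE_image[OF compact_S _ cover]) (simp, blast)
  have "1 \<in> S" by (simp add: S_def)
  then have P0: "P \<noteq> {}" using P(3) by auto
  define \<epsilon> where "\<epsilon> = Min (eps ` P) / 2"
  have \<epsilon>: "0 < \<epsilon>" "\<And>\<omega>. \<omega> \<in> P \<Longrightarrow> \<epsilon> \<le> eps \<omega> / 2"
    using P P0 Re by (auto simp: \<epsilon>_def subset_iff)
  show ?thesis
  proof (rule that[OF \<epsilon>(1)])
    fix \<omega> assume \<omega>: "cmod \<omega> = 1"
    then obtain \<nu> where \<nu>: "\<nu> \<in> P" "\<omega> \<in> ball \<nu> (\<rho> \<nu>)" using P(3) by (auto simp: S_def)
    have \<nu>S: "\<nu> \<in> S" "cmod \<nu> = 1" using \<nu> P(1) by (auto simp: S_def)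
    have "\<epsilon> \<le> cmod (\<Delta> \<omega> z)" if z: "cmod z = Rad \<nu>" for z
    proof -
      have "\<bar>Im z\<bar> \<le> M + 1" using abs_Im_le_cmod[of z] z Re[OF \<nu>S(1)] by linarith
      then have Tz: "cmod (T z) \<le> K" by (rule K(2))
      have "\<Delta> \<nu> z - \<Delta> \<omega> z = (\<nu> - \<omega>) * (\<nu> + \<omega> - T z)"
        by (simp add: \<Delta>_def power2_eq_square algebra_simps)
      moreover have "cmod (\<nu> + \<omega> - T z) \<le> 2 + K"
        using norm_triangle_ineq4[of "\<nu> + \<omega>" "T z"] norm_triangle_ineq[of \<nu> \<omega>] \<nu>S \<omega> Tz by linarith
      ultimately have "cmod (\<Delta> \<nu> z - \<Delta> \<omega> z) \<le> \<rho> \<nu> * (2 + K)"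
        using \<nu>(2) \<rho>[OF \<nu>S(1)] by (auto simp: norm_mult dist_norm intro!: mult_mono)
      also have "\<dots> = eps \<nu> / 2" using K(1) by (simp add: \<rho>_def field_simps)
      finally have "cmod (\<Delta> \<nu> z - \<Delta> \<omega> z) \<le> eps \<nu> / 2" .
      moreover have "eps \<nu> \<le> cmod (\<Delta> \<nu> z)" using Re[OF \<nu>S(1)] z by auto
      ultimately show ?thesis
        using norm_triangle_ineq2[of "\<Delta> \<nu> z" "\<Delta> \<omega> z"] \<epsilon>(2)[OF \<nu>(1)]
          norm_triangle_ineq4[of "\<Delta> \<nu> z" "\<Delta> \<nu> z - \<Delta> \<omega> z"] by simp
    qed
    then show "\<exists>R. M < R \<and> R < M + 1 \<and> (\<forall>z. cmod z = R \<longrightarrow> \<epsilon> \<le> cmod (\<Delta> \<omega> z))"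
      using Re[OF \<nu>S(1)] by (intro exI[of _ "Rad \<nu>"]) auto
  qed
qed

end

section \<open>Residues of the resolvent\<close>

text \<open>Just enough joint regularity in the spectral parameter and in \<open>x\<close> to be
  stable under sums, products and indefinite integration in \<open>x\<close>, with entire dependence
  on the parameter.\<close>

definition entire_family :: "(complex \<Rightarrow> real \<Rightarrow> complex) \<Rightarrow> bool" where
  "entire_family F \<longleftrightarrow> (\<forall>l. continuous_on {0..pi} (F l)) \<and> (\<forall>x\<in>{0..pi}. (\<lambda>l. F l x) holomorphic_on
      UNIV) \<and>
     (\<forall>r. \<exists>K\<ge>0. \<forall>l x. cmod l \<le> r \<longrightarrow> x \<in> {0..pi} \<longrightarrow> cmod (F l x) \<le> K)"

lemma entire_family_exp: "entire_family (\<lambda>l x. exp (\<i> * (\<sigma> * l) * of_real x))" if "cmod \<sigma> = 1"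
proof -
  have "cmod (exp (\<i> * (\<sigma> * l) * of_real x)) \<le> exp (r * pi)" if "cmod l \<le> r" "x \<in> {0..pi}" for l x r
  proof (rule norm_exp_ii_le[OF that(2)])
    show "\<bar>Im (\<sigma> * l)\<bar> \<le> r"
      using abs_Im_le_cmod[of "\<sigma> * l"] \<open>cmod l \<le> r\<close> \<open>cmod \<sigma> = 1\<close> by (simp add: norm_mult)
  qed
  then show ?thesis
    unfolding entire_family_def by (intro conjI allI ballI holomorphic_intros continuous_intros)
        (meson exp_ge_zero)
qed

lemma entire_family_mult:
  assumes F: "entire_family F" and G: "entire_family G"
  shows "entire_family (\<lambda>l x. F l x * G l x)"
  unfolding entire_family_def
proof (intro conjI allI ballI)
  show "continuous_on {0..pi} (\<lambda>x. F l x * G l x)" for l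
    using assms by (intro continuous_intros) (auto simp: entire_family_def)
  show "(\<lambda>l. F l x * G l x) holomorphic_on UNIV" if "x \<in> {0..pi}" for x
    using assms that by (intro holomorphic_intros) (auto simp: entire_family_def)
  fix r
  obtain K1 where K1: "0 \<le> K1" "\<And>l x. cmod l \<le> r \<Longrightarrow> x \<in> {0..pi} \<Longrightarrow> cmod (F l x) \<le> K1"
    using F unfolding entire_family_def by meson
  obtain K2 where K2: "0 \<le> K2" "\<And>l x. cmod l \<le> r \<Longrightarrow> x \<in> {0..pi} \<Longrightarrow> cmod (G l x) \<le> K2"
    using G unfolding entire_family_def by meson
  have "cmod (F l x * G l x) \<le> K1 * K2" if "cmod l \<le> r" "x \<in> {0..pi}" for l x
    unfolding norm_mult using K1 K2 that by (intro mult_mono) auto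
  then show "\<exists>K\<ge>0. \<forall>l x. cmod l \<le> r \<longrightarrow> x \<in> {0..pi} \<longrightarrow> cmod (F l x * G l x) \<le> K"
    using K1(1) K2(1) by (intro exI[of _ "K1 * K2"]) auto
qed

lemma entire_family_add:
  assumes F: "entire_family F" and G: "entire_family G"
  shows "entire_family (\<lambda>l x. F l x + G l x)"
  unfolding entire_family_def
proof (intro conjI allI ballI)
  show "continuous_on {0..pi} (\<lambda>x. F l x + G l x)" for l
    using assms by (intro continuous_intros) (auto simp: entire_family_def)
  show "(\<lambda>l. F l x + G l x) holomorphic_on UNIV" if "x \<in> {0..pi}" for x
    using assms that by (intro holomorphic_intros) (auto simp: entire_family_def)
  fix r
  obtain K1 where K1: "0 \<le> K1" "\<And>l x. cmod l \<le> r \<Longrightarrow> x \<in> {0..pi} \<Longrightarrow> cmod (F l x) \<le> K1"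
    using F unfolding entire_family_def by meson
  obtain K2 where K2: "0 \<le> K2" "\<And>l x. cmod l \<le> r \<Longrightarrow> x \<in> {0..pi} \<Longrightarrow> cmod (G l x) \<le> K2"
    using G unfolding entire_family_def by meson
  have "cmod (F l x + G l x) \<le> K1 + K2" if "cmod l \<le> r" "x \<in> {0..pi}" for l x
    using K1 K2 that by (intro norm_triangle_mono) auto
  then show "\<exists>K\<ge>0. \<forall>l x. cmod l \<le> r \<longrightarrow> x \<in> {0..pi} \<longrightarrow> cmod (F l x + G l x) \<le> K"
    using K1(1) K2(1) by (intro exI[of _ "K1 + K2"]) auto
qed

lemma entire_family_uminus:
  assumes "entire_family F"
  shows "entire_family (\<lambda>l x. - F l x)"
  using assms unfolding entire_family_def by (auto intro!: continuous_intros holomorphic_intros)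

lemma entire_family_diff: "entire_family F \<Longrightarrow> entire_family G \<Longrightarrow> entire_family (\<lambda>l x. F l x - G l x)"
  using entire_family_add[of F "\<lambda>l x. - G l x"] by (simp add: entire_family_uminus)

lemma entire_family_absolutely_integrable:
  assumes F: "entire_family F" and w: "w absolutely_integrable_on {0..pi}"
  shows "(\<lambda>s. F l s * w s) absolutely_integrable_on {0..pi}"
  using F by (intro absolutely_integrable_continuous_mult w) (auto simp: entire_family_def)

lemma entire_family_integral:
  assumes F: "entire_family F" and w: "w absolutely_integrable_on {0..pi}"
  shows "entire_family (\<lambda>l x. integral {0..x} (\<lambda>s. F l s * w s))"
proof -
  note ai = entire_family_absolutely_integrable[OF F w]
  have wn: "(\<lambda>s. cmod (w s)) integrable_on {0..pi}" using w
      by (simp add: absolutely_integrable_on_def)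
  have bound: "\<exists>K\<ge>0. \<forall>l x. cmod l \<le> r \<longrightarrow> x \<in> {0..pi} \<longrightarrow> cmod (F l x) \<le> K" for r
    using F by (simp add: entire_family_def)
  show ?thesis
    unfolding entire_family_def
  proof (intro conjI allI ballI)
    show "continuous_on {0..pi} (\<lambda>x. integral {0..x} (\<lambda>s. F l s * w s))" for l
      using ac_on_continuous[OF ac_on_integral[OF ai, of 0 l]] by simp
    show "(\<lambda>l. integral {0..x} (\<lambda>s. F l s * w s)) holomorphic_on UNIV" if x: "x \<in> {0..pi}" for x
    proof (rule holomorphic_integral)
      show "(\<lambda>s. F l s * w s) integrable_on {0..x}" for l
        using ai x by (rule integrable_on_initial)
      show "(\<lambda>l. F l s * w s) holomorphic_on UNIV" if "s \<in> {0..x}" for s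
        using F that x by (intro holomorphic_intros) (auto simp: entire_family_def)
      fix r
      obtain K where K: "0 \<le> K" "\<And>l x. cmod l \<le> r \<Longrightarrow> x \<in> {0..pi} \<Longrightarrow> cmod (F l x) \<le> K"
        using bound[of r] by blast
      have "(\<lambda>s. K * cmod (w s)) integrable_on {0..x}"
        using x by (intro integrable_on_mult_right integrable_subinterval_real[OF wn]) auto
      then show "\<exists>g. g integrable_on {0..x} \<and> (\<forall>s\<in>{0..x}. \<forall>z. cmod z \<le> r \<longrightarrow> cmod (F z s * w s)
          \<le> g s)"
        using K x by (intro exI[of _ "\<lambda>s. K * cmod (w s)"]) (auto simp: norm_mult intro!:
            mult_right_mono)
    qed
    fix r
    obtain K where K: "0 \<le> K" "\<And>l x. cmod l \<le> r \<Longrightarrow> x \<in> {0..pi} \<Longrightarrow> cmod (F l x) \<le> K"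
      using bound[of r] by blast
    define I where "I = integral {0..pi} (\<lambda>s. K * cmod (w s))"
    have "cmod (integral {0..x} (\<lambda>s. F l s * w s)) \<le> I" if "cmod l \<le> r" "x \<in> {0..pi}" for l x
    proof -
      have "cmod (integral {0..x} (\<lambda>s. F l s * w s)) \<le> integral {0..x} (\<lambda>s. K * cmod (w s))"
        using that K by (intro integral_norm_bound_integral integrable_on_initial[OF ai]
            integrable_on_mult_right integrable_subinterval_real[OF wn])
          (auto simp: norm_mult intro!: mult_right_mono)
      also have "\<dots> \<le> I"
        unfolding I_def using that K(1)
        by (intro integral_subset_le integrable_on_mult_right integrable_subinterval_real[OF wn])
            auto
      finally show ?thesis .
    qed
    moreover have "0 \<le> I"
      unfolding I_def using K(1) wn
      by (intro Henstock_Kurzweil_Integration.integral_nonneg integrable_on_mult_right) auto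
    ultimately show "\<exists>K\<ge>0. \<forall>l x. cmod l \<le> r \<longrightarrow> x \<in> {0..pi}
        \<longrightarrow> cmod (integral {0..x} (\<lambda>s. F l s * w s)) \<le> K"
      by blast
  qed
qed

lemma entire_family_holomorphic: "entire_family F \<Longrightarrow> x \<in> {0..pi} \<Longrightarrow> (\<lambda>l. F l x) holomorphic_on UNIV"
  by (simp add: entire_family_def)

text \<open>A Fourier coefficient of \<open>w\<close> at the frequency \<open>\<sigma> * l\<close>,
  perturbed by the factor \<open>Z\<close>; the sign \<sigma> selects one of the two exponentials of
  the free system.\<close>

definition pairing :: "complex \<Rightarrow> (complex \<Rightarrow> real \<Rightarrow> complex) \<Rightarrow> (real \<Rightarrow> complex) \<Rightarrow> complex \<Rightarrow> complex"
    where
  "pairing \<sigma> Z w l = integral {0..pi} (\<lambda>x. exp (\<i> * (\<sigma> * l) * of_real x) * Z l x * w x)"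

lemma pairing_holomorphic:
  assumes "cmod \<sigma> = 1" "entire_family Z" "w absolutely_integrable_on {0..pi}"
  shows "pairing \<sigma> Z w holomorphic_on UNIV"
  unfolding pairing_def[abs_def]
  using entire_family_holomorphic[OF entire_family_integral[OF entire_family_mult[OF
      entire_family_exp[OF assms(1)] assms(2)] assms(3)], of pi]
  by simp

lemma pairing_bound:
  assumes \<sigma>: "cmod \<sigma> = 1" and Z: "continuous_on {0..pi} (Z l)" "\<And>x. x \<in> {0..pi} \<Longrightarrow> cmod (Z l x) \<le> K"
    and w: "sq_integrable w" and l: "cmod l \<le> r"
  shows "(cmod (pairing \<sigma> Z w l))\<^sup>2 \<le> (exp (r * pi) * K)\<^sup>2 * pi * sq_norm w"
proof -
  have w_ai: "w absolutely_integrable_on {0..pi}" by (rule sq_integrable_absolutely_integrable[OF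
      w])
  have wn: "(\<lambda>x. cmod (w x)) integrable_on {0..pi}" using w_ai
      by (simp add: absolutely_integrable_on_def)
  have Im: "\<bar>Im (\<sigma> * l)\<bar> \<le> r"
    using abs_Im_le_cmod[of "\<sigma> * l"] l \<sigma> by (simp add: norm_mult)
  have "cmod (pairing \<sigma> Z w l) \<le> integral {0..pi} (\<lambda>x. exp (r * pi) * K * cmod (w x))"
    unfolding pairing_def
  proof (rule integral_norm_bound_integral)
    show "(\<lambda>x. exp (\<i> * (\<sigma> * l) * of_real x) * Z l x * w x) integrable_on {0..pi}"
      by (intro set_lebesgue_integral_eq_integral(1) absolutely_integrable_continuous_mult w_ai
          continuous_intros Z(1))
    show "(\<lambda>x. exp (r * pi) * K * cmod (w x)) integrable_on {0..pi}"
      using wn by (rule integrable_on_mult_right)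
    show "cmod (exp (\<i> * (\<sigma> * l) * of_real x) * Z l x * w x) \<le> exp (r * pi) * K * cmod (w x)"
        if "x \<in> {0..pi}" for x
      unfolding norm_mult using norm_exp_ii_le[OF that Im] Z(2)[OF that]
      by (intro mult_right_mono mult_mono) auto
  qed
  then have "(cmod (pairing \<sigma> Z w l))\<^sup>2 \<le> (exp (r * pi) * K * integral {0..pi} (\<lambda>x. cmod (w x)))\<^sup>2"
    by (intro power_mono) auto
  also have "\<dots> \<le> (exp (r * pi) * K)\<^sup>2 * (pi * sq_norm w)"
    unfolding power_mult_distrib[of _ "integral _ _"] by (intro mult_left_mono l1_le_l2[OF w]) auto
  finally show ?thesis by (simp add: mult.assoc)
qed

lemma residue_divide_simple_zero:
  assumes N: "N holomorphic_on UNIV" and g: "g holomorphic_on UNIV" and g0: "g p = 0"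
    and g': "deriv g p \<noteq> 0" and S: "open S" "p \<in> S" "\<And>z. z \<in> S - {p} \<Longrightarrow> g z \<noteq> 0"
  shows "residue (\<lambda>z. N z / g z) p = N p / deriv g p"
proof (rule residue_simple'[OF S(1,2)])
  show "(\<lambda>z. N z / g z) holomorphic_on S - {p}"
    using N g S(3) by (intro holomorphic_on_divide) (auto intro: holomorphic_on_subset)
  have "((\<lambda>w. (g w - g p) / (w - p)) \<longlongrightarrow> deriv g p) (at p)"
    using entire_has_derivative[OF g, of p UNIV] by (simp add: has_field_derivative_iff)
  moreover have "(N \<longlongrightarrow> N p) (at p)"
    using holomorphic_on_imp_continuous_on[OF N] by (auto simp: continuous_on_def)
  ultimately have "((\<lambda>w. N w / ((g w - g p) / (w - p))) \<longlongrightarrow> N p / deriv g p) (at p)"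
    using g' by (intro tendsto_divide)
  then show "((\<lambda>w. N w / g w * (w - p)) \<longlongrightarrow> N p / deriv g p) (at p)"
    by (simp add: g0)
qed

lemma square_sum4: "(a + b + c + d)\<^sup>2 \<le> 4 * (a\<^sup>2 + b\<^sup>2 + c\<^sup>2 + d\<^sup>2)" for a b c d :: real
  using zero_le_power2[of "a - b"] zero_le_power2[of "a - c"] zero_le_power2[of "a - d"]
    zero_le_power2[of "b - c"] zero_le_power2[of "b - d"] zero_le_power2[of "c - d"]
  by (simp add: power2_eq_square algebra_simps)

section \<open>The numerator of the tested resolvent and its bounds\<close>

context dirac_system begin

lemma Z_entire_family: "entire_family Z11" "entire_family Z12" "entire_family Z21" "entire_family
    Z22"
proof -
  have "\<exists>K\<ge>0. \<forall>l x. cmod l \<le> r \<longrightarrow> x \<in> {0..pi} \<longrightarrow>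
      cmod (Z11 l x) \<le> K \<and> cmod (Z12 l x) \<le> K \<and> cmod (Z21 l x) \<le> K \<and> cmod (Z22 l x) \<le> K" for r
    by (rule Z_bound[of r]) (meson abs_Im_le_cmod order_trans)
  then show "entire_family Z11" "entire_family Z12" "entire_family Z21" "entire_family Z22"
    unfolding entire_family_def using Z_continuous Z_holomorphic by meson+
qed

text \<open>\<open>A1\<close> and \<open>A2\<close> pair the two columns of the fundamental matrix
  with the test functions. \<open>G1\<close> and \<open>G2\<close> are the entries of the integral
  over the whole interval of its inverse, which is the adjugate, applied to the forcing.\<close>

definition "A1 v1 v2 l = pairing (-1) Z11 v1 l + pairing 1 Z21 v2 l"
definition "A2 v1 v2 l = pairing (-1) Z12 v1 l + pairing 1 Z22 v2 l"
definition "G1 g1 g2 l = pairing 1 Z22 g1 l - pairing (-1) Z12 g2 l"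
definition "G2 g1 g2 l = pairing (-1) Z11 g2 l - pairing 1 Z21 g1 l"

text \<open>\<open>\<Delta>\<close> times the boundary values \<open>\<zeta>(0)\<close> is \<open>(\<omega> Y - D) G\<close> with the monodromy matrix
  \<open>Y = diag(m1, m2) Z(\<pi>)\<close>; pairing with the fundamental solution gives \<open>N\<close>.\<close>
definition "N \<omega> v1 v2 g1 g2 l =
  A1 v1 v2 l * (\<omega> * m1 l * (Z11 l pi * G1 g1 g2 l + Z12 l pi * G2 g1 g2 l) - D * G1 g1 g2 l) +
  A2 v1 v2 l * (\<omega> * m2 l * (Z21 l pi * G1 g1 g2 l + Z22 l pi * G2 g1 g2 l) - D * G2 g1 g2 l)"

lemma N_holomorphic:
  assumes "sq_integrable v1" "sq_integrable v2" "sq_integrable g1" "sq_integrable g2"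
  shows "N \<omega> v1 v2 g1 g2 holomorphic_on UNIV"
proof -
  note ai = assms[THEN sq_integrable_absolutely_integrable]
  have "pairing \<sigma> Z w holomorphic_on UNIV" if "\<sigma> = 1 \<or> \<sigma>
      = -1" "Z \<in> {Z11, Z12, Z21, Z22}" "w \<in> {v1, v2, g1, g2}" for \<sigma> Z w
    using that ai Z_entire_family by (intro pairing_holomorphic) auto
  then show ?thesis
    unfolding N_def[abs_def] A1_def A2_def G1_def G2_def
    by (intro holomorphic_intros m_holomorphic Z_holomorphic) auto
qed

text \<open>The elementary coefficients are kept apart instead of being combined into
  \<open>A1\<close>, \<open>A2\<close>, \<open>G1\<close>, \<open>G2\<close>, because the sampling
  bound treats one coefficient at a time.\<close>

definition "vsum v1 v2 l = cmod (pairing (-1) Z11 v1 l) + cmod (pairing 1 Z21 v2 l) +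
  cmod (pairing (-1) Z12 v1 l) + cmod (pairing 1 Z22 v2 l)"
definition "gsum g1 g2 l = cmod (pairing 1 Z22 g1 l) + cmod (pairing (-1) Z12 g2 l) +
  cmod (pairing 1 Z21 g1 l) + cmod (pairing (-1) Z11 g2 l)"

text \<open>\<open>N\<close> is bilinear in the coefficients of the test functions and those of the
  forcing, with factors that are bounded on strips. The product form prepares Cauchy-Schwarz over
  the eigenvalues.\<close>

lemma N_pointwise_bound:
  obtains C where "0 \<le> C" "\<And>\<omega> l v1 v2 g1 g2. cmod \<omega> = 1 \<Longrightarrow> \<bar>Im l\<bar> \<le> h \<Longrightarrow>
    cmod (N \<omega> v1 v2 g1 g2 l) \<le> C * (vsum v1 v2 l * gsum g1 g2 l)"
proof -
  obtain K1 where K1: "0 \<le> K1" "\<And>l x. \<bar>Im l\<bar> \<le> h \<Longrightarrow> x \<in> {0..pi} \<Longrightarrow>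
    cmod (Z11 l x) \<le> K1 \<and> cmod (Z12 l x) \<le> K1 \<and> cmod (Z21 l x) \<le> K1 \<and> cmod (Z22 l x) \<le> K1"
    by (rule Z_bound[of h]) blast
  obtain K2 where K2: "0 \<le> K2" "\<And>l. \<bar>Im l\<bar> \<le> h \<Longrightarrow> cmod (m1 l) \<le> K2 \<and> cmod (m2 l) \<le> K2"
    by (rule m_bound[of h]) blast
  define C where "C = K2 * K1 + cmod D"
  have C: "0 \<le> C" using K1(1) K2(1) by (simp add: C_def)
  have comb: "cmod (\<omega> * m * (z * G + z' * G') - D * G'') \<le> C * (cmod G + cmod G')"
    if "cmod \<omega> = 1" "cmod m \<le> K2" "cmod z \<le> K1" "cmod z' \<le> K1" "cmod G'' \<le> cmod G + cmod G'"
        for \<omega> m z z' G G' G''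
  proof -
    have "cmod (\<omega> * m * (z * G + z' * G')) \<le> K2 * (K1 * cmod G + K1 * cmod G')"
      unfolding norm_mult \<open>cmod \<omega> = 1\<close> mult_1_left using that K1(1) K2(1)
      by (intro mult_mono norm_triangle_mono) (auto simp: norm_mult intro!: mult_mono)
    moreover have "cmod (D * G'') \<le> cmod D * (cmod G + cmod G')"
      unfolding norm_mult using that by (intro mult_left_mono) auto
    ultimately show ?thesis
      by (intro norm_triangle_ineq4[THEN order_trans]) (simp add: C_def algebra_simps)
  qed
  have "cmod (N \<omega> v1 v2 g1 g2 l) \<le> C * (vsum v1 v2 l * gsum g1 g2 l)"
    if \<omega>: "cmod \<omega> = 1" and l: "\<bar>Im l\<bar> \<le> h" for \<omega> l v1 v2 g1 g2
  proof -
    define a1 a2 y1 y2 where "a1 = A1 v1 v2 l" and "a2 = A2 v1 v2 l" and "y1 = G1 g1 g2 l" and "y2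
        = G2 g1 g2 l"
    note Z = K1(2)[OF l, of pi] and m = K2(2)[OF l]
    have "cmod (N \<omega> v1 v2 g1 g2 l) \<le> cmod a1 * (C * (cmod y1 + cmod y2)) + cmod a2 * (C * (cmod y1 +
        cmod y2))"
      unfolding N_def a1_def[symmetric] a2_def[symmetric] y1_def[symmetric] y2_def[symmetric]
      using Z m \<omega> by (intro norm_triangle_mono; unfold norm_mult[of a1] norm_mult[of a2]; intro
          mult_left_mono comb) auto
    also have "\<dots> = C * ((cmod a1 + cmod a2) * (cmod y1 + cmod y2))" by (simp add: algebra_simps)
    also have "\<dots> \<le> C * (vsum v1 v2 l * gsum g1 g2 l)"
    proof (intro mult_left_mono mult_mono C)
      show "cmod a1 + cmod a2 \<le> vsum v1 v2 l"
        unfolding vsum_def a1_def a2_def A1_def A2_def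
        using norm_triangle_ineq[of "pairing (-1) Z11 v1 l" "pairing 1 Z21 v2 l"]
          norm_triangle_ineq[of "pairing (-1) Z12 v1 l" "pairing 1 Z22 v2 l"] by linarith
      show "cmod y1 + cmod y2 \<le> gsum g1 g2 l"
        unfolding gsum_def y1_def y2_def G1_def G2_def
        using norm_triangle_ineq4[of "pairing 1 Z22 g1 l" "pairing (-1) Z12 g2 l"]
          norm_triangle_ineq4[of "pairing (-1) Z11 g2 l" "pairing 1 Z21 g1 l"] by linarith
    qed (auto simp: vsum_def)
    finally show ?thesis .
  qed
  then show ?thesis using that C by blast
qed

text \<open>A crude estimate of the individual coefficients by the L2 norm, meant for the circle
  around the small eigenvalues. Each test function occurs in two of the four coefficients, which
  gives the 8.\<close>

lemma N_disc_bound: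
  obtains C where "0 \<le> C" "\<And>\<omega> l v1 v2 g1 g2. cmod \<omega> = 1 \<Longrightarrow> cmod l \<le> r \<Longrightarrow>
    sq_integrable v1 \<Longrightarrow> sq_integrable v2 \<Longrightarrow> sq_integrable g1 \<Longrightarrow> sq_integrable g2 \<Longrightarrow>
    cmod (N \<omega> v1 v2 g1 g2 l) \<le> C * (pair_norm v1 v2 * pair_norm g1 g2)"
proof -
  obtain C1 where C1: "0 \<le> C1" "\<And>\<omega> l v1 v2 g1 g2. cmod \<omega> = 1 \<Longrightarrow> \<bar>Im l\<bar> \<le> r \<Longrightarrow>
    cmod (N \<omega> v1 v2 g1 g2 l) \<le> C1 * (vsum v1 v2 l * gsum g1 g2 l)"
    by (rule N_pointwise_bound[of r]) blast
  obtain K where K: "0 \<le> K" "\<And>l x. \<bar>Im l\<bar> \<le> r \<Longrightarrow> x \<in> {0..pi} \<Longrightarrow>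
    cmod (Z11 l x) \<le> K \<and> cmod (Z12 l x) \<le> K \<and> cmod (Z21 l x) \<le> K \<and> cmod (Z22 l x) \<le> K"
    by (rule Z_bound[of r]) blast
  define P where "P = (exp (r * pi) * K)\<^sup>2 * pi"
  have P: "0 \<le> P" by (simp add: P_def)
  have four: "a + b + c + d \<le> sqrt (8 * P) * sqrt (s + t)"
    if "a\<^sup>2 \<le> P * s" "b\<^sup>2 \<le> P * t" "c\<^sup>2 \<le> P * s" "d\<^sup>2 \<le> P * t" for a b c d s t :: real
  proof -
    have "(a + b + c + d)\<^sup>2 \<le> 4 * (a\<^sup>2 + b\<^sup>2 + c\<^sup>2 + d\<^sup>2)" by (rule square_sum4)
    also have "\<dots> \<le> 8 * P * (s + t)" using that by (simp add: algebra_simps)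
    finally have "a + b + c + d \<le> sqrt (8 * P * (s + t))" by (rule real_le_rsqrt)
    then show ?thesis by (simp only: real_sqrt_mult)
  qed
  have "cmod (N \<omega> v1 v2 g1 g2 l) \<le> C1 * (8 * P) * (pair_norm v1 v2 * pair_norm g1 g2)"
    if \<omega>: "cmod \<omega> = 1" and l: "cmod l \<le> r"
      and sq: "sq_integrable v1" "sq_integrable v2" "sq_integrable g1" "sq_integrable g2"
          for \<omega> l v1 v2 g1 g2
  proof -
    have Im: "\<bar>Im l\<bar> \<le> r" using abs_Im_le_cmod[of l] l by linarith
    have pb: "(cmod (pairing \<sigma> Z w l))\<^sup>2 \<le> P * sq_norm w"
      if "\<sigma> = 1 \<or> \<sigma> = -1" "Z \<in> {Z11, Z12, Z21, Z22}" "w \<in> {v1, v2, g1, g2}" for \<sigma> Z w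
      unfolding P_def using that sq K(2)[OF Im] Z_continuous[of l] l by (intro pairing_bound) auto
    have v: "vsum v1 v2 l \<le> sqrt (8 * P) * pair_norm v1 v2"
      unfolding vsum_def pair_norm_def by (intro four pb) auto
    have g: "gsum g1 g2 l \<le> sqrt (8 * P) * pair_norm g1 g2"
      unfolding gsum_def pair_norm_def by (intro four pb) auto
    have "cmod (N \<omega> v1 v2 g1 g2 l) \<le> C1 * ((sqrt (8 * P) * pair_norm v1 v2) * (sqrt (8 * P) *
        pair_norm g1 g2))"
      by (intro order_trans[OF C1(2)[OF \<omega> Im]] mult_left_mono mult_mono v g C1(1)) (auto simp: P
          vsum_def gsum_def pair_norm_nonneg)
    also have "\<dots> = C1 * (sqrt (8 * P) * sqrt (8 * P)) * (pair_norm v1 v2 * pair_norm g1 g2)"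
      by simp
    also have "sqrt (8 * P) * sqrt (8 * P) = 8 * P" using P by simp
    finally show ?thesis .
  qed
  then show ?thesis using that[of "C1 * (8 * P)"] C1(1) P by auto
qed

text \<open>Cauchy-Schwarz over \<Lambda> separates test functions from forcing, and each remaining
  sum of squares is a sampling sum.\<close>

lemma N_sampling_bound:
  obtains C where "0 \<le> C" "\<And>\<Lambda> \<omega> v1 v2 g1 g2. cmod \<omega> = 1 \<Longrightarrow> lattice_like B n \<Lambda> \<Longrightarrow>
    sq_integrable v1 \<Longrightarrow> sq_integrable v2 \<Longrightarrow> sq_integrable g1 \<Longrightarrow> sq_integrable g2 \<Longrightarrow>
    (\<Sum>l\<in>\<Lambda>. cmod (N \<omega> v1 v2 g1 g2 l)) \<le> C * (pair_norm v1 v2 * pair_norm g1 g2)"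
proof -
  obtain C1 where C1: "0 \<le> C1" "\<And>\<omega> l v1 v2 g1 g2. cmod \<omega> = 1 \<Longrightarrow> \<bar>Im l\<bar> \<le> B \<Longrightarrow>
    cmod (N \<omega> v1 v2 g1 g2 l) \<le> C1 * (vsum v1 v2 l * gsum g1 g2 l)"
    by (rule N_pointwise_bound[of B]) blast
  obtain C0 where C0: "0 \<le> C0" "\<And>l x. \<bar>Im l\<bar> \<le> B \<Longrightarrow> l \<noteq> 0 \<Longrightarrow> x \<in> {0..pi} \<Longrightarrow>
    cmod (Z11 l x - 1) \<le> C0 / cmod l \<and> cmod (Z12 l x) \<le> C0 / cmod l \<and>
    cmod (Z21 l x) \<le> C0 / cmod l \<and> cmod (Z22 l x - 1) \<le> C0 / cmod l"
    by (rule Z_asymptotics[of B]) blast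
  obtain P where P: "0 \<le> P" "\<And>\<Lambda> w \<theta> \<delta> \<sigma>. lattice_like B n \<Lambda> \<Longrightarrow> sq_integrable w \<Longrightarrow>
    (\<And>l. l \<in> \<Lambda> \<Longrightarrow> continuous_on {0..pi} (\<theta> l)) \<Longrightarrow>
    (\<And>l x. l \<in> \<Lambda> \<Longrightarrow> x \<in> {0..pi} \<Longrightarrow> cmod (\<theta> l x - \<delta>) \<le> C0 / cmod l) \<Longrightarrow> cmod \<delta> \<le> 1 \<Longrightarrow> \<sigma> = 1 \<or> \<sigma> = -1 \<Longrightarrow>
    (\<Sum>l\<in>\<Lambda>. (cmod (integral {0..pi} (\<lambda>x. exp (\<i> * (\<sigma> * l) * of_real x) * \<theta> l x * w x)))\<^sup>2)
        \<le> P * sq_norm w"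
    by (rule sampling_bound[where B = B and N = n and ?C0.0 = C0]) blast
  have four: "(\<Sum>l\<in>\<Lambda>. (a l + b l + c l + d l)\<^sup>2) \<le> 8 * P * (s + t)"
    if "(\<Sum>l\<in>\<Lambda>. (a l)\<^sup>2) \<le> P * s" "(\<Sum>l\<in>\<Lambda>. (b l)\<^sup>2) \<le> P * t" "(\<Sum>l\<in>\<Lambda>. (c l)\<^sup>2)
        \<le> P * s" "(\<Sum>l\<in>\<Lambda>. (d l)\<^sup>2) \<le> P * t"
    for a b c d :: "complex \<Rightarrow> real" and s t \<Lambda>
  proof -
    have "(\<Sum>l\<in>\<Lambda>. (a l + b l + c l + d l)\<^sup>2) \<le> (\<Sum>l\<in>\<Lambda>. 4 * ((a l)\<^sup>2 + (b l)\<^sup>2 + (c l)\<^sup>2 + (d l)\<^sup>2))"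
      by (intro sum_mono square_sum4)
    also have "\<dots> = 4 * ((\<Sum>l\<in>\<Lambda>. (a l)\<^sup>2) + (\<Sum>l\<in>\<Lambda>. (b l)\<^sup>2) + (\<Sum>l\<in>\<Lambda>. (c l)\<^sup>2) + (\<Sum>l\<in>\<Lambda>. (d l)\<^sup>2))"
      by (simp only: sum.distrib sum_distrib_left[symmetric])
    also have "\<dots> \<le> 8 * P * (s + t)" using that by (simp add: algebra_simps)
    finally show ?thesis .
  qed
  have "(\<Sum>l\<in>\<Lambda>. cmod (N \<omega> v1 v2 g1 g2 l)) \<le> C1 * (8 * P) * (pair_norm v1 v2 * pair_norm g1 g2)"
    if \<omega>: "cmod \<omega> = 1" and \<Lambda>: "lattice_like B n \<Lambda>"
      and sq: "sq_integrable v1" "sq_integrable v2" "sq_integrable g1" "sq_integrable g2"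
          for \<Lambda> \<omega> v1 v2 g1 g2
  proof -
    have Im: "\<bar>Im l\<bar> \<le> B" if "l \<in> \<Lambda>" for l by (rule lattice_like_Im[OF \<Lambda> that])
    have nz: "l \<noteq> 0" if "l \<in> \<Lambda>" for l using \<Lambda> that by (auto simp: lattice_like_def)
    have pb: "(\<Sum>l\<in>\<Lambda>. (cmod (pairing \<sigma> Z w l))\<^sup>2) \<le> P * sq_norm w"
      if "\<sigma> = 1 \<or> \<sigma> = -1" "Z \<in> {Z11, Z12, Z21, Z22}" "w \<in> {v1, v2, g1, g2}" for \<sigma> Z w
      unfolding pairing_def
    \<comment> \<open>The limit \<delta> is 1 for diagonal and 0 for off-diagonal entries. Here
      \<open>Z\<close> is known only as a function, so a function that is both counts as
      diagonal.\<close>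
    proof (rule P(2)[OF \<Lambda>, where \<delta> = "if Z \<in> {Z12, Z21} \<and> Z \<notin> {Z11, Z22} then 0 else 1"])
      show "cmod (Z l x - (if Z \<in> {Z12, Z21} \<and> Z \<notin> {Z11, Z22} then 0 else 1)) \<le> C0 / cmod l"
        if "l \<in> \<Lambda>" "x \<in> {0..pi}" for l x
        using C0(2)[OF Im[OF that(1)] nz[OF that(1)] that(2)] \<open>Z \<in> _\<close> by auto
      show "continuous_on {0..pi} (Z l)" for l using \<open>Z \<in> _\<close> Z_continuous by auto
    qed (use that sq in auto)
    define a where "a = vsum v1 v2"
    define b where "b = gsum g1 g2"
    have a: "(\<Sum>l\<in>\<Lambda>. (a l)\<^sup>2) \<le> 8 * P * (sq_norm v1 + sq_norm v2)"
      unfolding a_def vsum_def by (intro four pb) auto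
    have b: "(\<Sum>l\<in>\<Lambda>. (b l)\<^sup>2) \<le> 8 * P * (sq_norm g1 + sq_norm g2)"
      unfolding b_def gsum_def by (intro four pb) auto
    have "(\<Sum>l\<in>\<Lambda>. a l * b l)\<^sup>2 \<le> (\<Sum>l\<in>\<Lambda>. (a l)\<^sup>2) * (\<Sum>l\<in>\<Lambda>. (b l)\<^sup>2)"
      by (rule Cauchy_Schwarz_ineq_sum)
    also have "\<dots> \<le> (8 * P * (sq_norm v1 + sq_norm v2)) * (8 * P * (sq_norm g1 + sq_norm g2))"
      using P(1) by (intro mult_mono a b) (auto simp: sum_nonneg sq_norm_nonneg)
    finally have "(\<Sum>l\<in>\<Lambda>. a l * b l) \<le> sqrt ((8 * P * (sq_norm v1 + sq_norm v2)) * (8 * P * (sq_norm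
        g1 + sq_norm g2)))"
      by (rule real_le_rsqrt)
    also have "\<dots> = sqrt (8 * P) * sqrt (8 * P) * (pair_norm v1 v2 * pair_norm g1 g2)"
      by (simp only: real_sqrt_mult mult_ac pair_norm_def)
    also have "sqrt (8 * P) * sqrt (8 * P) = 8 * P" using P(1) by simp
    finally have ab: "(\<Sum>l\<in>\<Lambda>. a l * b l) \<le> 8 * P * (pair_norm v1 v2 * pair_norm g1 g2)" .
    have "(\<Sum>l\<in>\<Lambda>. cmod (N \<omega> v1 v2 g1 g2 l)) \<le> (\<Sum>l\<in>\<Lambda>. C1 * (a l * b l))"
      unfolding a_def b_def by (intro sum_mono C1(2)[OF \<omega> Im])
    also have "\<dots> = C1 * (\<Sum>l\<in>\<Lambda>. a l * b l)" by (simp add: sum_distrib_left)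
    also have "\<dots> \<le> C1 * (8 * P * (pair_norm v1 v2 * pair_norm g1 g2))"
      by (intro mult_left_mono ab C1(1))
    finally show ?thesis by (simp only: mult.assoc)
  qed
  then show ?thesis using that[of "C1 * (8 * P)"] C1(1) P(1) by auto
qed

end

lemma ac_on_exp_linear:
  assumes b: "damped_on pi f"
  shows "ac_on pi (\<lambda>x. exp (c * of_real x + s * integral {0..x} f))
    (\<lambda>x. (c + s * f x) * exp (c * of_real x + s * integral {0..x} f))"
proof -
  have d: "damped_on pi (\<lambda>x. of_real 1 * c + s * f x)"
    by (intro damped_on_add damped_on_cmult b) (use damped_on_cmult[OF damped_on_increasing[of pi
        "\<lambda>_. 1"], of c] in \<open>simp add: mult.commute\<close>)
  obtain B where "0 < B" "\<And>x. x \<in> {0..pi} \<Longrightarrow> cmod (of_real 1 * c + s * f x) \<le> B"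
    by (rule damped_onE[OF d]) blast
  then have B: "0 \<le> B" "bounded_integrable pi B (\<lambda>x. c + s * f x)"
    unfolding bounded_integrable_def using damped_on_absolutely_integrable[OF d] by auto
  have "integral {0..x} (\<lambda>x. c + s * f x) = c * of_real x + s * integral {0..x} f"
      if x: "x \<in> {0..pi}" for x
  proof -
    have "f integrable_on {0..x}"
      using damped_on_absolutely_integrable[OF b] x by (rule integrable_on_initial)
    then show ?thesis
      using x by (subst Henstock_Kurzweil_Integration.integral_add)
        (auto intro: integrable_on_mult_right simp: scaleR_conv_of_real)
  qed
  then show ?thesis
    by (intro ac_on_cong[OF ac_on_exp[OF B(2,1)]]) auto
qed

section \<open>Contour integrals of the singular part\<close>

context dirac_system begin

text \<open>A contour outside the disc of radius \<open>M\<close> winds around all its points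
  equally often. The residues inside the circle of radius \<open>R\<close> thus contribute a
  multiple, by at most 1 in modulus, of the integral over that circle; the others are simple poles
  summed by sampling.\<close>

lemma contour_bound:
  obtains M C where "0 < M" "0 \<le> C" "\<And>\<omega> \<gamma> v1 v2 g1 g2. cmod \<omega> = 1 \<Longrightarrow>
    \<gamma> \<in> closed_contours_in ({z. cmod z > M} \<inter> {z. \<Delta> \<omega> z \<noteq> 0}) \<Longrightarrow>
    sq_integrable v1 \<Longrightarrow> sq_integrable v2 \<Longrightarrow> sq_integrable g1 \<Longrightarrow> sq_integrable g2 \<Longrightarrow>
    cmod (contour_integral \<gamma> (\<lambda>l. N \<omega> v1 v2 g1 g2 l / \<Delta> \<omega> l))
      \<le> C * (pair_norm v1 v2 * pair_norm g1 g2)"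
proof -
  obtain M1 B n where M1: "2 \<le> M1" and lat: "\<And>\<omega> \<Lambda>. cmod \<omega> = 1 \<Longrightarrow> finite \<Lambda> \<Longrightarrow>
    (\<And>l. l \<in> \<Lambda> \<Longrightarrow> \<Delta> \<omega> l = 0 \<and> M1 \<le> cmod l) \<Longrightarrow> lattice_like B n \<Lambda>"
    by (rule zeros_lattice_like) blast
  obtain c M2 where c: "0 < c" "2 \<le> M2"
    "\<And>\<omega> l. cmod \<omega> = 1 \<Longrightarrow> \<Delta> \<omega> l = 0 \<Longrightarrow> M2 \<le> cmod l \<Longrightarrow> c \<le> cmod (deriv T l)"
    by (rule deriv_T_lower_bound) blast
  define M0 where "M0 = max M1 M2"
  have M0: "0 < M0" "M1 \<le> M0" "M2 \<le> M0" using M1 by (auto simp: M0_def)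
  obtain \<epsilon> where \<epsilon>: "0 < \<epsilon>" "\<And>\<omega>. cmod \<omega> = 1 \<Longrightarrow>
    \<exists>R. M0 < R \<and> R < M0 + 1 \<and> (\<forall>z. cmod z = R \<longrightarrow> \<epsilon> \<le> cmod (\<Delta> \<omega> z))"
    by (rule uniform_circle[OF M0(1)]) blast
  \<comment> \<open>The extra 1 makes room for the separating circle, whose radius lies strictly
    between \<open>M0\<close> and \<open>M\<close>.\<close>
  define M where "M = M0 + 1"
  obtain C1 where C1: "0 \<le> C1" "\<And>\<omega> l v1 v2 g1 g2. cmod \<omega> = 1 \<Longrightarrow> cmod l \<le> M \<Longrightarrow>
    sq_integrable v1 \<Longrightarrow> sq_integrable v2 \<Longrightarrow> sq_integrable g1 \<Longrightarrow> sq_integrable g2 \<Longrightarrow>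
    cmod (N \<omega> v1 v2 g1 g2 l) \<le> C1 * (pair_norm v1 v2 * pair_norm g1 g2)"
    by (rule N_disc_bound[of M]) blast
  obtain C2 where C2: "0 \<le> C2" "\<And>\<Lambda> \<omega> v1 v2 g1 g2. cmod \<omega> = 1 \<Longrightarrow> lattice_like B n \<Lambda> \<Longrightarrow>
    sq_integrable v1 \<Longrightarrow> sq_integrable v2 \<Longrightarrow> sq_integrable g1 \<Longrightarrow> sq_integrable g2 \<Longrightarrow>
    (\<Sum>l\<in>\<Lambda>. cmod (N \<omega> v1 v2 g1 g2 l)) \<le> C2 * (pair_norm v1 v2 * pair_norm g1 g2)"
    by (rule N_sampling_bound[where B = B and n = n]) blast
  define C where "C = C1 / \<epsilon> * (2 * pi * M) + 2 * pi * (C2 / c)"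
  have "cmod (contour_integral \<gamma> (\<lambda>l. N \<omega> v1 v2 g1 g2 l / \<Delta> \<omega> l))
      \<le> C * (pair_norm v1 v2 * pair_norm g1 g2)"
    if \<omega>: "cmod \<omega> = 1" and \<gamma>: "\<gamma> \<in> closed_contours_in ({z. cmod z > M} \<inter> {z. \<Delta> \<omega> z \<noteq> 0})"
      and sq: "sq_integrable v1" "sq_integrable v2" "sq_integrable g1" "sq_integrable g2"
    for \<omega> \<gamma> v1 v2 g1 g2
  proof -
    define X where "X = pair_norm v1 v2 * pair_norm g1 g2"
    have X: "0 \<le> X" by (simp add: X_def pair_norm_nonneg)
    define n' where "n' = N \<omega> v1 v2 g1 g2"
    define f where "f l = n' l / \<Delta> \<omega> l" for l
    have n'_holo: "n' holomorphic_on UNIV" unfolding n'_def by (rule N_holomorphic[OF sq])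
    have valid: "valid_path \<gamma>" and simple: "simple_path \<gamma>" and loop: "pathfinish \<gamma> = pathstart \<gamma>"
      and img: "\<And>z. z \<in> path_image \<gamma> \<Longrightarrow> M < cmod z" "\<And>z. z \<in> path_image \<gamma> \<Longrightarrow> \<Delta> \<omega> z \<noteq> 0"
      using \<gamma> by (auto simp: closed_contours_in_def)
    have path: "path \<gamma>" using valid by (rule valid_path_imp_path)
    obtain R where R: "M0 < R" "R < M" "\<And>z. cmod z = R \<Longrightarrow> \<epsilon> \<le> cmod (\<Delta> \<omega> z)"
      using \<epsilon>(2)[OF \<omega>] by (auto simp: M_def)
    have R0: "0 < R" using R M0 by simp
    obtain \<rho>0 where \<rho>0: "\<And>z. z \<in> path_image \<gamma> \<Longrightarrow> cmod z \<le> \<rho>0"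
      using bounded_path_image[OF path] unfolding bounded_iff by blast
    \<comment> \<open>Large enough for one ball to contain both the contour and the auxiliary
      circle, so that the residue theorem applies to both with the same poles.\<close>
    define \<rho> where "\<rho> = max \<rho>0 M + 1"
    define S where "S = ball (0::complex) \<rho>"
    define P where "P = {z \<in> cball 0 \<rho>. \<Delta> \<omega> z = 0}"
    have P: "finite P" unfolding P_def by (rule finite_zeros[OF \<omega>])
    have \<gamma>S: "path_image \<gamma> \<subseteq> S" using \<rho>0 by (force simp: S_def \<rho>_def)
    have f_holo: "f holomorphic_on S - P"
      unfolding f_def
      by (intro holomorphic_on_divide holomorphic_on_subset[OF n'_holo] holomorphic_on_subset[OF
          \<Delta>_holomorphic])
        (auto simp: S_def P_def)
    have res: "contour_integral g f = 2 * pi * \<i> * (\<Sum>p\<in>P. winding_number g p * residue f p)"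
      if "valid_path g" "pathfinish g = pathstart g" "path_image g \<subseteq> S - P" for g
    proof (rule Residue_theorem[OF _ _ P f_holo that])
      show "\<forall>z. z \<notin> S \<longrightarrow> winding_number g z = 0"
        using that by (auto intro!: winding_number_zero_outside[of g S] valid_path_imp_path simp:
            S_def)
    qed (auto simp: S_def)
    \<comment> \<open>The split is at \<open>R\<close>, not at \<open>M\<close>: zeros with modulus
      between them go to \<open>P2\<close>, where their modulus still exceeds \<open>M0\<close> and
      the derivative bound applies.\<close>
    define P1 where "P1 = {p\<in>P. cmod p < R}"
    define P2 where "P2 = {p\<in>P. R < cmod p}"
    have "cmod p \<noteq> R" if "p \<in> P" for p
      using R(3)[of p] \<epsilon>(1) that by (auto simp: P_def)
    then have "P = P1 \<union> P2" by (force simp: P1_def P2_def)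
    moreover have "P1 \<inter> P2 = {}" by (auto simp: P1_def P2_def)
    ultimately have P12: "P = P1 \<union> P2" "P1 \<inter> P2 = {}" "finite P1" "finite P2"
      using P by auto
    have circ_img: "path_image (circlepath 0 R) \<subseteq> S - P"
      using R R0 \<epsilon>(1) by (force simp: S_def P_def \<rho>_def)
    have "winding_number (circlepath 0 R) p = (if p \<in> P1 then 1 else 0)" if "p \<in> P" for p
    proof (cases "p \<in> P1")
      case True
      then show ?thesis by (simp add: P1_def winding_number_circlepath)
    next
      case False
      then have "p \<in> P2" using that P12(1) by blast
      then have "p \<notin> cball 0 R" by (simp add: P2_def)
      then have "winding_number (circlepath 0 R) p = 0"
        using R0 by (intro winding_number_zero_outside[of _ "cball 0 R"]) auto
      then show ?thesis using False by simp
    qed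
    then have "contour_integral (circlepath 0 R) f = 2 * pi * \<i> * (\<Sum>p\<in>P. (if p \<in> P1 then 1 else 0) *
        residue f p)"
      using res[OF _ _ circ_img] by simp
    also have "(\<Sum>p\<in>P. (if p \<in> P1 then 1 else 0) * residue f p) = (\<Sum>p\<in>P1. residue f p)"
      using P12 by (intro sum.mono_neutral_cong_right) auto
    finally have circ: "contour_integral (circlepath 0 R) f = 2 * pi * \<i> * (\<Sum>p\<in>P1. residue f p)" .
    have f_circ: "cmod (f z) \<le> C1 * X / \<epsilon>" if "cmod z = R" for z
      unfolding f_def norm_divide
    proof (rule frac_le)
      show "cmod (n' z) \<le> C1 * X"
        unfolding n'_def X_def using that R(2) by (intro C1(2)[OF \<omega> _ sq]) simp
    qed (use C1(1) X \<epsilon>(1) R(3)[OF that] in auto)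
    have "f contour_integrable_on circlepath 0 R"
      using circ_img P by (intro contour_integrable_holomorphic_simple[OF f_holo]) (auto simp: S_def
          intro: finite_imp_closed)
    then have "cmod (contour_integral (circlepath 0 R) f) \<le> C1 * X / \<epsilon> * (2 * pi * R)"
      using C1(1) X \<epsilon>(1) R0 f_circ
      by (intro has_contour_integral_bound_circlepath[OF has_contour_integral_integral]) auto
    also have "\<dots> \<le> C1 * X / \<epsilon> * (2 * pi * M)"
      using C1(1) X \<epsilon>(1) R by (intro mult_left_mono) auto
    finally have low: "cmod (2 * pi * \<i> * (\<Sum>p\<in>P1. residue f p)) \<le> C1 * X / \<epsilon> * (2 * pi * M)"
      unfolding circ .
    \<comment> \<open>Simplicity of the contour enters here: it bounds the winding numbers
      independently of the contour.\<close>
    have W: "winding_number \<gamma> p \<in> {-1, 0, 1}" if "p \<in> P" for p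
      using that img(2) by (intro simple_closed_path_winding_number_cases simple loop) (auto simp:
          P_def)
    \<comment> \<open>The closed disc of radius \<open>M\<close> is connected and misses the
      contour, so the winding number is constant on it.\<close>
    have inner: "winding_number \<gamma> p = winding_number \<gamma> 0" if "p \<in> P1" for p
    proof (rule winding_number_eq[OF path loop, where S = "cball 0 M"])
      show "cball 0 M \<inter> path_image \<gamma> = {}" using img(1) by force
    qed (use that R M0 in \<open>auto simp: P1_def M_def\<close>)
    have W0: "cmod (winding_number \<gamma> 0) \<le> 1"
    proof -
      have "0 \<notin> path_image \<gamma>" using img(1)[of 0] M0(1) by (auto simp: M_def)
      then show ?thesis using simple_closed_path_winding_number_cases[OF simple loop, of 0] by auto
    qed
    have residue_bound: "cmod (residue f p) \<le> cmod (n' p) / c" if "p \<in> P2" for p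
    proof -
      have p: "\<Delta> \<omega> p = 0" "M2 \<le> cmod p" using that R(1) M0 by (auto simp: P2_def P_def)
      have "((\<lambda>l. \<omega>\<^sup>2 - \<omega> * T l + D) has_field_derivative - (\<omega> * deriv T p)) (at p)"
        by (auto intro!: derivative_eq_intros entire_has_derivative[OF T_holomorphic])
      then have d: "deriv (\<Delta> \<omega>) p = - (\<omega> * deriv T p)"
        unfolding \<Delta>_def[abs_def] by (rule DERIV_imp_deriv)
      have c': "c \<le> cmod (deriv (\<Delta> \<omega>) p)" using c(3)[OF \<omega> p] \<omega> by (simp add: d norm_mult)
      \<comment> \<open>Removing the finitely many other zeros from a ball leaves an open
        neighbourhood in which \<open>p\<close> is the only zero.\<close>
      have "finite {z \<in> cball 0 (cmod p + 1). \<Delta> \<omega> z = 0}" by (rule finite_zeros[OF \<omega>])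
      then have "open (ball 0 (cmod p + 1) - ({z \<in> cball 0 (cmod p + 1). \<Delta> \<omega> z = 0} - {p}))"
        by (intro open_Diff finite_imp_closed) auto
      then have "residue f p = n' p / deriv (\<Delta> \<omega>) p"
        unfolding f_def using c' c(1) p(1)
        by (intro residue_divide_simple_zero[OF n'_holo \<Delta>_holomorphic]) (auto simp: dist_norm)
      then show ?thesis
        using c' c(1) by (auto simp: norm_divide intro!: divide_left_mono mult_pos_pos)
    qed
    have "lattice_like B n P2"
      using P12(4) R(1) M0 by (intro lat[OF \<omega>]) (auto simp: P2_def P_def)
    then have "(\<Sum>p\<in>P2. cmod (n' p)) \<le> C2 * X"
      unfolding n'_def X_def by (intro C2(2)[OF \<omega> _ sq])
    have "cmod (\<Sum>p\<in>P2. winding_number \<gamma> p * residue f p) \<le> (\<Sum>p\<in>P2. cmod (n' p) / c)"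
    proof (rule sum_norm_le)
      fix p assume p: "p \<in> P2"
      have "cmod (winding_number \<gamma> p) \<le> 1" using W[of p] p P12 by auto
      then have "cmod (winding_number \<gamma> p) * cmod (residue f p) \<le> 1 * (cmod (n' p) / c)"
        using residue_bound[OF p] by (intro mult_mono) auto
      then show "cmod (winding_number \<gamma> p * residue f p) \<le> cmod (n' p) / c" by (simp add: norm_mult)
    qed
    also have "\<dots> = (\<Sum>p\<in>P2. cmod (n' p)) / c" by (simp add: sum_divide_distrib)
    also have "\<dots> \<le> C2 * X / c" using \<open>(\<Sum>p\<in>P2. cmod (n' p)) \<le> C2 * X\<close> c(1)
        by (intro divide_right_mono) auto
    finally have high: "cmod (\<Sum>p\<in>P2. winding_number \<gamma> p * residue f p) \<le> C2 * X / c" .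
    have "contour_integral \<gamma> f = 2 * pi * \<i> * (\<Sum>p\<in>P. winding_number \<gamma> p * residue f p)"
      using \<gamma>S img(2) by (intro res valid loop) (auto simp: P_def)
    also have "(\<Sum>p\<in>P. winding_number \<gamma> p * residue f p)
        = (\<Sum>p\<in>P1. winding_number \<gamma> p * residue f p) + (\<Sum>p\<in>P2. winding_number \<gamma> p * residue f p)"
      unfolding P12(1) using P12 by (intro sum.union_disjoint) auto
    also have "(\<Sum>p\<in>P1. winding_number \<gamma> p * residue f p)
        = winding_number \<gamma> 0 * (\<Sum>p\<in>P1. residue f p)"
      by (simp add: inner sum_distrib_left)
    finally have eq: "contour_integral \<gamma> f = winding_number \<gamma> 0 * (2 * pi * \<i> * (\<Sum>p\<in>P1. residue f
        p))
        + 2 * pi * \<i> * (\<Sum>p\<in>P2. winding_number \<gamma> p * residue f p)"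
      by (simp add: algebra_simps)
    have "cmod (winding_number \<gamma> 0 * (2 * pi * \<i> * (\<Sum>p\<in>P1. residue f p)))
        \<le> 1 * (C1 * X / \<epsilon> * (2 * pi * M))"
      unfolding norm_mult[of "winding_number \<gamma> 0"] using W0 low by (intro mult_mono) auto
    moreover have "cmod (2 * pi * \<i> * (\<Sum>p\<in>P2. winding_number \<gamma> p * residue f p))
        \<le> 2 * pi * (C2 * X / c)"
      using mult_left_mono[OF high, of "2 * pi"] by (simp add: norm_mult)
    ultimately have "cmod (contour_integral \<gamma> f) \<le> 1 * (C1 * X / \<epsilon> * (2 * pi * M)) + 2 * pi * (C2 *
        X / c)"
      unfolding eq by (rule norm_triangle_mono)
    also have "\<dots> = C * X" by (simp add: C_def algebra_simps)
    finally show ?thesis by (simp add: f_def[abs_def] n'_def X_def)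
  qed
  moreover have "0 \<le> C" using C1(1) C2(1) \<epsilon>(1) c(1) M0(1) by (simp add: C_def M_def)
  ultimately show ?thesis using that[of M C] M0(1) by (auto simp: M_def)
qed

section \<open>Solving the quasi-periodic boundary value problem\<close>

definition "W1 g1 g2 l x = integral {0..x} (\<lambda>s. exp (\<i> * (1 * l) * of_real s) * Z22 l s * g1 s)
  - integral {0..x} (\<lambda>s. exp (\<i> * (-1 * l) * of_real s) * Z12 l s * g2 s)"
definition "W2 g1 g2 l x = integral {0..x} (\<lambda>s. exp (\<i> * (-1 * l) * of_real s) * Z11 l s * g2 s)
  - integral {0..x} (\<lambda>s. exp (\<i> * (1 * l) * of_real s) * Z21 l s * g1 s)"

text \<open>\<open>W1\<close> and \<open>W2\<close> are \<open>G1\<close> and \<open>G2\<close> with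
  a variable upper limit. \<open>Rest\<close> collects their contribution to the pairing; it
  contains no division by \<Delta> and is therefore entire.\<close>

definition "Rest v1 v2 g1 g2 l =
  pairing (-1) (\<lambda>l x. Z11 l x * W1 g1 g2 l x + Z12 l x * W2 g1 g2 l x) v1 l +
  pairing 1 (\<lambda>l x. Z21 l x * W1 g1 g2 l x + Z22 l x * W2 g1 g2 l x) v2 l"

lemma W_entire_family:
  assumes "g1 absolutely_integrable_on {0..pi}" "g2 absolutely_integrable_on {0..pi}"
  shows "entire_family (W1 g1 g2)" "entire_family (W2 g1 g2)"
  unfolding W1_def[abs_def] W2_def[abs_def]
  by (intro entire_family_diff entire_family_integral entire_family_mult entire_family_exp
      Z_entire_family assms; simp)+

lemma Rest_holomorphic:
  assumes "g1 absolutely_integrable_on {0..pi}" "g2 absolutely_integrable_on {0..pi}"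
    "v1 absolutely_integrable_on {0..pi}" "v2 absolutely_integrable_on {0..pi}"
  shows "Rest v1 v2 g1 g2 holomorphic_on UNIV"
  unfolding Rest_def[abs_def]
  by (intro holomorphic_intros pairing_holomorphic entire_family_add entire_family_mult
      Z_entire_family W_entire_family assms) auto

definition "g1 f x = exp (- \<beta>1 x) * f x"
definition "g2 f x = exp (- \<beta>2 x) * f x"

lemma \<beta>_continuous: "continuous_on {0..pi} \<beta>1" "continuous_on {0..pi} \<beta>2"
  unfolding \<beta>1_def[abs_def] \<beta>2_def[abs_def]
  using damped(1,4)[THEN damped_on_absolutely_integrable]
  by (auto intro!: indefinite_integral_continuous_1 simp: absolutely_integrable_on_def)

lemma g_absolutely_integrable:
  assumes "sq_integrable f"
  shows "g1 f absolutely_integrable_on {0..pi}" "g2 f absolutely_integrable_on {0..pi}"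
  unfolding g1_def[abs_def] g2_def[abs_def]
  by (intro absolutely_integrable_continuous_mult sq_integrable_absolutely_integrable assms
      continuous_intros \<beta>_continuous)+

context
  fixes f1 f2 z1 z2 :: "real \<Rightarrow> complex" and l \<omega> :: complex
  assumes f: "sq_integrable f1" "sq_integrable f2"
    and z1: "ac_on pi z1 (\<lambda>x. (- \<i> * l + b11 x) * z1 x + b12 x * z2 x + f1 x)"
    and z2: "ac_on pi z2 (\<lambda>x. b21 x * z1 x + (\<i> * l + b22 x) * z2 x + f2 x)"
    and bc: "z1 pi = \<omega> * z1 0" "z2 pi = \<omega> * z2 0"
begin

text \<open>Factoring out the diagonal part turns the system into the off-diagonal one with
  coefficients \<open>p\<close> and \<open>q\<close>; then \<open>variation_of_constants\<close>
  applies.\<close>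

lemma solution:
  assumes x: "x \<in> {0..pi}"
  shows "z1 x = exp (\<i> * (-1 * l) * of_real x) * exp (\<beta>1 x) *
      (Z11 l x * (z1 0 + W1 (g1 f1) (g2 f2) l x) + Z12 l x * (z2 0 + W2 (g1 f1) (g2 f2) l x))"
    and "z2 x = exp (\<i> * (1 * l) * of_real x) * exp (\<beta>2 x) *
      (Z21 l x * (z1 0 + W1 (g1 f1) (g2 f2) l x) + Z22 l x * (z2 0 + W2 (g1 f1) (g2 f2) l x))"
proof -
  obtain B where B: "0 \<le> B" and pq: "bounded_integrable pi B (p l)" "bounded_integrable pi B (q l)"
    by (rule pq_bounded_integrable_at)
  \<comment> \<open>Reciprocals of the solutions of the diagonal equations: their densities cancel
    the diagonal terms of \<open>z1\<close> and \<open>z2\<close>.\<close>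
  define e1 where "e1 x = exp (\<i> * l * of_real x + (-1) * \<beta>1 x)" for x
  define e2 where "e2 x = exp (- \<i> * l * of_real x + (-1) * \<beta>2 x)" for x
  define \<zeta>1 where "\<zeta>1 x = e1 x * z1 x" for x
  define \<zeta>2 where "\<zeta>2 x = e2 x * z2 x" for x
  define \<phi>1 where "\<phi>1 x = exp (\<i> * (1 * l) * of_real x) * g1 f1 x" for x
  define \<phi>2 where "\<phi>2 x = exp (\<i> * (-1 * l) * of_real x) * g2 f2 x" for x
  have e1: "ac_on pi e1 (\<lambda>x. (\<i> * l + (-1) * b11 x) * e1 x)"
    using ac_on_exp_linear[OF damped(1), of "\<i> * l" "-1"] by (simp add: e1_def[abs_def] \<beta>1_def)
  have e2: "ac_on pi e2 (\<lambda>x. (- \<i> * l + (-1) * b22 x) * e2 x)"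
    using ac_on_exp_linear[OF damped(4), of "- \<i> * l" "-1"] by (simp add: e2_def[abs_def] \<beta>2_def)
  have p: "p l x * e2 x = e1 x * b12 x" and q: "q l x * e1 x = e2 x * b21 x" for x
    by (auto simp: p_def q_def c12_def c21_def e1_def e2_def algebra_simps simp flip: exp_add)
  have \<phi>: "e1 x * f1 x = \<phi>1 x" "e2 x * f2 x = \<phi>2 x" for x
    by (auto simp: \<phi>1_def \<phi>2_def e1_def e2_def g1_def g2_def algebra_simps simp flip: exp_add)
  have \<zeta>1: "ac_on pi \<zeta>1 (\<lambda>x. p l x * \<zeta>2 x + \<phi>1 x)"
    by (rule ac_on_cong[OF ac_on_mult[OF e1 z1]])
      (auto simp: \<zeta>1_def \<zeta>2_def \<phi>[symmetric] p mult.assoc[symmetric], simp add: algebra_simps)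
  have \<zeta>2: "ac_on pi \<zeta>2 (\<lambda>x. q l x * \<zeta>1 x + \<phi>2 x)"
    by (rule ac_on_cong[OF ac_on_mult[OF e2 z2]])
      (auto simp: \<zeta>1_def \<zeta>2_def \<phi>[symmetric] q mult.assoc[symmetric], simp add: algebra_simps)
  have int: "(\<lambda>s. exp (\<i> * (\<sigma> * l) * of_real s) * Z l s * g s) integrable_on {0..x}"
    if "cmod \<sigma> = 1" "entire_family Z" "g absolutely_integrable_on {0..pi}" for \<sigma> Z g
    using entire_family_absolutely_integrable[OF entire_family_mult[OF entire_family_exp[OF that(1)]
        that(2)] that(3)] x
    by (rule integrable_on_initial)
  have w1: "integral {0..x} (\<lambda>s. vcosh (q l) (p l) s * \<phi>1 s - vsinh (p l) (q l) s * \<phi>2 s)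
      = W1 (g1 f1) (g2 f2) l x"
    unfolding W1_def
    by (subst Henstock_Kurzweil_Integration.integral_diff[symmetric]; (intro int Z_entire_family
        g_absolutely_integrable f)?)
      (auto simp: \<phi>1_def \<phi>2_def Z22_def Z12_def algebra_simps)
  have w2: "integral {0..x} (\<lambda>s. vcosh (p l) (q l) s * \<phi>2 s - vsinh (q l) (p l) s * \<phi>1 s)
      = W2 (g1 f1) (g2 f2) l x"
    unfolding W2_def
    by (subst Henstock_Kurzweil_Integration.integral_diff[symmetric]; (intro int Z_entire_family
        g_absolutely_integrable f)?)
      (auto simp: \<phi>1_def \<phi>2_def Z11_def Z21_def algebra_simps)
  have z0: "\<zeta>1 0 = z1 0" "\<zeta>2 0 = z2 0"
    by (auto simp: \<zeta>1_def \<zeta>2_def e1_def e2_def \<beta>1_def \<beta>2_def)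
  have "\<zeta>1 x = Z11 l x * (z1 0 + W1 (g1 f1) (g2 f2) l x) + Z12 l x * (z2 0 + W2 (g1 f1) (g2 f2) l
      x)"
    "\<zeta>2 x = Z21 l x * (z1 0 + W1 (g1 f1) (g2 f2) l x) + Z22 l x * (z2 0 + W2 (g1 f1) (g2 f2) l x)"
    using variation_of_constants[OF pq B \<zeta>1 \<zeta>2 x] unfolding w1 w2 z0
    by (auto simp: Z11_def Z12_def Z21_def Z22_def)
  moreover have "exp (\<i> * (-1 * l) * of_real x) * exp (\<beta>1 x) * \<zeta>1 x = z1 x"
    "exp (\<i> * (1 * l) * of_real x) * exp (\<beta>2 x) * \<zeta>2 x = z2 x"
    by (auto simp: \<zeta>1_def \<zeta>2_def e1_def e2_def mult.assoc[symmetric] simp flip: exp_add)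
  ultimately show
    "z1 x = exp (\<i> * (-1 * l) * of_real x) * exp (\<beta>1 x) *
      (Z11 l x * (z1 0 + W1 (g1 f1) (g2 f2) l x) + Z12 l x * (z2 0 + W2 (g1 f1) (g2 f2) l x))"
    "z2 x = exp (\<i> * (1 * l) * of_real x) * exp (\<beta>2 x) *
      (Z21 l x * (z1 0 + W1 (g1 f1) (g2 f2) l x) + Z22 l x * (z2 0 + W2 (g1 f1) (g2 f2) l x))"
    by metis+
qed

text \<open>With monodromy matrix Y the boundary condition reads (\<omega> - Y) z(0) = Y G.
  Multiplying by the adjugate \<omega> - T + Y of \<omega> - Y gives \<Delta> on the left, and
  Cayley-Hamilton reduces the right side to (\<omega> Y - D) G.\<close>

lemma boundary_values:
  shows "\<Delta> \<omega> l * z1 0 = \<omega> * m1 l * (Z11 l pi * G1 (g1 f1) (g2 f2) l + Z12 l pi * G2 (g1 f1) (g2 f2)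
      l) - D * G1 (g1 f1) (g2 f2) l"
    and "\<Delta> \<omega> l * z2 0 = \<omega> * m2 l * (Z21 l pi * G1 (g1 f1) (g2 f2) l + Z22 l pi * G2 (g1 f1) (g2 f2)
        l) - D * G2 (g1 f1) (g2 f2) l"
proof -
  have W: "W1 (g1 f1) (g2 f2) l pi = G1 (g1 f1) (g2 f2) l" "W2 (g1 f1) (g2 f2) l pi
      = G2 (g1 f1) (g2 f2) l"
    by (simp_all add: W1_def W2_def G1_def G2_def pairing_def)
  have m: "exp (\<i> * (-1 * l) * of_real pi) * exp (\<beta>1 pi)
      = m1 l" "exp (\<i> * (1 * l) * of_real pi) * exp (\<beta>2 pi) = m2 l"
    by (simp_all add: m1_def m2_def algebra_simps flip: exp_add)
  define y1 y2 where "y1 = G1 (g1 f1) (g2 f2) l" and "y2 = G2 (g1 f1) (g2 f2) l"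
  have e1: "\<omega> * z1 0 = m1 l * (Z11 l pi * (z1 0 + y1) + Z12 l pi * (z2 0 + y2))"
    and e2: "\<omega> * z2 0 = m2 l * (Z21 l pi * (z1 0 + y1) + Z22 l pi * (z2 0 + y2))"
    using solution[of pi] bc unfolding W m y1_def y2_def by simp_all
  have det: "Z11 l pi * Z22 l pi - Z12 l pi * Z21 l pi = 1" by (rule Z_det) simp
  have "m1 l * m2 l = D" by (rule m_mult)
  with det have d: "m1 l * Z11 l pi * (m2 l * Z22 l pi) - m1 l * Z12 l pi * (m2 l * Z21 l pi) = D"
    by algebra
  show "\<Delta> \<omega> l * z1 0 = \<omega> * m1 l * (Z11 l pi * G1 (g1 f1) (g2 f2) l + Z12 l pi * G2 (g1 f1) (g2 f2)
      l) - D * G1 (g1 f1) (g2 f2) l"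
    unfolding y1_def[symmetric] y2_def[symmetric] \<Delta>_def T_def using e1 e2 d by algebra
  show "\<Delta> \<omega> l * z2 0 = \<omega> * m2 l * (Z21 l pi * G1 (g1 f1) (g2 f2) l + Z22 l pi * G2 (g1 f1) (g2 f2)
      l) - D * G2 (g1 f1) (g2 f2) l"
    unfolding y1_def[symmetric] y2_def[symmetric] \<Delta>_def T_def using e1 e2 d by algebra
qed

text \<open>The solution is affine in its boundary values at 0. The part linear in them produces the
  quotient with all poles, the part depending only on the forcing produces
  \<open>Rest\<close>.\<close>

lemma solution_pairing:
  assumes \<psi>: "sq_integrable \<psi>1" "sq_integrable \<psi>2" and nz: "\<Delta> \<omega> l \<noteq> 0"
  defines "v1 \<equiv> \<lambda>x. exp (\<beta>1 x) * \<psi>1 x" and "v2 \<equiv> \<lambda>x. exp (\<beta>2 x) * \<psi>2 x"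
  shows "integral {0..pi} (\<lambda>x. z1 x * \<psi>1 x + z2 x * \<psi>2 x)
      = N \<omega> v1 v2 (g1 f1) (g2 f2) l / \<Delta> \<omega> l + Rest v1 v2 (g1 f1) (g2 f2) l"
proof -
  have v: "v1 absolutely_integrable_on {0..pi}" "v2 absolutely_integrable_on {0..pi}"
    unfolding v1_def v2_def
    by (intro absolutely_integrable_continuous_mult sq_integrable_absolutely_integrable \<psi>
        continuous_intros \<beta>_continuous)+
  have int: "(\<lambda>s. exp (\<i> * (\<sigma> * l) * of_real s) * Z l s * g s) integrable_on {0..pi}"
    if "cmod \<sigma> = 1" "entire_family Z" "g absolutely_integrable_on {0..pi}" for \<sigma> Z g
    using entire_family_absolutely_integrable[OF entire_family_mult[OF entire_family_exp[OF that(1)]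
        that(2)] that(3)]
    by (rule set_lebesgue_integral_eq_integral(1))
  note F = entire_family_add[OF entire_family_mult entire_family_mult]
  have lin: "integral {0..pi} (\<lambda>x. exp (\<i> * (\<sigma> * l) * of_real x) * (Z l x * (z1 0 + W1 (g1 f1) (g2
      f2) l x) + Z' l x * (z2 0 + W2 (g1 f1) (g2 f2) l x)) * v x)
      = z1 0 * pairing \<sigma> Z v l + z2 0 * pairing \<sigma> Z' v l + pairing \<sigma> (\<lambda>l x. Z l x * W1 (g1 f1) (g2
          f2) l x + Z' l x * W2 (g1 f1) (g2 f2) l x) v l"
    and lin_int: "(\<lambda>x. exp (\<i> * (\<sigma> * l) * of_real x) * (Z l x * (z1 0 + W1 (g1 f1) (g2 f2) l x) + Z'
        l x * (z2 0 + W2 (g1 f1) (g2 f2) l x)) * v x) integrable_on {0..pi}"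
    if \<sigma>: "cmod \<sigma> = 1" and Z: "entire_family Z" "entire_family Z'" and v: "v
        absolutely_integrable_on {0..pi}" for \<sigma> Z Z' v
  proof -
    have W: "entire_family (\<lambda>l x. Z l x * W1 (g1 f1) (g2 f2) l x + Z' l x * W2 (g1 f1) (g2 f2) l x)"
      by (intro F Z W_entire_family g_absolutely_integrable f)
    have "((\<lambda>x. z1 0 * (exp (\<i> * (\<sigma> * l) * of_real x) * Z l x * v x) + z2 0 * (exp (\<i> * (\<sigma> * l) *
        of_real x) * Z' l x * v x)
        + exp (\<i> * (\<sigma> * l) * of_real x) * (Z l x * W1 (g1 f1) (g2 f2) l x + Z' l x * W2 (g1 f1) (g2
            f2) l x) * v x) has_integral
      (z1 0 * pairing \<sigma> Z v l + z2 0 * pairing \<sigma> Z' v l + pairing \<sigma> (\<lambda>l x. Z l x * W1 (g1 f1) (g2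
          f2) l x + Z' l x * W2 (g1 f1) (g2 f2) l x) v l)) {0..pi}"
      unfolding pairing_def
      by (intro has_integral_add has_integral_mult_right integrable_integral int \<sigma> Z v int[OF \<sigma> W
          v])
    then have "((\<lambda>x. exp (\<i> * (\<sigma> * l) * of_real x) * (Z l x * (z1 0 + W1 (g1 f1) (g2 f2) l x) + Z' l
        x * (z2 0 + W2 (g1 f1) (g2 f2) l x)) * v x) has_integral
      (z1 0 * pairing \<sigma> Z v l + z2 0 * pairing \<sigma> Z' v l + pairing \<sigma> (\<lambda>l x. Z l x * W1 (g1 f1) (g2
          f2) l x + Z' l x * W2 (g1 f1) (g2 f2) l x) v l)) {0..pi}"
      by (rule has_integral_eq[rotated]) (simp add: algebra_simps)
    then show "integral {0..pi} (\<lambda>x. exp (\<i> * (\<sigma> * l) * of_real x) * (Z l x * (z1 0 + W1 (g1 f1) (g2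
        f2) l x) + Z' l x * (z2 0 + W2 (g1 f1) (g2 f2) l x)) * v x)
      = z1 0 * pairing \<sigma> Z v l + z2 0 * pairing \<sigma> Z' v l + pairing \<sigma> (\<lambda>l x. Z l x * W1 (g1 f1) (g2
          f2) l x + Z' l x * W2 (g1 f1) (g2 f2) l x) v l"
      "(\<lambda>x. exp (\<i> * (\<sigma> * l) * of_real x) * (Z l x * (z1 0 + W1 (g1 f1) (g2 f2) l x) + Z' l x * (z2
          0 + W2 (g1 f1) (g2 f2) l x)) * v x) integrable_on {0..pi}"
      by (auto simp: integral_unique)
  qed
  have "integral {0..pi} (\<lambda>x. z1 x * \<psi>1 x + z2 x * \<psi>2 x) = integral {0..pi} (\<lambda>x.
      exp (\<i> * (-1 * l) * of_real x) * (Z11 l x * (z1 0 + W1 (g1 f1) (g2 f2) l x) + Z12 l x * (z2 0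
          + W2 (g1 f1) (g2 f2) l x)) * v1 x +
      exp (\<i> * (1 * l) * of_real x) * (Z21 l x * (z1 0 + W1 (g1 f1) (g2 f2) l x) + Z22 l x * (z2 0 +
          W2 (g1 f1) (g2 f2) l x)) * v2 x)"
  proof (rule integral_cong)
    fix x assume x: "x \<in> {0..pi}"
    show "z1 x * \<psi>1 x + z2 x * \<psi>2 x =
      exp (\<i> * (-1 * l) * of_real x) * (Z11 l x * (z1 0 + W1 (g1 f1) (g2 f2) l x) + Z12 l x * (z2 0
          + W2 (g1 f1) (g2 f2) l x)) * v1 x +
      exp (\<i> * (1 * l) * of_real x) * (Z21 l x * (z1 0 + W1 (g1 f1) (g2 f2) l x) + Z22 l x * (z2 0 +
          W2 (g1 f1) (g2 f2) l x)) * v2 x"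
      by (subst solution(1)[OF x], subst solution(2)[OF x]) (simp add: v1_def v2_def mult_ac)
  qed
  also have "\<dots> = (z1 0 * pairing (-1) Z11 v1 l + z2 0 * pairing (-1) Z12 v1 l + pairing (-1) (\<lambda>l x.
      Z11 l x * W1 (g1 f1) (g2 f2) l x + Z12 l x * W2 (g1 f1) (g2 f2) l x) v1 l)
      + (z1 0 * pairing 1 Z21 v2 l + z2 0 * pairing 1 Z22 v2 l + pairing 1 (\<lambda>l x. Z21 l x * W1 (g1
          f1) (g2 f2) l x + Z22 l x * W2 (g1 f1) (g2 f2) l x) v2 l)"
    using v Z_entire_family
    by (subst Henstock_Kurzweil_Integration.integral_add[OF lin_int lin_int], (simp; fail)+) (subst
        (1 2) lin; simp)
  also have "\<dots> = A1 v1 v2 l * z1 0 + A2 v1 v2 l * z2 0 + Rest v1 v2 (g1 f1) (g2 f2) l"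
    by (simp add: A1_def A2_def Rest_def algebra_simps)
  also have "A1 v1 v2 l * z1 0 + A2 v1 v2 l * z2 0 = N \<omega> v1 v2 (g1 f1) (g2 f2) l / \<Delta> \<omega> l"
    using nz unfolding N_def boundary_values[symmetric] by (simp add: field_simps)
  finally show ?thesis .
qed

end

end

section \<open>The Dirac operators\<close>

no_notation fps_nth (infixl \<open>$\<close> 75)

text \<open>Equations between L2 classes hold only almost everywhere, so the density must be
  replaceable on a null set.\<close>

lemma ac_on_cong_negligible:
  assumes u: "ac_on b u u'" and S: "negligible S" "\<And>x. x \<in> {0..b} - S \<Longrightarrow> v' x = u' x"
  shows "ac_on b u v'"
  unfolding ac_on_def
proof (intro conjI ballI)
  show "v' absolutely_integrable_on {0..b}"
    by (rule absolutely_integrable_spike[OF ac_on_absolutely_integrable[OF u] S])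
  fix x assume x: "x \<in> {0..b}"
  have "integral {0..x} v' = integral {0..x} u'"
    using x by (intro integral_spike[OF S(1)]) (auto simp: S(2))
  then show "u x = u 0 + integral {0..x} v'" using ac_on_eq[OF u x] by simp
qed

lemma ac_with_derivative_component:
  assumes "ac_with_derivative u u'"
  shows "ac_on pi (\<lambda>x. u x $ i) (\<lambda>x. u' x $ i)"
  unfolding ac_on_def
proof (intro conjI ballI)
  have ai: "u' absolutely_integrable_on {0..pi}" using assms by (simp add: ac_with_derivative_def)
  show "(\<lambda>x. u' x $ i) absolutely_integrable_on {0..pi}"
    using absolutely_integrable_linear[OF ai bounded_linear_vec_nth[of i]] by (simp add: comp_def)
  fix x assume x: "x \<in> {0..pi}"
  have "u' integrable_on {0..x}"
    using x by (intro set_lebesgue_integral_eq_integral(1) absolutely_integrable_on_subinterval[OF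
        ai]) auto
  then have "integral {0..x} (\<lambda>x. u' x $ i) = integral {0..x} u' $ i"
    using integral_linear[OF _ bounded_linear_vec_nth[of i]] by (simp add: comp_def)
  moreover have "u x = u 0 + integral {0..x} u'"
    using assms x unfolding ac_with_derivative_def by blast
  then have "u x $ i = u 0 $ i + integral {0..x} u' $ i" by (metis vector_add_component)
  ultimately show "u x $ i = u 0 $ i + integral {0..x} (\<lambda>x. u' x $ i)" by simp
qed

lemma continuous_on_componentwise_vec:
  fixes u :: "real \<Rightarrow> complex^2"
  assumes "\<And>i. continuous_on S (\<lambda>x. u x $ i)"
  shows "continuous_on S u"
  using continuous_on_vec_lambda[of S "\<lambda>i x. u x $ i", OF assms] by simp

lemma ac_with_derivative_continuous:
  assumes "ac_with_derivative u u'"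
  shows "continuous_on {0..pi} u"
  by (intro continuous_on_componentwise_vec ac_on_continuous[OF ac_with_derivative_component[OF
      assms]])

lemma square_integrable_continuous:
  assumes "continuous_on {0..pi} u"
  shows "square_integrable u"
  unfolding square_integrable_def
proof
  show "u \<in> borel_measurable interval_measure"
    using assms by (rule continuous_imp_measurable_on_sets_lebesgue) auto
  have "(\<lambda>x. (norm (u x))\<^sup>2) absolutely_integrable_on {0..pi}"
    using assms by (intro absolutely_integrable_continuous_real continuous_intros)
  then show "integrable interval_measure (\<lambda>x. (norm (u x))\<^sup>2)"
    by (rule absolutely_integrable_imp_integrable) auto
qed

lemma borel_measurable_component:
  fixes f :: "'a \<Rightarrow> complex^2"
  assumes "f \<in> borel_measurable M"
  shows "(\<lambda>x. f x $ i) \<in> borel_measurable M"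
  using measurable_compose[OF assms borel_measurable_continuous_onI[OF
      linear_continuous_on[OF bounded_linear_vec_nth[of i]]]] by simp

lemma sq_integrable_from_L2:
  assumes f: "square_integrable f" and v: "v \<in> borel_measurable interval_measure"
    and le: "\<And>x. x \<in> {0..pi} \<Longrightarrow> cmod (v x) \<le> K * norm (f x)"
  shows "sq_integrable v" and "sq_norm v \<le> K\<^sup>2 * (norm (L2_class f))\<^sup>2"
proof -
  have int: "integrable interval_measure (\<lambda>x. (norm (f x))\<^sup>2)" and meas: "f \<in> borel_measurable
      interval_measure"
    using f by (auto simp: square_integrable_def)
  have w: "sq_integrable (\<lambda>x. of_real (norm (f x)))"
    using int meas by (auto simp: sq_integrable_def intro: integrable_on_lebesgue_on)
  have "sq_norm (\<lambda>x. of_real (norm (f x))) = (norm (L2_class f))\<^sup>2"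
    unfolding norm_L2_class[OF f] sq_norm_def using lebesgue_integral_eq_integral[OF int] by simp
  then show "sq_integrable v" "sq_norm v \<le> K\<^sup>2 * (norm (L2_class f))\<^sup>2"
    using sq_integrable_dominated[OF w v, of K] le by auto
qed

lemma L2_class_eq_iff:
  assumes "square_integrable f" "square_integrable g"
  shows "L2_class f = L2_class g \<longleftrightarrow> (AE x in interval_measure. f x = g x)"
  using Quotient_rel[OF Quotient_L2, of f g] assms by (auto simp: L2_rel_def)

text \<open>The inner product of the code is the real part of the Hermitian one. The scalar
  \<open>c\<close>, later the derivative of the contour, has to be kept inside the real
  part.\<close>

lemma inner_scaleC_L2_class:
  assumes u: "square_integrable u" and g: "square_integrable g"
  shows "(c *\<^sub>C L2_class u) \<bullet> L2_class g
    = Re (c * integral {0..pi} (\<lambda>x. u x $ 1 * cnj (g x $ 1) + u x $ 2 * cnj (g x $ 2)))"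
proof -
  define h where "h x = u x $ 1 * cnj (g x $ 1) + u x $ 2 * cnj (g x $ 2)" for x
  have inner_eq: "(c *s u x) \<bullet> g x = Re (c * h x)" for c x
    by (simp add: h_def inner_vec_def sum_2 inner_complex_def algebra_simps)
  have int: "integrable interval_measure (\<lambda>x. Re (c * h x))" for c
    using integrable_inner[OF square_integrable_scale[OF u] g, of c] by (simp add: inner_eq)
  \<comment> \<open>The choices \<open>c = 1\<close> and \<open>c = - \<i>\<close> recover the real
    and the imaginary part of \<open>h\<close>.\<close>
  have Re_int: "(\<lambda>x. Re (h x)) integrable_on {0..pi}" "(\<lambda>x. Im (h x)) integrable_on {0..pi}"
    using int[of 1] int[of "- \<i>"] by (auto intro: integrable_on_lebesgue_on)
  have "(\<lambda>x. complex_of_real (Re (h x)) + \<i> * complex_of_real (Im (h x))) integrable_on {0..pi}"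
    using Re_int[THEN integrable_linear[OF _ bounded_linear_of_real[where 'a = complex]]]
    by (intro Henstock_Kurzweil_Integration.integrable_add integrable_on_mult_right) (auto simp:
        comp_def)
  then have h: "h integrable_on {0..pi}" by (simp flip: complex_eq)
  have rel: "L2_rel u u" "L2_rel g g" "L2_rel (\<lambda>x. c *s u x) (\<lambda>x. c *s u x)"
    using u g square_integrable_scale[OF u] by (auto simp: L2_rel_def)
  have "(c *\<^sub>C L2_class u) \<bullet> L2_class g = (\<integral>x. (c *s u x) \<bullet> g x \<partial>interval_measure)"
    using rel by (simp add: scaleC_L2.abs_eq inner_L2.abs_eq)
  also have "\<dots> = (\<integral>x. Re (c * h x) \<partial>interval_measure)" by (simp add: inner_eq)
  also have "\<dots> = integral {0..pi} (\<lambda>x. Re (c * h x))"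
    using int[of c] by (rule lebesgue_integral_eq_integral) auto
  also have "\<dots> = Re (integral {0..pi} (\<lambda>x. c * h x))"
    using integral_linear[OF integrable_on_mult_right[OF h, of c] bounded_linear_Re]
        by (simp add: comp_def)
  also have "\<dots> = Re (c * integral {0..pi} h)" by simp
  finally show ?thesis by (simp add: h_def[abs_def])
qed

text \<open>The potential in the eigenbasis \<open>(1, \<i>)\<close>, \<open>(1, -\<i>)\<close> of \<open>J\<close>.\<close>
locale dirac_coefficients =
  fixes a1 a2 a3 a4 :: "real \<Rightarrow> complex"
  assumes damped_a: "damped_on pi a1" "damped_on pi a2" "damped_on pi a3" "damped_on pi a4"
    and nonzero: "Re (integral {0..pi} (\<lambda>x. a3 x - a2 x)) \<noteq> 0"
begin

definition "b11 x = (1/2) * (a3 x + (-1) * a2 x) + (\<i>/2) * (a1 x + a4 x)"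
definition "b22 x = (1/2) * (a3 x + (-1) * a2 x) + (-\<i>/2) * (a1 x + a4 x)"
definition "b12 x = (1/2) * (a3 x + a2 x) + (\<i>/2) * (a1 x + (-1) * a4 x)"
definition "b21 x = (1/2) * (a3 x + a2 x) + (-\<i>/2) * (a1 x + (-1) * a4 x)"

sublocale dirac_system b11 b12 b21 b22
proof
  show damped: "damped_on pi b11" "damped_on pi b12" "damped_on pi b21" "damped_on pi b22"
    unfolding b11_def[abs_def] b12_def[abs_def] b21_def[abs_def] b22_def[abs_def]
    by (intro damped_on_add damped_on_cmult damped_a)+
  have "integral {0..pi} (\<lambda>x. b11 x + b22 x) = integral {0..pi} b11 + integral {0..pi} b22"
    using damped(1,4)[THEN damped_on_absolutely_integrable]
    by (intro Henstock_Kurzweil_Integration.integral_add set_lebesgue_integral_eq_integral(1))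
  moreover have "(\<lambda>x. b11 x + b22 x) = (\<lambda>x. a3 x - a2 x)"
    by (auto simp: b11_def b22_def field_simps)
  ultimately show "Re (integral {0..pi} b11 + integral {0..pi} b22) \<noteq> 0"
    using nonzero by simp
qed

definition "Q x = (vector [vector [a1 x, a2 x], vector [a3 x, a4 x]] :: complex^2^2)"

text \<open>\<open>force1\<close> and \<open>force2\<close> are the coordinates of the inverse of J
  applied to \<open>f\<close>, in the eigenbasis in which \<open>z1\<close> and \<open>z2\<close>
  are the coordinates of \<open>u\<close>.\<close>

definition force1 :: "(real \<Rightarrow> complex^2) \<Rightarrow> real \<Rightarrow> complex" where
  "force1 f x = - \<i> * (f x $ 1 - \<i> * f x $ 2) / 2"
definition force2 :: "(real \<Rightarrow> complex^2) \<Rightarrow> real \<Rightarrow> complex" where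
  "force2 f x = \<i> * (f x $ 1 + \<i> * f x $ 2) / 2"

text \<open>Membership in the graph yields a representative of the resolvent image in the operator
  domain; its differential equation, diagonalized in J, is the system of \<open>dirac_system\<close>
  with forcing.\<close>

lemma resolvent_solution:
  assumes z: "z \<in> resolvent_set (dirac_operator Q t)" and f: "square_integrable f"
  obtains u z1 z2 where "square_integrable u"
    "resolvent (dirac_operator Q t) z (L2_class f) = L2_class u"
    "\<And>x. u x $ 1 = z1 x + z2 x" "\<And>x. u x $ 2 = \<i> * (z1 x - z2 x)"
    "ac_on pi z1 (\<lambda>x. (- \<i> * z + b11 x) * z1 x + b12 x * z2 x + force1 f x)"
    "ac_on pi z2 (\<lambda>x. b21 x * z1 x + (\<i> * z + b22 x) * z2 x + force2 f x)"
    "z1 pi = exp (\<i> * of_real (pi * t)) * z1 0" "z2 pi = exp (\<i> * of_real (pi * t)) * z2 0"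
proof -
  let ?R = "resolvent (dirac_operator Q t) z"
  have "(L2_class f, ?R (L2_class f)) \<in> {(g - z *\<^sub>C y, y) | y g. (y, g) \<in> dirac_operator Q t}"
    using resolvent_works[OF z] unfolding is_resolvent_def by blast
  then obtain y g where yg: "L2_class f = g - z *\<^sub>C y" "?R (L2_class f)
      = y" "(y, g) \<in> dirac_operator Q t"
    by auto
  then obtain u u' where y: "y = L2_class u" and g: "g = L2_class (\<lambda>x. dirac_J *v u' x + Q x *v u
      x)"
    and ac: "ac_with_derivative u u'" and F: "square_integrable (\<lambda>x. dirac_J *v u' x + Q x *v u x)"
    and bc: "u pi = exp (\<i> * of_real (pi * t)) *s u 0"
    unfolding dirac_operator_def by auto
  have u: "square_integrable u"
    by (rule square_integrable_continuous[OF ac_with_derivative_continuous[OF ac]])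
  have zu: "square_integrable (\<lambda>x. z *s u x)" by (rule square_integrable_scale[OF u])
  have "L2_class f = L2_class (\<lambda>x. dirac_J *v u' x + Q x *v u x) - L2_class (\<lambda>x. z *s u x)"
    using yg(1) u by (simp add: y g scaleC_L2.abs_eq L2_rel_def)
  also have "\<dots> = L2_class (\<lambda>x. dirac_J *v u' x + Q x *v u x - z *s u x)"
    by (rule L2_class_diff[OF F zu])
  finally have "AE x in interval_measure. f x = dirac_J *v u' x + Q x *v u x - z *s u x"
    using L2_class_eq_iff[OF f square_integrable_diff[OF F zu]] by simp
  then have "AE x in lebesgue. x \<in> {0..pi} \<longrightarrow> f x = dirac_J *v u' x + Q x *v u x - z *s u x"
    by (simp add: AE_restrict_space_iff)
  then obtain S where S: "negligible S"
    "{x. \<not> (x \<in> {0..pi} \<longrightarrow> f x = dirac_J *v u' x + Q x *v u x - z *s u x)} \<subseteq> S"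
    unfolding eventually_ae_filter_negligible by blast
  have eq: "f x $ 1 = u' x $ 2 + a1 x * u x $ 1 + a2 x * u x $ 2 - z * u x $ 1"
    "f x $ 2 = - u' x $ 1 + a3 x * u x $ 1 + a4 x * u x $ 2 - z * u x $ 2" if "x \<in> {0..pi} - S"
        for x
  proof -
    have "f x = dirac_J *v u' x + Q x *v u x - z *s u x" using S(2) that by blast
    then show "f x $ 1 = u' x $ 2 + a1 x * u x $ 1 + a2 x * u x $ 2 - z * u x $ 1"
      "f x $ 2 = - u' x $ 1 + a3 x * u x $ 1 + a4 x * u x $ 2 - z * u x $ 2"
      by (simp_all add: dirac_J_def Q_def matrix_vector_mult_def sum_2)
  qed
  define z1 where "z1 x = (1/2) * u x $ 1 + (-\<i>/2) * u x $ 2" for x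
  define z2 where "z2 x = (1/2) * u x $ 1 + (\<i>/2) * u x $ 2" for x
  have u12: "u x $ 1 = z1 x + z2 x" "u x $ 2 = \<i> * (z1 x - z2 x)" for x
    by (auto simp: z1_def z2_def field_simps)
  note comp = ac_with_derivative_component[OF ac]
  show ?thesis
  proof (rule that[of u z1 z2, OF u _ u12])
    show "?R (L2_class f) = L2_class u" using yg(2) y by simp
    show "z1 pi = exp (\<i> * of_real (pi * t)) * z1 0" "z2 pi = exp (\<i> * of_real (pi * t)) * z2 0"
      by (auto simp: z1_def z2_def bc algebra_simps)
    show "ac_on pi z1 (\<lambda>x. (- \<i> * z + b11 x) * z1 x + b12 x * z2 x + force1 f x)"
    \<comment> \<open>The differential equation may fail on the null set \<open>S\<close>; there the
      density is redefined by the right-hand side.\<close>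
    proof (rule ac_on_cong_negligible[OF _ S(1)])
      show "ac_on pi z1 (\<lambda>x. (1/2) * u' x $ 1 + (-\<i>/2) * u' x $ 2)"
        unfolding z1_def[abs_def] by (intro ac_on_add ac_on_cmult comp)
      fix x assume x: "x \<in> {0..pi} - S"
      show "(- \<i> * z + b11 x) * z1 x + b12 x * z2 x + force1 f x
          = (1/2) * u' x $ 1 + (-\<i>/2) * u' x $ 2"
        unfolding force1_def eq[OF x] u12 b11_def b12_def by (simp add: field_simps)
    qed
    show "ac_on pi z2 (\<lambda>x. b21 x * z1 x + (\<i> * z + b22 x) * z2 x + force2 f x)"
    proof (rule ac_on_cong_negligible[OF _ S(1)])
      show "ac_on pi z2 (\<lambda>x. (1/2) * u' x $ 1 + (\<i>/2) * u' x $ 2)"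
        unfolding z2_def[abs_def] by (intro ac_on_add ac_on_cmult comp)
      fix x assume x: "x \<in> {0..pi} - S"
      show "b21 x * z1 x + (\<i> * z + b22 x) * z2 x + force2 f x
          = (1/2) * u' x $ 1 + (\<i>/2) * u' x $ 2"
        unfolding force2_def eq[OF x] u12 b21_def b22_def by (simp add: field_simps)
    qed
  qed
qed

lemma \<beta>_exp_bound:
  obtains K where "1 \<le> K" "\<And>x. x \<in> {0..pi} \<Longrightarrow> cmod (exp (\<beta>1 x)) \<le> K \<and> cmod (exp (\<beta>2 x)) \<le> K \<and>
    cmod (exp (- \<beta>1 x)) \<le> K \<and> cmod (exp (- \<beta>2 x)) \<le> K"
proof -
  obtain B1 where B1: "0 \<le> B1" "\<And>x. x \<in> {0..pi} \<Longrightarrow> cmod (\<beta>1 x) \<le> B1"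
    by (rule continuous_on_interval_bounded[OF \<beta>_continuous(1)]) blast
  obtain B2 where B2: "0 \<le> B2" "\<And>x. x \<in> {0..pi} \<Longrightarrow> cmod (\<beta>2 x) \<le> B2"
    by (rule continuous_on_interval_bounded[OF \<beta>_continuous(2)]) blast
  show ?thesis
  proof (rule that[of "exp (B1 + B2)"])
    fix x assume x: "x \<in> {0..pi}"
    have "\<bar>Re (\<beta>1 x)\<bar> \<le> B1 + B2" "\<bar>Re (\<beta>2 x)\<bar> \<le> B1 + B2"
      using B1(1) B1(2)[OF x] B2(1) B2(2)[OF x] abs_Re_le_cmod[of "\<beta>1 x"] abs_Re_le_cmod[of "\<beta>2 x"]
      by linarith+
    then show "cmod (exp (\<beta>1 x)) \<le> exp (B1 + B2) \<and> cmod (exp (\<beta>2 x)) \<le> exp (B1 + B2) \<and>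
      cmod (exp (- \<beta>1 x)) \<le> exp (B1 + B2) \<and> cmod (exp (- \<beta>2 x)) \<le> exp (B1 + B2)"
      by (simp add: abs_le_iff)
  qed (use B1 B2 in simp)
qed

lemma force_bound: "cmod (force1 f x) \<le> norm (f x)" "cmod (force2 f x) \<le> norm (f x)"
proof -
  have "cmod (f x $ 1 - \<i> * f x $ 2) \<le> norm (f x) + norm (f x)"
    "cmod (f x $ 1 + \<i> * f x $ 2) \<le> norm (f x) + norm (f x)"
    using Finite_Cartesian_Product.norm_nth_le[of "f x" 1] Finite_Cartesian_Product.norm_nth_le[of
        "f x" 2]
    by (auto intro!: order_trans[OF norm_triangle_ineq4] order_trans[OF norm_triangle_ineq] add_mono
        simp: norm_mult)
  then show "cmod (force1 f x) \<le> norm (f x)" "cmod (force2 f x) \<le> norm (f x)"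
    by (auto simp: force1_def force2_def norm_mult norm_divide)
qed

lemma force_measurable:
  assumes "square_integrable f"
  shows "force1 f \<in> borel_measurable interval_measure" "force2 f \<in> borel_measurable
      interval_measure"
proof -
  have [measurable]: "(\<lambda>x. f x $ i) \<in> borel_measurable interval_measure" for i
    using assms by (intro borel_measurable_component) (simp add: square_integrable_def)
  show "force1 f \<in> borel_measurable interval_measure" "force2 f \<in> borel_measurable interval_measure"
    unfolding force1_def[abs_def] force2_def[abs_def] by measurable
qed

lemma force_sq_integrable:
  assumes "square_integrable f"
  shows "sq_integrable (force1 f)" "sq_integrable (force2 f)"
  using sq_integrable_from_L2(1)[OF assms force_measurable(1)[OF assms], of 1]
    sq_integrable_from_L2(1)[OF assms force_measurable(2)[OF assms], of 1] force_bound by auto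

text \<open>Solvability for the forcing \<open>Z(x) k / \<pi>\<close>, for which \<open>G = k\<close> is arbitrary, would force \<open>\<omega> Y
    = D\<close>
  at a zero of \<open>\<Delta>\<close>, hence \<open>D = \<omega>\<^sup>2\<close>.\<close>
lemma \<Delta>_nonzero_on_resolvent_set:
  assumes z: "z \<in> resolvent_set (dirac_operator Q t)"
  shows "\<Delta> (exp (\<i> * of_real (pi * t))) z \<noteq> 0"
proof
  define \<omega> where "\<omega> = exp (\<i> * complex_of_real (pi * t))"
  have \<omega>: "cmod \<omega> = 1" by (simp add: \<omega>_def)
  assume "\<Delta> (exp (\<i> * of_real (pi * t))) z = 0"
  then have zero: "\<Delta> \<omega> z = 0" by (simp add: \<omega>_def)
  have key: "\<omega> * m1 z * (Z11 z pi * k1 + Z12 z pi * k2) = D * k1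
      \<and> \<omega> * m2 z * (Z21 z pi * k1 + Z22 z pi * k2) = D * k2" for k1 k2
  proof -
    define \<phi>1 where "\<phi>1 x = (Z11 z x * k1 + Z12 z x * k2) / pi" for x
    define \<phi>2 where "\<phi>2 x = (Z21 z x * k1 + Z22 z x * k2) / pi" for x
    \<comment> \<open>The exponential factors undo those in \<open>g1\<close>, \<open>g2\<close> and
      in the pairing, so the integrand of \<open>G1\<close> and \<open>G2\<close> is the adjugate of
      Z times Z k / pi, which is the constant k / pi.\<close>
    define h1 where "h1 x = exp (\<i> * (-1 * z) * of_real x) * exp (\<beta>1 x) * \<phi>1 x" for x
    define h2 where "h2 x = exp (\<i> * (1 * z) * of_real x) * exp (\<beta>2 x) * \<phi>2 x" for x
    define f :: "real \<Rightarrow> complex^2" where "f x = vector [\<i> * (h1 x - h2 x), - (h1 x + h2 x)]" for x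
    have h: "continuous_on {0..pi} h1" "continuous_on {0..pi} h2"
      unfolding h1_def[abs_def] h2_def[abs_def] \<phi>1_def \<phi>2_def
      by (auto intro!: continuous_intros Z_continuous \<beta>_continuous)
    have "continuous_on {0..pi} (\<lambda>x. f x $ i)" for i
      using exhaust_2[of i]
    proof
      assume "i = 1"
      then show ?thesis using h by (simp only: f_def vector_2) (intro continuous_intros)
    next
      assume "i = 2"
      then show ?thesis using h by (simp only: f_def vector_2) (intro continuous_intros)
    qed
    then have "continuous_on {0..pi} f" by (rule continuous_on_componentwise_vec)
    then have f: "square_integrable f" by (rule square_integrable_continuous)
    have force: "force1 f = h1" "force2 f = h2"
      by (auto simp: force1_def force2_def f_def field_simps)
    obtain u z1 z2 where sol:
      "ac_on pi z1 (\<lambda>x. (- \<i> * z + b11 x) * z1 x + b12 x * z2 x + force1 f x)"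
      "ac_on pi z2 (\<lambda>x. b21 x * z1 x + (\<i> * z + b22 x) * z2 x + force2 f x)"
      "z1 pi = \<omega> * z1 0" "z2 pi = \<omega> * z2 0"
      by (rule resolvent_solution[OF z f]) (simp add: \<omega>_def)
    note ai = g_absolutely_integrable(1)[OF force_sq_integrable(1)[OF f]]
        g_absolutely_integrable(2)[OF force_sq_integrable(2)[OF f]]
    have int: "(\<lambda>s. exp (\<i> * (\<sigma> * z) * of_real s) * Z z s * g s) integrable_on {0..pi}"
      if "cmod \<sigma> = 1" "entire_family Z" "g absolutely_integrable_on {0..pi}" for \<sigma> Z g
      using entire_family_absolutely_integrable[OF entire_family_mult[OF entire_family_exp[OF
          that(1)] that(2)] that(3)]
      by (rule set_lebesgue_integral_eq_integral(1))
    have g: "exp (\<i> * (1 * z) * of_real x) * g1 (force1 f) x = \<phi>1 x"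
      "exp (\<i> * (-1 * z) * of_real x) * g2 (force2 f) x = \<phi>2 x" for x
      unfolding g1_def g2_def force h1_def h2_def by (simp_all add: mult.assoc[symmetric] flip:
          exp_add)
    have "G1 (g1 (force1 f)) (g2 (force2 f)) z = integral {0..pi} (\<lambda>x. k1 / pi)"
      unfolding G1_def pairing_def
    proof (subst Henstock_Kurzweil_Integration.integral_diff[symmetric])
      show "integral {0..pi} (\<lambda>x. exp (\<i> * (1 * z) * of_real x) * Z22 z x * g1 (force1 f) x -
          exp (\<i> * (-1 * z) * of_real x) * Z12 z x * g2 (force2 f) x)
              = integral {0..pi} (\<lambda>x. k1 / pi)"
      proof (rule integral_cong)
        fix x assume x: "x \<in> {0..pi}"
        have "exp (\<i> * (1 * z) * of_real x) * Z22 z x * g1 (force1 f) x - exp (\<i> * (-1 * z) *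
            of_real x) * Z12 z x * g2 (force2 f) x
            = Z22 z x * \<phi>1 x - Z12 z x * \<phi>2 x"
          unfolding g[symmetric] by (simp add: mult_ac)
        also have "\<dots> = (Z11 z x * Z22 z x - Z12 z x * Z21 z x) * k1 / pi"
          by (simp add: \<phi>1_def \<phi>2_def field_simps)
        finally show "exp (\<i> * (1 * z) * of_real x) * Z22 z x * g1 (force1 f) x - exp (\<i> * (-1 * z)
            * of_real x) * Z12 z x * g2 (force2 f) x = k1 / pi"
          by (simp add: Z_det[OF x])
      qed
    qed (intro int Z_entire_family ai; simp)+
    then have G1: "G1 (g1 (force1 f)) (g2 (force2 f)) z = k1" by (simp add: scaleR_conv_of_real)
    have "G2 (g1 (force1 f)) (g2 (force2 f)) z = integral {0..pi} (\<lambda>x. k2 / pi)"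
      unfolding G2_def pairing_def
    proof (subst Henstock_Kurzweil_Integration.integral_diff[symmetric])
      show "integral {0..pi} (\<lambda>x. exp (\<i> * (-1 * z) * of_real x) * Z11 z x * g2 (force2 f) x -
          exp (\<i> * (1 * z) * of_real x) * Z21 z x * g1 (force1 f) x)
              = integral {0..pi} (\<lambda>x. k2 / pi)"
      proof (rule integral_cong)
        fix x assume x: "x \<in> {0..pi}"
        have "exp (\<i> * (-1 * z) * of_real x) * Z11 z x * g2 (force2 f) x - exp (\<i> * (1 * z) *
            of_real x) * Z21 z x * g1 (force1 f) x
            = Z11 z x * \<phi>2 x - Z21 z x * \<phi>1 x"
          unfolding g[symmetric] by (simp add: mult_ac)
        also have "\<dots> = (Z11 z x * Z22 z x - Z12 z x * Z21 z x) * k2 / pi"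
          by (simp add: \<phi>1_def \<phi>2_def field_simps)
        finally show "exp (\<i> * (-1 * z) * of_real x) * Z11 z x * g2 (force2 f) x - exp (\<i> * (1 * z)
            * of_real x) * Z21 z x * g1 (force1 f) x = k2 / pi"
          by (simp add: Z_det[OF x])
      qed
    qed (intro int Z_entire_family ai; simp)+
    then have G2: "G2 (g1 (force1 f)) (g2 (force2 f)) z = k2" by (simp add: scaleR_conv_of_real)
    show ?thesis
      using boundary_values[OF force_sq_integrable[OF f] sol] unfolding zero G1 G2 by simp
  qed
  \<comment> \<open>The two unit vectors for k show that \<omega> times the monodromy matrix is
    \<open>D\<close> times the identity. Taking determinants forces
    \<open>D = \<omega>\<^sup>2\<close>, impossible for the moduli.\<close>
  have 1: "\<omega> * m1 z * Z11 z pi = D" "\<omega> * m2 z * Z21 z pi = 0" using key[of 1 0] by auto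
  have 2: "\<omega> * m2 z * Z22 z pi = D" using key[of 0 1] by auto
  have "Z11 z pi * Z22 z pi - Z12 z pi * Z21 z pi = 1" by (rule Z_det) simp
  moreover have "Z21 z pi = 0" using 1(2) \<omega> by (auto simp: m2_def)
  ultimately have "Z11 z pi * Z22 z pi = 1" by simp
  moreover have "D * D = (\<omega> * m1 z * Z11 z pi) * (\<omega> * m2 z * Z22 z pi)" by (simp only: 1(1) 2)
  moreover have "\<dots> = \<omega>\<^sup>2 * (m1 z * m2 z) * (Z11 z pi * Z22 z pi)" by (simp add: power2_eq_square)
  ultimately have "D * D = \<omega>\<^sup>2 * D" by (simp add: m_mult)
  moreover have "D \<noteq> 0" by (simp add: D_def)
  ultimately have "D = \<omega>\<^sup>2" by simp
  then show False using D_ne_1 \<omega> by (simp add: norm_power)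
qed

text \<open>Testing the operator integral with \<open>a\<close> and \<open>b\<close> gives the real
  part of a scalar contour integral to which \<open>contour_bound\<close> applies. The choice
  \<open>b = e a\<close> then yields the operator norm.\<close>

lemma projections_bounded:
  obtains M C where "0 < M" "\<And>t \<gamma>. \<gamma> \<in> closed_contours_in ({z. cmod z > M} \<inter> resolvent_set
      (dirac_operator Q t)) \<Longrightarrow>
    norm (resolvent_contour_integral (dirac_operator Q t) \<gamma>) \<le> C"
proof -
  obtain M C where M: "0 < M" and C: "0 \<le> C" "\<And>\<omega> \<gamma> v1 v2 g1 g2. cmod \<omega> = 1 \<Longrightarrow>
    \<gamma> \<in> closed_contours_in ({z. cmod z > M} \<inter> {z. \<Delta> \<omega> z \<noteq> 0}) \<Longrightarrow>
    sq_integrable v1 \<Longrightarrow> sq_integrable v2 \<Longrightarrow> sq_integrable g1 \<Longrightarrow> sq_integrable g2 \<Longrightarrow>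
    cmod (contour_integral \<gamma> (\<lambda>l. N \<omega> v1 v2 g1 g2 l / \<Delta> \<omega> l))
      \<le> C * (pair_norm v1 v2 * pair_norm g1 g2)"
    by (rule contour_bound) blast
  obtain K where K: "1 \<le> K" "\<And>x. x \<in> {0..pi} \<Longrightarrow> cmod (exp (\<beta>1 x)) \<le> K \<and> cmod (exp (\<beta>2 x)) \<le> K \<and>
    cmod (exp (- \<beta>1 x)) \<le> K \<and> cmod (exp (- \<beta>2 x)) \<le> K"
    by (rule \<beta>_exp_bound) blast
  \<comment> \<open>The pair norms cost a factor 2 each, every exponential of \<beta> costs
    \<open>K\<close>, and passing from \<open>g\<close> to \<psi> costs another 2.\<close>
  define C' where "C' = C * (4 * K * (2 * K))"
  have pair_norm_le: "pair_norm v w \<le> 2 * k * n"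
    if "sq_norm v \<le> k\<^sup>2 * n\<^sup>2" "sq_norm w \<le> k\<^sup>2 * n\<^sup>2" "0 \<le> k" "0 \<le> n" for v w k n
    unfolding pair_norm_def
  proof (rule real_le_lsqrt)
    show "sq_norm v + sq_norm w \<le> (2 * k * n)\<^sup>2"
    proof -
      have "0 \<le> k\<^sup>2 * n\<^sup>2" by simp
      then have "sq_norm v + sq_norm w \<le> 4 * (k\<^sup>2 * n\<^sup>2)" using that(1,2) by linarith
      then show ?thesis by (simp add: power_mult_distrib)
    qed
  qed (use that in auto)
  have "norm (resolvent_contour_integral (dirac_operator Q t) \<gamma>) \<le> C'"
    if \<gamma>: "\<gamma> \<in> closed_contours_in ({z. cmod z > M} \<inter> resolvent_set (dirac_operator Q t))" for t \<gamma>
  proof -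
    let ?A = "dirac_operator Q t"
    define \<omega> where "\<omega> = exp (\<i> * complex_of_real (pi * t))"
    have \<omega>: "cmod \<omega> = 1" by (simp add: \<omega>_def)
    define \<gamma>' where "\<gamma>' s = vector_derivative \<gamma> (at s within {0..1})" for s
    define F where "F s = scaleC_blinfun (\<gamma>' s) o\<^sub>L resolvent ?A (\<gamma> s)" for s
    define e where "e = integral {0..1} F"
    have e_eq: "resolvent_contour_integral ?A \<gamma> = e"
      by (simp add: resolvent_contour_integral_def e_def F_def[abs_def] \<gamma>'_def)
    have valid: "valid_path \<gamma>" and loop: "pathfinish \<gamma> = pathstart \<gamma>"
      and img: "path_image \<gamma> \<subseteq> resolvent_set ?A"
      using \<gamma> by (auto simp: closed_contours_in_def)
    have nz: "\<Delta> \<omega> l \<noteq> 0" if "l \<in> path_image \<gamma>" for l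
      unfolding \<omega>_def using \<Delta>_nonzero_on_resolvent_set img that by blast
    then have \<gamma>\<Delta>: "\<gamma> \<in> closed_contours_in ({z. cmod z > M} \<inter> {z. \<Delta> \<omega> z \<noteq> 0})"
      using \<gamma> by (auto simp: closed_contours_in_def)
    have C'0: "0 \<le> C'" using C(1) K(1) by (simp add: C'_def)
    show ?thesis
    proof (cases "F integrable_on {0..1}")
      \<comment> \<open>An integral that does not exist has the value 0 by convention, which
        satisfies any nonnegative bound.\<close>
      case False
      then show ?thesis using C'0 by (simp add: e_eq e_def not_integrable_integral)
    next
      case True
      have bound: "e a \<bullet> b \<le> C' * norm a * norm b" for a b
      proof -
        obtain f where f: "square_integrable f" and a: "a = L2_class f" by (rule L2_class_surj)
        obtain g where g: "square_integrable g" and b: "b = L2_class g" by (rule L2_class_surj)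
        \<comment> \<open>The dual coordinates: with \<open>u\<close> expressed by \<open>z1\<close>
          and \<open>z2\<close>, the Hermitian product of \<open>u\<close> and \<open>g\<close>
          becomes \<open>z1 x * \<psi>1 x + z2 x * \<psi>2 x\<close>.\<close>
        define \<psi>1 where "\<psi>1 x = cnj (g x $ 1) + \<i> * cnj (g x $ 2)" for x
        define \<psi>2 where "\<psi>2 x = cnj (g x $ 1) - \<i> * cnj (g x $ 2)" for x
        define v1 where "v1 x = exp (\<beta>1 x) * \<psi>1 x" for x
        define v2 where "v2 x = exp (\<beta>2 x) * \<psi>2 x" for x
        have [measurable]: "(\<lambda>x. g x $ i) \<in> borel_measurable interval_measure" for i
          using g by (intro borel_measurable_component) (simp add: square_integrable_def)
        have cnj_meas: "(\<lambda>x. cnj (g x $ i)) \<in> borel_measurable interval_measure" for i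
          by (rule measurable_compose[OF _ borel_measurable_continuous_onI[OF continuous_on_cnj[OF
              continuous_on_id]]]) simp
        have \<psi>_meas: "\<psi>1 \<in> borel_measurable interval_measure" "\<psi>2 \<in> borel_measurable
            interval_measure"
          unfolding \<psi>1_def[abs_def] \<psi>2_def[abs_def]
          by (intro borel_measurable_add borel_measurable_diff borel_measurable_times cnj_meas
              borel_measurable_const)+
        have exp_meas: "(\<lambda>x. exp (\<beta>1 x)) \<in> borel_measurable interval_measure" "(\<lambda>x. exp (\<beta>2 x)) \<in>
            borel_measurable interval_measure"
          "(\<lambda>x. exp (- \<beta>1 x)) \<in> borel_measurable interval_measure" "(\<lambda>x. exp (- \<beta>2 x)) \<in>
              borel_measurable interval_measure"
          by (intro continuous_imp_measurable_on_sets_lebesgue continuous_intros \<beta>_continuous;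
              simp)+
        have \<psi>_bound: "cmod (\<psi>1 x) \<le> 2 * norm (g x)" "cmod (\<psi>2 x) \<le> 2 * norm (g x)" for x
          unfolding \<psi>1_def \<psi>2_def
          using norm_triangle_ineq[of "cnj (g x $ 1)" "\<i> * cnj (g x $ 2)"] norm_triangle_ineq4[of
              "cnj (g x $ 1)" "\<i> * cnj (g x $ 2)"]
            Finite_Cartesian_Product.norm_nth_le[of "g x" 1] Finite_Cartesian_Product.norm_nth_le[of
                "g x" 2]
          by (auto simp: norm_mult)
        have v_bound: "cmod (v1 x) \<le> 2 * K * norm (g x)" "cmod (v2 x) \<le> 2 * K * norm (g x)"
            if "x \<in> {0..pi}" for x
          using mult_mono[of "cmod (exp (\<beta>1 x))" K "cmod (\<psi>1 x)" "2 * norm (g x)"]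
            mult_mono[of "cmod (exp (\<beta>2 x))" K "cmod (\<psi>2 x)" "2 * norm (g x)"] K(1) K(2)[OF that]
                \<psi>_bound[of x]
          by (auto simp: v1_def v2_def norm_mult mult_ac)
        have g_bound: "cmod (g1 (force1 f) x) \<le> K * norm (f x)" "cmod (g2 (force2 f) x)
            \<le> K * norm (f x)" if "x \<in> {0..pi}" for x
          unfolding g1_def g2_def norm_mult
          using K(1) K(2)[OF that] force_bound[of f x] by (auto intro!: mult_mono)
        have v_meas: "v1 \<in> borel_measurable interval_measure" "v2 \<in> borel_measurable
            interval_measure"
          unfolding v1_def[abs_def] v2_def[abs_def] by (intro borel_measurable_times exp_meas
              \<psi>_meas)+
        have g_meas: "g1 (force1 f) \<in> borel_measurable interval_measure" "g2 (force2 f) \<in>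
            borel_measurable interval_measure"
          unfolding g1_def[abs_def] g2_def[abs_def] by (intro borel_measurable_times exp_meas
              force_measurable[OF f])+
        note v1 = sq_integrable_from_L2[OF g v_meas(1) v_bound(1)] and v2
            = sq_integrable_from_L2[OF g v_meas(2) v_bound(2)]
        note h1 = sq_integrable_from_L2[OF f g_meas(1) g_bound(1)] and h2
            = sq_integrable_from_L2[OF f g_meas(2) g_bound(2)]
        have \<psi>_sq: "sq_integrable \<psi>1" "sq_integrable \<psi>2"
          using sq_integrable_from_L2(1)[OF g \<psi>_meas(1) \<psi>_bound(1)] sq_integrable_from_L2(1)[OF g
              \<psi>_meas(2) \<psi>_bound(2)] by auto
        define n where "n = N \<omega> v1 v2 (g1 (force1 f)) (g2 (force2 f))"
        define r where "r = Rest v1 v2 (g1 (force1 f)) (g2 (force2 f))"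
        have n: "n holomorphic_on UNIV" unfolding n_def by (intro N_holomorphic v1 v2 h1 h2)
        have r: "r holomorphic_on UNIV"
          unfolding r_def by (intro Rest_holomorphic sq_integrable_absolutely_integrable v1 v2 h1
              h2)
        have pointwise: "F s a \<bullet> b = Re ((n (\<gamma> s) / \<Delta> \<omega> (\<gamma> s) + r (\<gamma> s)) * \<gamma>' s)"
            if s: "s \<in> {0..1}" for s
        proof -
          have \<gamma>s: "\<gamma> s \<in> path_image \<gamma>" using s by (auto simp: path_image_def)
          obtain u z1 z2 where u: "square_integrable u" "resolvent ?A (\<gamma> s) (L2_class f)
              = L2_class u"
            and u12: "\<And>x. u x $ 1 = z1 x + z2 x" "\<And>x. u x $ 2 = \<i> * (z1 x - z2 x)"
            and sol: "ac_on pi z1 (\<lambda>x. (- \<i> * \<gamma> s + b11 x) * z1 x + b12 x * z2 x + force1 f x)"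
              "ac_on pi z2 (\<lambda>x. b21 x * z1 x + (\<i> * \<gamma> s + b22 x) * z2 x + force2 f x)"
              "z1 pi = \<omega> * z1 0" "z2 pi = \<omega> * z2 0"
            using resolvent_solution[OF _ f, of "\<gamma> s" t] img \<gamma>s unfolding \<omega>_def by blast
          have "F s a \<bullet> b = (\<gamma>' s *\<^sub>C L2_class u) \<bullet> L2_class g"
            by (simp add: F_def a b u(2) scaleC_blinfun.rep_eq)
          also have "\<dots> = Re (\<gamma>' s * integral {0..pi} (\<lambda>x. u x $ 1 * cnj (g x $ 1) + u x $ 2 * cnj (g
              x $ 2)))"
            by (rule inner_scaleC_L2_class[OF u(1) g])
          also have "(\<lambda>x. u x $ 1 * cnj (g x $ 1) + u x $ 2 * cnj (g x $ 2))
              = (\<lambda>x. z1 x * \<psi>1 x + z2 x * \<psi>2 x)"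
            by (auto simp: u12 \<psi>1_def \<psi>2_def algebra_simps)
          also have "integral {0..pi} \<dots> = n (\<gamma> s) / \<Delta> \<omega> (\<gamma> s) + r (\<gamma> s)"
            unfolding n_def r_def v1_def[abs_def] v2_def[abs_def]
            by (rule solution_pairing[OF force_sq_integrable[OF f] sol \<psi>_sq nz[OF \<gamma>s]])
          finally show ?thesis by (simp add: mult.commute)
        qed
        have bl: "bounded_linear (\<lambda>T. blinfun_apply T a \<bullet> b)"
          by (rule bounded_linear_compose[OF bounded_linear_inner_left blinfun.bounded_linear_left])
        have "e a \<bullet> b = integral {0..1} (\<lambda>s. F s a \<bullet> b)"
          using integral_linear[OF True bl] by (simp add: e_def comp_def)
        also have "\<dots> = integral {0..1} (\<lambda>s. Re ((n (\<gamma> s) / \<Delta> \<omega> (\<gamma> s) + r (\<gamma> s)) * \<gamma>' s))"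
          by (intro integral_cong pointwise)
        finally have e1: "e a \<bullet> b = integral {0..1} (\<lambda>s. Re ((n (\<gamma> s) / \<Delta> \<omega> (\<gamma> s) + r (\<gamma> s)) * \<gamma>'
            s))" .
        define S where "S = {l. \<Delta> \<omega> l \<noteq> 0}"
        have "open (\<Delta> \<omega> -` (- {0}))"
          using holomorphic_on_imp_continuous_on[OF \<Delta>_holomorphic[of \<omega>]] by (intro open_vimage) auto
        then have S: "open S" "path_image \<gamma> \<subseteq> S"
          using nz by (auto simp: S_def vimage_def)
        have "(\<lambda>l. n l / \<Delta> \<omega> l) holomorphic_on S"
          by (intro holomorphic_on_divide holomorphic_on_subset[OF n] holomorphic_on_subset[OF
              \<Delta>_holomorphic]) (auto simp: S_def)
        then have ci1: "(\<lambda>l. n l / \<Delta> \<omega> l) contour_integrable_on \<gamma>"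
          by (rule contour_integrable_holomorphic_simple[OF _ S(1) valid S(2)])
        \<comment> \<open>\<open>Rest\<close> is entire, so Cauchy's theorem removes it and the
          estimate concerns the quotient alone.\<close>
        have ci2: "(r has_contour_integral 0) \<gamma>"
          by (rule Cauchy_theorem_convex_simple[OF r convex_UNIV valid _ loop]) simp
        have "((\<lambda>l. n l / \<Delta> \<omega> l + r l) has_contour_integral (contour_integral \<gamma> (\<lambda>l. n l / \<Delta> \<omega> l) +
            0)) \<gamma>"
          by (intro has_contour_integral_add has_contour_integral_integral ci1 ci2)
        then have "((\<lambda>s. (n (\<gamma> s) / \<Delta> \<omega> (\<gamma> s) + r (\<gamma> s)) * \<gamma>' s)
            has_integral contour_integral \<gamma> (\<lambda>l. n l / \<Delta> \<omega> l)) {0..1}"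
          by (simp add: has_contour_integral_def \<gamma>'_def)
        from has_integral_linear[OF this bounded_linear_Re]
        have "e a \<bullet> b = Re (contour_integral \<gamma> (\<lambda>l. n l / \<Delta> \<omega> l))"
          unfolding e1 by (simp add: comp_def integral_unique)
        also have "\<dots> \<le> cmod (contour_integral \<gamma> (\<lambda>l. n l / \<Delta> \<omega> l))" by (rule complex_Re_le_cmod)
        also have "\<dots> \<le> C * (pair_norm v1 v2 * pair_norm (g1 (force1 f)) (g2 (force2 f)))"
          unfolding n_def by (intro C(2)[OF \<omega> \<gamma>\<Delta>] v1 v2 h1 h2)
        also have "\<dots> \<le> C * ((2 * (2 * K) * norm b) * (2 * K * norm a))"
          using K(1) unfolding a b
          by (intro mult_left_mono mult_mono pair_norm_le v1 v2 h1 h2 C(1)) (auto simp: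
              pair_norm_nonneg)
        also have "\<dots> = C' * norm a * norm b" by (simp add: C'_def)
        finally show ?thesis .
      qed
      have "norm (e a) \<le> C' * norm a" for a
      proof (cases "norm (e a) = 0")
        case False
        have "norm (e a) * norm (e a) \<le> C' * norm a * norm (e a)"
          using bound[of a "e a"] by (simp add: norm_eq_sqrt_inner)
        then show ?thesis using False by simp
      qed (use C'0 in simp)
      then show ?thesis unfolding e_eq by (intro norm_blinfun_bound C'0)
    qed
  qed
  then show ?thesis using that[OF M] by blast
qed

end

theorem theorem2:
  fixes a1 a2 a3 a4 :: "real \<Rightarrow> complex"
  assumes periodic: "\<And>x. a1 (x + pi) = a1 x" "\<And>x. a2 (x + pi) = a2 x"
      "\<And>x. a3 (x + pi) = a3 x" "\<And>x. a4 (x + pi) = a4 x"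
    and bounded_variation: "bounded_variation_on a1 0 pi" "bounded_variation_on a2 0 pi"
      "bounded_variation_on a3 0 pi" "bounded_variation_on a4 0 pi"
    and nonzero: "Re (integral {0..pi} (\<lambda>x. a3 x - a2 x)) \<noteq> 0"
  shows "asymptotically_spectral (\<lambda>x. vector [vector [a1 x, a2 x], vector [a3 x, a4 x]])"
proof -
  interpret dirac_coefficients a1 a2 a3 a4
    using bounded_variation nonzero by unfold_locales (auto intro: damped_on_bounded_variation)
  obtain M C where M: "0 < M" and C: "\<And>t \<gamma>. \<gamma> \<in> closed_contours_in ({z. cmod z > M} \<inter> resolvent_set
      (dirac_operator Q t)) \<Longrightarrow>
    norm (resolvent_contour_integral (dirac_operator Q t) \<gamma>) \<le> C"
    by (rule projections_bounded) blast
  have "(SUP t\<in>{-1<..1}. SUP \<gamma>\<in>closed_contours_in ({z. cmod z > M} \<inter> resolvent_set (dirac_operator Q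
      t)).
      ennreal (norm (resolvent_contour_integral (dirac_operator Q t) \<gamma>))) \<le> ennreal C"
    by (intro SUP_least ennreal_leI C)
  also have "\<dots> < \<infinity>" by simp
  finally show ?thesis
    unfolding asymptotically_spectral_def Q_def[abs_def, symmetric] using M by blast
qed

end
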